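(* Let $\alpha=[a_0;a_1,a_2,\dots]\in\mathbb R$ be irrational, with convergents $p_n/q_n$, such that $a_n\ge2$ for infinitely many $n$ and $$\sum_{\substack{n\ge2\\ a_n,\,a_{n+1}\ge2}}\frac1{\log q_n}=\infty .$$ Then, given any $\mathbf p$ and $\mathbf q$, every reparametrized linear flow $\phi^t$ (in the sense of the context) with angle $\alpha$ and stopping points at $\mathbf p$ and $\mathbf q$ has historic behaviour. When moreover $\mathbf q$ is on the positive orbit of $\mathbf p$ (that is, $\mathbf q=\mathbf p+r(1,\alpha)\bmod\mathbb Z^2$ for some $r>0$), then for $\lambda^2$-almost every $\mathbf x\in\mathbb T^2$, $$p\omega(\mathbf x)=[\mu_\infty,\delta_{\mathbf p}].$$
   Context: $[a_0;a_1,a_2,\dots]$ is the continued fraction expansion and $p_n/q_n=[a_0;a_1,\dots,a_n]$ is the $n$-th convergent in lowest terms, $q_n>0$. Let $\mathbb T^2=\mathbb R^2/\mathbb Z^2$, and let $\lambda^2$ be Lebesgue (Haar) measure on $\mathbb T^2$. A reparametrized linear flow with angle $\alpha$ and stopping points at $\mathbf p$ and $\mathbf q$ is the flow $\phi^t$ on $\mathbb T^2$ generated by a vector field $X=\varphi X_0$ such that: $X_0=(1,\alpha)$ with $\alpha\in\mathbb R$ irrational; $\varphi:\mathbb T^2\to[0,\infty)$ is of class $C^3$; $\varphi$ vanishes at two distinct points $\mathbf p,\mathbf q$ and is positive elsewhere; the Hessians $D^2\varphi(\mathbf p)$ and $D^2\varphi(\mathbf q)$ are positive definite. Put $d_{\mathbf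 p}=\det D^2\varphi(\mathbf p)$, $d_{\mathbf q}=\det D^2\varphi(\mathbf q)$ and $$\mu_\infty=\frac{\sqrt{d_{\mathbf q}}}{\sqrt{d_{\mathbf p}}+\sqrt{d_{\mathbf q}}}\delta_{\mathbf p}+\frac{\sqrt{d_{\mathbf p}}}{\sqrt{d_{\mathbf p}}+\sqrt{d_{\mathbf q}}}\delta_{\mathbf q}.$$ For measures $\mu,\nu$, $[\mu,\nu]=\{s\mu+(1-s)\nu:0\le s\le1\}$. For $\mathbf x\in\mathbb T^2$ and $t>0$ the empirical measure $\mu^t_{\mathbf x}$ is the Borel probability with $\int f\,d\mu^t_{\mathbf x}=\frac1t\int_0^t f(\phi^s(\mathbf x))\,ds$ for continuous $f$, and $p\omega(\mathbf x)=\bigcap_{T>0}\overline{\{\mu^t_{\mathbf x}:t\ge T\}}$ (weak-* closure). The flow has historic behaviour if $p\omega(\mathbf x)$ has at least two elements for $\lambda^2$-a.e. $\mathbf x$. *)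

theory Defs
  imports "HOL-Probability.Probability"
begin

section \<open>The torus and its Haar measure\<close>

definition lattice_equiv :: "real^2 \<Rightarrow> real^2 \<Rightarrow> bool" where
  "lattice_equiv u v \<longleftrightarrow> (\<forall>i. u $ i - v $ i \<in> \<int>)"

lemma equivp_lattice_equiv: "equivp lattice_equiv"
proof (rule equivpI)
  show "reflp lattice_equiv"
    by (simp add: reflp_def lattice_equiv_def)
  show "symp lattice_equiv"
    unfolding symp_def lattice_equiv_def
  proof (intro allI impI)
    fix u v :: "real^2" and i
    assume "\<forall>i. u $ i - v $ i \<in> \<int>"
    then have "- (u $ i - v $ i) \<in> \<int>" by (intro Ints_minus) blast
    then show "v $ i - u $ i \<in> \<int>" by simp
  qed
  show "transp lattice_equiv"
    unfolding transp_def lattice_equiv_def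
  proof (intro allI impI)
    fix u v w :: "real^2" and i
    assume "\<forall>i. u $ i - v $ i \<in> \<int>" "\<forall>i. v $ i - w $ i \<in> \<int>"
    then have "(u $ i - v $ i) + (v $ i - w $ i) \<in> \<int>" by (intro Ints_add) blast+
    then show "u $ i - w $ i \<in> \<int>" by simp
  qed
qed

quotient_type torus = "real^2" / lattice_equiv
  morphisms torus_rep to_torus
  by (rule equivp_lattice_equiv)

instantiation torus :: ab_group_add
begin

lift_definition zero_torus :: torus is 0 .

lift_definition plus_torus :: "torus \<Rightarrow> torus \<Rightarrow> torus" is "(+)"
  unfolding lattice_equiv_def
proof
  fix u u' v v' :: "real^2" and i
  assume "\<forall>i. u $ i - u' $ i \<in> \<int>" "\<forall>i. v $ i - v' $ i \<in> \<int>"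
  then have "(u $ i - u' $ i) + (v $ i - v' $ i) \<in> \<int>" by (intro Ints_add) blast+
  then show "(u + v) $ i - (u' + v') $ i \<in> \<int>" by (simp add: algebra_simps)
qed

lift_definition uminus_torus :: "torus \<Rightarrow> torus" is uminus
  unfolding lattice_equiv_def
proof
  fix u u' :: "real^2" and i
  assume "\<forall>i. u $ i - u' $ i \<in> \<int>"
  then have "- (u $ i - u' $ i) \<in> \<int>" by (intro Ints_minus) blast
  then show "(- u) $ i - (- u') $ i \<in> \<int>" by simp
qed

definition minus_torus :: "torus \<Rightarrow> torus \<Rightarrow> torus" where
  "minus_torus x y = x + (- y)"

instance
proof
  fix x y z :: torus
  show "x + y + z = x + (y + z)"
    by transfer (simp add: lattice_equiv_def)
  show "x + y = y + x"
    by transfer (simp add: lattice_equiv_def)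
  show "0 + x = x"
    by transfer (simp add: lattice_equiv_def)
  show "- x + x = 0"
    by transfer (simp add: lattice_equiv_def)
  show "x - y = x + - y"
    by (rule minus_torus_def)
qed

end

text \<open>The quotient topology; \<open>borel :: torus measure\<close> refers to it.\<close>

instantiation torus :: topological_space
begin

definition open_torus :: "torus set \<Rightarrow> bool" where
  "open_torus U \<longleftrightarrow> open (to_torus -` U)"

instance
proof
  show "open (UNIV :: torus set)"
    by (simp add: open_torus_def)
  show "open (S \<inter> T)" if "open S" "open T" for S T :: "torus set"
    using that by (simp add: open_torus_def open_Int)
  show "open (\<Union>K)" if "\<forall>S\<in>K. open S" for K :: "torus set set"
    using that by (auto simp: open_torus_def vimage_Union)
qed

end

definition haar_torus :: "torus measure" where
  "haar_torus = distr (restrict_space lborel {v. \<forall>i. 0 \<le> v $ i \<and> v $ i < 1}) borel to_torus"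

section \<open>Reparametrized linear flows\<close>

primrec C_times_differentiable :: "nat \<Rightarrow> (real^2 \<Rightarrow> real) \<Rightarrow> bool" where
  "C_times_differentiable 0 f \<longleftrightarrow> continuous_on UNIV f"
| "C_times_differentiable (Suc k) f \<longleftrightarrow>
     (\<forall>x. f differentiable (at x)) \<and>
     (\<forall>v. C_times_differentiable k (\<lambda>x. frechet_derivative f (at x) v))"

definition partial_deriv :: "2 \<Rightarrow> (real^2 \<Rightarrow> real) \<Rightarrow> real^2 \<Rightarrow> real" where
  "partial_deriv i f x = frechet_derivative f (at x) (axis i 1)"

text \<open>The derivatives are those of the \<open>\<int>\<^sup>2\<close>-periodic lift of \<open>f\<close> to the plane, so the choice
  of the representative of \<open>x\<close> is immaterial.\<close>

definition hessian_torus :: "(torus \<Rightarrow> real) \<Rightarrow> torus \<Rightarrow> real^2^2" where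
  "hessian_torus f x =
     (\<chi> i j. partial_deriv i (partial_deriv j (\<lambda>v. f (to_torus v))) (torus_rep x))"

definition positive_definite :: "real^2^2 \<Rightarrow> bool" where
  "positive_definite A \<longleftrightarrow> (\<forall>v. v \<noteq> 0 \<longrightarrow> 0 < v \<bullet> (A *v v))"

definition direction :: "real \<Rightarrow> real^2" where
  "direction \<alpha> = vector [1, \<alpha>]"

text \<open>A vector field on the torus is a map to \<open>\<real>\<^sup>2\<close>, the tangent bundle being trivial; its
  integral curves are the projections of curves \<open>c\<close> in the plane. For \<open>C\<^sup>1\<close> fields they exist for
  all times and are unique, so that \<open>\<Phi>\<close> is then determined by \<open>X\<close> and is a one-parameter group.\<close>

definition generates_flow :: "(torus \<Rightarrow> real^2) \<Rightarrow> (real \<Rightarrow> torus \<Rightarrow> torus) \<Rightarrow> bool" where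
  "generates_flow X \<Phi> \<longleftrightarrow>
     (\<forall>x. \<exists>c. to_torus (c 0) = x \<and>
        (\<forall>t. \<Phi> t x = to_torus (c t) \<and>
             (c has_vector_derivative X (to_torus (c t))) (at t)))"

definition reparametrized_linear_flow ::
    "real \<Rightarrow> torus \<Rightarrow> torus \<Rightarrow> (torus \<Rightarrow> real) \<Rightarrow> (real \<Rightarrow> torus \<Rightarrow> torus) \<Rightarrow> bool" where
  "reparametrized_linear_flow \<alpha> p q \<phi> \<Phi> \<longleftrightarrow>
     \<alpha> \<notin> \<rat> \<and>
     C_times_differentiable 3 (\<lambda>v. \<phi> (to_torus v)) \<and>
     p \<noteq> q \<and> \<phi> p = 0 \<and> \<phi> q = 0 \<and> (\<forall>x. x \<noteq> p \<and> x \<noteq> q \<longrightarrow> 0 < \<phi> x) \<and>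
     positive_definite (hessian_torus \<phi> p) \<and> positive_definite (hessian_torus \<phi> q) \<and>
     generates_flow (\<lambda>x. \<phi> x *\<^sub>R direction \<alpha>) \<Phi>"

section \<open>Measures on the torus\<close>

definition borel_probabilities :: "torus measure set" where
  "borel_probabilities = {\<mu>. sets \<mu> = sets borel \<and> prob_space \<mu>}"

text \<open>The coarsest topology on the Borel probabilities for which \<open>\<mu> \<mapsto> \<integral>f d\<mu>\<close> is
  continuous for every continuous \<open>f\<close>.\<close>

definition weak_star_topology :: "torus measure topology" where
  "weak_star_topology =
     (let C = {f :: torus \<Rightarrow> real. continuous_on UNIV f} in
      pullback_topology borel_probabilities (\<lambda>\<mu>. \<lambda>f\<in>C. \<integral>x. f x \<partial>\<mu>)
        (product_topology (\<lambda>f. euclideanreal) C))"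

definition is_empirical_measure ::
    "(real \<Rightarrow> torus \<Rightarrow> torus) \<Rightarrow> torus \<Rightarrow> real \<Rightarrow> torus measure \<Rightarrow> bool" where
  "is_empirical_measure \<Phi> x t \<mu> \<longleftrightarrow>
     \<mu> \<in> borel_probabilities \<and>
     (\<forall>f :: torus \<Rightarrow> real. continuous_on UNIV f \<longrightarrow>
        (\<integral>y. f y \<partial>\<mu>) = 1 / t * integral {0..t} (\<lambda>s. f (\<Phi> s x)))"

definition p_omega :: "(real \<Rightarrow> torus \<Rightarrow> torus) \<Rightarrow> torus \<Rightarrow> torus measure set" where
  "p_omega \<Phi> x =
     (\<Inter>T\<in>{0<..}. weak_star_topology closure_of {\<mu>. \<exists>t\<ge>T. is_empirical_measure \<Phi> x t \<mu>})"

definition historic_behaviour :: "(real \<Rightarrow> torus \<Rightarrow> torus) \<Rightarrow> bool" where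
  "historic_behaviour \<Phi> \<longleftrightarrow>
     (AE x in haar_torus. \<exists>\<mu>\<in>p_omega \<Phi> x. \<exists>\<nu>\<in>p_omega \<Phi> x. \<mu> \<noteq> \<nu>)"

text \<open>The measure \<open>a \<mu> + b \<nu>\<close>, for \<open>a, b \<ge> 0\<close> and Borel measures \<open>\<mu>, \<nu>\<close>.\<close>

definition lincomb_measure ::
    "real \<Rightarrow> torus measure \<Rightarrow> real \<Rightarrow> torus measure \<Rightarrow> torus measure" where
  "lincomb_measure a \<mu> b \<nu> =
     measure_of UNIV (sets borel) (\<lambda>A. ennreal a * emeasure \<mu> A + ennreal b * emeasure \<nu> A)"

lemma emeasure_lincomb_measure:
  assumes "sets \<mu> = sets borel" "sets \<nu> = sets borel" "A \<in> sets borel"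
  shows "emeasure (lincomb_measure a \<mu> b \<nu>) A = ennreal a * emeasure \<mu> A + ennreal b * emeasure \<nu> A"
  unfolding lincomb_measure_def
proof (rule emeasure_measure_of_sigma)
  show "sigma_algebra UNIV (sets (borel :: torus measure))"
    by (metis sets.sigma_algebra_axioms space_borel)
  show "positive (sets borel) (\<lambda>A. ennreal a * emeasure \<mu> A + ennreal b * emeasure \<nu> A)"
    by (simp add: positive_def)
  show "countably_additive (sets borel)
      (\<lambda>A. ennreal a * emeasure \<mu> A + ennreal b * emeasure \<nu> A)"
    unfolding countably_additive_def
  proof (intro allI impI)
    fix B :: "nat \<Rightarrow> torus set"
    assume "range B \<subseteq> sets borel" "disjoint_family B"
    then have "(\<Sum>i. emeasure \<mu> (B i)) = emeasure \<mu> (\<Union>i. B i)"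
      and "(\<Sum>i. emeasure \<nu> (B i)) = emeasure \<nu> (\<Union>i. B i)"
      using assms by (simp_all add: suminf_emeasure)
    then show "(\<Sum>i. ennreal a * emeasure \<mu> (B i) + ennreal b * emeasure \<nu> (B i)) =
        ennreal a * emeasure \<mu> (\<Union> (range B)) + ennreal b * emeasure \<nu> (\<Union> (range B))"
      by (simp add: suminf_add[symmetric])
  qed
qed (use assms in auto)

definition measure_segment :: "torus measure \<Rightarrow> torus measure \<Rightarrow> torus measure set" where
  "measure_segment \<mu> \<nu> = {lincomb_measure s \<mu> (1 - s) \<nu> | s. 0 \<le> s \<and> s \<le> 1}"

definition dirac :: "torus \<Rightarrow> torus measure" where
  "dirac x = return borel x"

definition mu_infinity :: "(torus \<Rightarrow> real) \<Rightarrow> torus \<Rightarrow> torus \<Rightarrow> torus measure" where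
  "mu_infinity \<phi> p q =
     (let d\<^sub>p = det (hessian_torus \<phi> p); d\<^sub>q = det (hessian_torus \<phi> q) in
      lincomb_measure (sqrt d\<^sub>q / (sqrt d\<^sub>p + sqrt d\<^sub>q)) (dirac p)
                      (sqrt d\<^sub>p / (sqrt d\<^sub>p + sqrt d\<^sub>q)) (dirac q))"

section \<open>Continued fractions\<close>

fun cfrac_value :: "int list \<Rightarrow> rat" where
  "cfrac_value [] = 0"
| "cfrac_value [a] = of_int a"
| "cfrac_value (a # b # as) = of_int a + 1 / cfrac_value (b # as)"

definition convergent_cfrac :: "(nat \<Rightarrow> int) \<Rightarrow> nat \<Rightarrow> rat" where
  "convergent_cfrac a n = cfrac_value (map a [0..<Suc n])"

text \<open>\<open>quotient_of\<close> yields the representation in lowest terms with positive denominator.\<close>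

definition convergent_denom :: "(nat \<Rightarrow> int) \<Rightarrow> nat \<Rightarrow> int" where
  "convergent_denom a n = snd (quotient_of (convergent_cfrac a n))"

definition has_cfrac_expansion :: "real \<Rightarrow> (nat \<Rightarrow> int) \<Rightarrow> bool" where
  "has_cfrac_expansion \<alpha> a \<longleftrightarrow>
     (\<forall>n\<ge>1. 1 \<le> a n) \<and> (\<lambda>n. real_of_rat (convergent_cfrac a n)) \<longlonglongrightarrow> \<alpha>"

end

theory Submission
  imports Defs
begin

text \<open>
  Let \<open>\<psi>\<close> be the lift of \<open>\<phi>\<close>. A stretch of the line \<open>x + l (1, \<alpha>)\<close> takes time \<open>\<integral>1 / \<psi> dl\<close>, and a passage at
  height \<open>w\<close> above \<open>p\<close> takes time asymptotic to \<open>2 \<pi> / (\<surd>d\<^sub>p \<bar>w\<bar>)\<close>. The time spent near \<open>p\<close> is therefore a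
  Birkhoff sum of \<open>1 / \<bar>w\<bar>\<close> over the rotation by \<open>\<alpha>\<close>. It grows superlinearly, so every limit of empirical measures
  is a combination of \<open>\<delta>\<^sub>p\<close> and \<open>\<delta>\<^sub>q\<close>, determined by the share of time spent near \<open>p\<close>.

  If \<open>a\<^sub>n\<^sub>+\<^sub>1 \<ge> 2\<close> then \<open>Q = q\<^sub>n\<close> satisfies \<open>\<bar>\<alpha> - p\<^sub>n / Q\<bar> \<le> 1 / (2 Q\<^sup>2)\<close>, which makes \<open>Q\<close> consecutive orbit points
  \<open>1 / (2 Q)\<close>-separated; without a visit closer than \<open>1 / (Q log Q)\<close> both Birkhoff sums up to time \<open>Q\<close> are of
  order \<open>Q log Q\<close>. Such times occur for almost every point, and then the share is bounded away from 0 and 1.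
  By divergence of the series of \<open>1 / log q\<^sub>n\<close>, almost every point also has, for every \<open>\<epsilon>\<close>, infinitely many visits
  closer than \<open>\<epsilon> / (Q log Q)\<close> to a given stopping point before time \<open>Q / 4\<close>. For each large \<open>Q\<close> one of the two points
  cannot be preceded by an equally close visit to the other one, so that the share comes close to 1 or to 0
  along a subsequence.

  If \<open>q = p + r (1, \<alpha>)\<close>, every passage near \<open>q\<close> repeats one near \<open>p\<close> at the same height. This bounds the share
  of \<open>p\<close> from below by that of \<open>\<mu>\<^sub>\<infinity>\<close> and, as the sums are not of exponential growth, the bound is attained.
\<close>

section \<open>Distance to the nearest integer and good rational approximations\<close>

text \<open>Geometry replaces it: the points that avoided the earlier targets form boundedly many
  intervals relative to the next scale, and each long interval contains its fair proportion of the
  next target.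

  The threshold \<open>1 / (Q ln Q)\<close> balances two effects. One passage at that height lasts
  as long, up to a constant, as the other \<open>Q\<close> passages together; and the points with
  such a visit before time \<open>Q\<close> have measure of order \<open>1 / ln Q\<close>, the term
  of the series.

  A cutoff \<open>h\<close>, equal to 1 near \<open>p\<close> and 0 near \<open>q\<close>, splits
  \<open>1 / \<phi>\<close> into two densities with one singularity each. The time average of
  \<open>h\<close> is the share of \<open>p\<close>, and the integral of \<open>h\<close> identifies
  a measure carried by \<open>p\<close> and \<open>q\<close>, so weak-* limits reduce to the cluster
  values of one real function.

  Which of the two points is approached alone may vary with \<open>Q\<close>. This depends only on
  \<alpha>, \<open>p\<close> and \<open>q\<close>, so a subsequence of scales with a constant answer
  and a divergent series is fixed before any null set is discarded.\<close>

definition dist_int :: "real \<Rightarrow> real" where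
  "dist_int x = \<bar>x - of_int (round x)\<bar>"

lemma dist_int_le: "dist_int x \<le> \<bar>x - of_int n\<bar>"
  unfolding dist_int_def by (rule round_diff_minimal)

lemma dist_int_nonneg [simp]: "0 \<le> dist_int x"
  by (simp add: dist_int_def)

lemma dist_int_le_abs: "dist_int x \<le> \<bar>x\<bar>"
  using dist_int_le[of x 0] by simp

lemma dist_int_obtain: obtains n :: int where "dist_int x = \<bar>x - of_int n\<bar>"
  unfolding dist_int_def by blast

lemma dist_int_add_int [simp]: "dist_int (x + of_int n) = dist_int x"
proof (rule antisym)
  obtain k where k: "dist_int x = \<bar>x - of_int k\<bar>" by (rule dist_int_obtain)
  show "dist_int (x + of_int n) \<le> dist_int x"
    using dist_int_le[of "x + of_int n" "k + n"] k by simp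
  obtain k where k: "dist_int (x + of_int n) = \<bar>x + of_int n - of_int k\<bar>" by (rule dist_int_obtain)
  show "dist_int x \<le> dist_int (x + of_int n)"
    using dist_int_le[of x "k - n"] k by (simp add: algebra_simps)
qed

lemma dist_int_diff_int [simp]: "dist_int (x - of_int n) = dist_int x"
  using dist_int_add_int[of x "- n"] by simp

lemma dist_int_minus [simp]: "dist_int (- x) = dist_int x"
proof -
  have "dist_int (- x) \<le> dist_int x" for x
  proof -
    obtain k where k: "dist_int x = \<bar>x - of_int k\<bar>" by (rule dist_int_obtain)
    then show ?thesis using dist_int_le[of "- x" "- k"] by simp
  qed
  from this[of x] this[of "- x"] show ?thesis by simp
qed

lemma dist_int_triangle: "dist_int (x + y) \<le> dist_int x + dist_int y"
proof -
  obtain k where k: "dist_int x = \<bar>x - of_int k\<bar>" by (rule dist_int_obtain)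
  obtain l where l: "dist_int y = \<bar>y - of_int l\<bar>" by (rule dist_int_obtain)
  show ?thesis using dist_int_le[of "x + y" "k + l"] k l by simp
qed

lemma dist_int_triangle_diff: "dist_int (x - y) \<le> dist_int x + dist_int y"
  using dist_int_triangle[of x "- y"] by simp

lemma dist_int_lipschitz: "\<bar>dist_int x - dist_int y\<bar> \<le> \<bar>x - y\<bar>"
  using dist_int_triangle[of "x - y" y] dist_int_triangle[of "y - x" x] dist_int_le_abs[of "x - y"] dist_int_le_abs[of "y - x"]
  by simp

lemma dist_int_eq_0_iff: "dist_int x = 0 \<longleftrightarrow> x \<in> \<int>"
proof
  assume "dist_int x = 0"
  then have "x = of_int (round x)" by (simp add: dist_int_def)
  then show "x \<in> \<int>" by (metis Ints_of_int)
next
  assume "x \<in> \<int>"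
  then show "dist_int x = 0" by (auto simp: dist_int_def elim!: Ints_cases)
qed

lemma dist_int_pos_iff: "0 < dist_int x \<longleftrightarrow> x \<notin> \<int>"
  using dist_int_eq_0_iff[of x] dist_int_nonneg[of x] by linarith

lemma continuous_on_dist_int: "continuous_on S dist_int"
proof (rule continuous_onI)
  fix x \<epsilon> :: real assume "0 < \<epsilon>" "x \<in> S"
  have "dist (dist_int x') (dist_int x) \<le> \<epsilon>" if "dist x' x < \<epsilon>" for x'
    using dist_int_lipschitz[of x' x] that by (simp add: dist_real_def)
  then show "\<exists>\<delta>>0. \<forall>x'\<in>S. dist x' x < \<delta> \<longrightarrow> dist (dist_int x') (dist_int x) \<le> \<epsilon>"
    using \<open>0 < \<epsilon>\<close> by blast
qed

lemma dist_int_measurable [measurable]: "dist_int \<in> borel_measurable borel"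
  by (rule borel_measurable_continuous_onI[OF continuous_on_dist_int])

lemma dist_int_frac: "dist_int x = min (frac x) (1 - frac x)"
proof -
  have f: "frac x = x - of_int \<lfloor>x\<rfloor>" by (simp add: frac_def)
  have b: "0 \<le> frac x" "frac x < 1" by (simp_all add: frac_lt_1)
  have 1: "dist_int x \<le> frac x" using dist_int_le[of x "\<lfloor>x\<rfloor>"] f b by simp
  have 2: "dist_int x \<le> 1 - frac x" using dist_int_le[of x "\<lfloor>x\<rfloor> + 1"] f b by simp
  obtain k where k: "dist_int x = \<bar>x - of_int k\<bar>" by (rule dist_int_obtain)
  have "min (frac x) (1 - frac x) \<le> dist_int x"
  proof (cases "k \<le> \<lfloor>x\<rfloor>")
    case True
    then have "real_of_int k \<le> of_int \<lfloor>x\<rfloor>" by simp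
    then show ?thesis using k f b by linarith
  next
    case False
    then have "real_of_int k \<ge> of_int \<lfloor>x\<rfloor> + 1" by linarith
    then show ?thesis using k f b by linarith
  qed
  with 1 2 show ?thesis by simp
qed

text \<open>With the factor 1/2, \<open>k \<alpha>\<close> differs from \<open>k P / Q\<close> by at
  most half the grid spacing \<open>1 / Q\<close> for all \<open>k \<le> Q\<close>. This is the only
  arithmetic information about \<alpha> that the dynamical part uses.\<close>

definition good_approx :: "real \<Rightarrow> nat \<Rightarrow> bool" where
  "good_approx \<alpha> Q \<longleftrightarrow> Q \<ge> 1 \<and>
     (\<exists>P::int. coprime P (int Q) \<and> \<bar>\<alpha> - of_int P / real Q\<bar> \<le> 1 / (2 * (real Q)\<^sup>2))"

text \<open>As \<open>Q\<close> does not divide \<open>m P\<close>, the number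
  \<open>m P / Q\<close> is at least \<open>1 / Q\<close> away from the integers; replacing
  \<open>P / Q\<close> by \<alpha> costs at most half of that.\<close>

lemma good_approx_separated:
  assumes "good_approx \<alpha> Q" "m \<noteq> 0" "\<bar>m\<bar> < int Q"
  shows "dist_int (of_int m * \<alpha>) \<ge> 1 / (2 * real Q)"
proof -
  from assms obtain P where P: "coprime P (int Q)"
    "\<bar>\<alpha> - of_int P / real Q\<bar> \<le> 1 / (2 * (real Q)\<^sup>2)" and Q: "Q \<ge> 1"
    unfolding good_approx_def by blast
  obtain n where n: "dist_int (of_int m * \<alpha>) = \<bar>of_int m * \<alpha> - of_int n\<bar>" by (rule dist_int_obtain)
  have "m * P - n * int Q \<noteq> 0"
  proof
    assume "m * P - n * int Q = 0"
    then have "int Q dvd m * P" by (metis dvd_triv_right eq_iff_diff_eq_0)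
    then have "int Q dvd m" using P(1) by (simp add: coprime_commute coprime_dvd_mult_left_iff)
    then have "int Q \<le> \<bar>m\<bar>" using assms(2) dvd_imp_le_int[of m "int Q"] by simp
    then show False using assms(3) by simp
  qed
  then have "\<bar>m * P - n * int Q\<bar> \<ge> 1" by linarith
  then have "real_of_int \<bar>m * P - n * int Q\<bar> \<ge> 1" by linarith
  then have "\<bar>of_int m * (of_int P) - of_int n * real Q\<bar> \<ge> (1::real)" by simp
  moreover have "of_int m * (of_int P / real Q) - of_int n = (of_int m * of_int P - of_int n * real Q) / real Q"
    using Q by (simp add: field_simps)
  ultimately have 1: "\<bar>of_int m * (of_int P / real Q) - of_int n\<bar> \<ge> 1 / real Q"
    using Q by (simp add: abs_divide divide_right_mono)
  have "\<bar>real_of_int m\<bar> \<le> real Q" using assms(3) by linarith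
  then have "\<bar>real_of_int m * (\<alpha> - of_int P / real Q)\<bar> \<le> real Q * (1 / (2 * (real Q)\<^sup>2))"
    unfolding abs_mult by (intro mult_mono P(2)) auto
  also have "\<dots> = 1 / (2 * real Q)" using Q by (simp add: power2_eq_square)
  finally have 2: "\<bar>real_of_int m * \<alpha> - of_int m * (of_int P / real Q)\<bar> \<le> 1 / (2 * real Q)"
    by (simp add: algebra_simps)
  have "e \<le> \<bar>a - c\<bar>" if "2 * e \<le> \<bar>b - c\<bar>" "\<bar>a - b\<bar> \<le> e" for a b c e :: real
    using that by linarith
  from this[OF _ 2, of "of_int n"] 1 n show ?thesis by simp
qed

lemma harm_le_ln: "n \<ge> 1 \<Longrightarrow> (\<Sum>k=1..n. 1 / real k) \<le> 1 + ln (real n)"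
proof (induction n rule: dec_induct)
  case (step n)
  have "ln (real n / real (Suc n)) \<le> real n / real (Suc n) - 1"
    using step by (intro ln_le_minus_one) auto
  also have "\<dots> = - (1 / real (Suc n))" by (simp add: field_simps)
  finally have "1 / real (Suc n) \<le> ln (real (Suc n)) - ln (real n)"
    using step by (simp add: ln_div)
  with step show ?case by simp
qed simp

text \<open>The points are \<open>1 / (2 Q)\<close>-separated, so each cell of length \<open>1 / (2 Q)\<close> contains at most one of them.\<close>

lemma good_approx_sum_le:
  assumes ga: "good_approx \<alpha> Q" and "finite K"
    and diff: "\<And>k l. k \<in> K \<Longrightarrow> l \<in> K \<Longrightarrow> \<bar>k - l\<bar> < int Q"
    and far: "\<And>k. k \<in> K \<Longrightarrow> dist_int (y + of_int k * \<alpha>) \<ge> \<delta>" and "\<delta> > 0"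
  shows "(\<Sum>k\<in>K. 1 / dist_int (y + of_int k * \<alpha>)) \<le> 2 / \<delta> + 4 * real Q * (1 + ln (2 * real Q))"
proof -
  have Q: "Q \<ge> 1" using ga by (simp add: good_approx_def)
  define c where "c k = nat \<lfloor>2 * real Q * frac (y + of_int k * \<alpha>)\<rfloor>" for k :: int
  have c_bounds: "real (c k) \<le> 2 * real Q * frac (y + of_int k * \<alpha>)"
    "2 * real Q * frac (y + of_int k * \<alpha>) < real (c k) + 1" for k
    unfolding c_def by (simp_all add: frac_ge_0)
  have c_lt: "c k < 2 * Q" for k
  proof -
    have "2 * real Q * frac (y + of_int k * \<alpha>) < 2 * real Q * 1"
      using Q by (intro mult_strict_left_mono) (auto simp: frac_lt_1)
    then have "real (c k) < real (2 * Q)" using c_bounds[of k] by simp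
    then show ?thesis by linarith
  qed
  have inj: "inj_on c K"
  proof (rule inj_onI, rule ccontr)
    fix k l assume kl: "k \<in> K" "l \<in> K" "c k = c l" "k \<noteq> l"
    let ?d = "frac (y + of_int k * \<alpha>) - frac (y + of_int l * \<alpha>)"
    have "2 * real Q * \<bar>?d\<bar> < 1"
    proof -
      have "\<bar>2 * real Q * ?d\<bar> < 1"
        using c_bounds[of k] c_bounds[of l] kl(3) by (simp add: algebra_simps abs_less_iff)
      then show ?thesis by (simp add: abs_mult)
    qed
    then have "\<bar>?d\<bar> < 1 / (2 * real Q)" using Q by (simp add: field_simps)
    moreover have "dist_int (of_int (k - l) * \<alpha>) \<le> \<bar>?d\<bar>"
      using dist_int_le[of "of_int (k - l) * \<alpha>" "\<lfloor>y + of_int k * \<alpha>\<rfloor> - \<lfloor>y + of_int l * \<alpha>\<rfloor>"]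
      by (simp add: frac_def algebra_simps)
    ultimately show False
      using good_approx_separated[OF ga, of "k - l"] kl diff[OF kl(1,2)] by auto
  qed
  \<comment> \<open>A bound for the inverse distance to the integer on the left in terms of the cell
    number. Cell 0 gives no information, and there the assumed lower bound \<open>\<delta>\<close>
    is used.\<close>
  define g where "g i = (if i = 0 then 1 / \<delta> else 2 * real Q / real i)" for i :: nat
  have g0: "g i \<ge> 0" for i using \<open>\<delta> > 0\<close> by (simp add: g_def)
  \<comment> \<open>The nearest integer lies either to the left, with cell number
    \<open>c k\<close>, or to the right, with reflected number \<open>2 * Q - 1 - c k\<close>.
    Adding both values of \<open>g\<close> avoids deciding which, and the reflection permutes the
    cells, so the total only doubles.\<close>
  have bound: "1 / dist_int (y + of_int k * \<alpha>) \<le> g (c k) + g (2 * Q - 1 - c k)" if "k \<in> K" for k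
  proof -
    let ?f = "frac (y + of_int k * \<alpha>)"
    have d: "dist_int (y + of_int k * \<alpha>) = min ?f (1 - ?f)" by (rule dist_int_frac)
    have dpos: "dist_int (y + of_int k * \<alpha>) > 0" using far[OF that] \<open>\<delta> > 0\<close> by simp
    have inv: "1 / dist_int (y + of_int k * \<alpha>) \<le> 1 / \<delta>" using far[OF that] \<open>\<delta> > 0\<close>
      by (simp add: frac_le)
    have A: "1 / dist_int (y + of_int k * \<alpha>) \<le> g (c k)" if "dist_int (y + of_int k * \<alpha>) = ?f"
    proof (cases "c k = 0")
      case False
      have "1 / ?f \<le> 2 * real Q / real (c k)"
        using False c_bounds(1)[of k] dpos that by (simp add: field_simps)
      then show ?thesis using that False by (simp add: g_def)
    qed (use inv in \<open>simp add: g_def\<close>)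
    have B: "1 / dist_int (y + of_int k * \<alpha>) \<le> g (2 * Q - 1 - c k)" if "dist_int (y + of_int k * \<alpha>) = 1 - ?f"
    proof (cases "2 * Q - 1 - c k = 0")
      case False
      have r: "real (2 * Q - 1 - c k) = 2 * real Q - 1 - real (c k)"
        using c_lt[of k] by (simp add: of_nat_diff)
      have "real (2 * Q - 1 - c k) \<le> 2 * real Q * (1 - ?f)"
        unfolding r using c_bounds(2)[of k] by (simp add: algebra_simps)
      then have "1 / (1 - ?f) \<le> 2 * real Q / real (2 * Q - 1 - c k)"
        using False dpos that by (simp add: field_simps)
      then show ?thesis using that False by (simp add: g_def)
    qed (use inv in \<open>simp add: g_def\<close>)
    show ?thesis using A B d g0[of "c k"] g0[of "2 * Q - 1 - c k"] by (auto simp: min_def split: if_splits)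
  qed
  have "(\<Sum>k\<in>K. 1 / dist_int (y + of_int k * \<alpha>)) \<le> (\<Sum>k\<in>K. g (c k) + g (2 * Q - 1 - c k))"
    by (rule sum_mono) (rule bound)
  also have "\<dots> = (\<Sum>i\<in>c ` K. g i + g (2 * Q - 1 - i))"
    by (simp add: sum.reindex[OF inj])
  also have "\<dots> \<le> (\<Sum>i<2 * Q. g i + g (2 * Q - 1 - i))"
    using c_lt g0 by (intro sum_mono2) (auto intro: add_nonneg_nonneg)
  also have "\<dots> = 2 * (\<Sum>i<2 * Q. g i)"
    using sum.nat_diff_reindex[of g "2 * Q"] by (simp add: sum.distrib)
  also have "(\<Sum>i<2 * Q. g i) = 1 / \<delta> + (\<Sum>i=1..2 * Q - 1. 2 * real Q / real i)"
  proof -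
    have "{..<2 * Q} = insert 0 {1..2 * Q - 1}" using Q by auto
    then show ?thesis by (simp add: g_def)
  qed
  also have "(\<Sum>i=1..2 * Q - 1. 2 * real Q / real i) \<le> (\<Sum>i=1..2 * Q. 2 * real Q * (1 / real i))"
    by (simp, intro sum_mono2) auto
  also have "\<dots> \<le> 2 * real Q * (1 + ln (2 * real Q))"
    unfolding sum_distrib_left[symmetric] using harm_le_ln[of "2 * Q"] Q by (intro mult_left_mono) auto
  finally show ?thesis by (simp add: algebra_simps)
qed

text \<open>Multiplication by \<open>P\<close> is invertible modulo \<open>Q\<close>, so
  \<open>Q\<close> consecutive points of the rotation by \<open>P / Q\<close> run once through the
  grid of step \<open>1 / Q\<close>, also after a shift by \<open>j\<close>.\<close>

lemma bij_betw_residues: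
  assumes "coprime P (int Q)" "Q \<ge> 1"
  shows "bij_betw (\<lambda>k. nat ((int k * P + j) mod int Q)) {..<Q} {..<Q}"
proof -
  let ?r = "\<lambda>k. nat ((int k * P + j) mod int Q)"
  have r_lt: "?r k < Q" for k using assms by (simp add: nat_less_iff)
  have inj: "inj_on ?r {..<Q}"
  proof (rule inj_onI)
    fix k l assume kl: "k \<in> {..<Q}" "l \<in> {..<Q}" "?r k = ?r l"
    then have "(int k * P + j) mod int Q = (int l * P + j) mod int Q"
      using assms(2) by (simp add: nat_eq_iff)
    then have "int Q dvd (int k * P + j) - (int l * P + j)" by (simp add: mod_eq_dvd_iff)
    then have "int Q dvd (int k - int l) * P" by (simp add: algebra_simps)
    then have d: "int Q dvd int k - int l"
      using assms(1) by (simp add: coprime_commute coprime_dvd_mult_left_iff)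
    show "k = l"
    proof (rule ccontr)
      assume "k \<noteq> l"
      then have "int Q \<le> \<bar>int k - int l\<bar>" using dvd_imp_le_int[OF _ d] by simp
      with kl show False by auto
    qed
  qed
  moreover have "?r ` {..<Q} = {..<Q}"
    using inj r_lt by (intro endo_inj_surj) auto
  ultimately show ?thesis by (simp add: bij_betw_def)
qed

text \<open>A point with residue \<open>r\<close> is within \<open>(r + 2) / Q\<close> of an
  integer: \<open>r / Q\<close> on the grid, less than \<open>1 / Q\<close> from rounding
  \<open>y\<close> down to the grid, at most \<open>1 / (2 Q)\<close> from \<alpha>. Each residue
  occurs once, so the sum dominates \<open>Q\<close> times a harmonic sum, wherever the orbit
  starts.\<close>

lemma good_approx_sum_ge:
  assumes ga: "good_approx \<alpha> Q" and off: "\<And>k::nat. y + real k * \<alpha> \<notin> \<int>"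
  shows "(\<Sum>k<Q. 1 / dist_int (y + real k * \<alpha>)) \<ge> real Q * (ln (real Q) - 1)"
proof -
  from ga obtain P where P: "coprime P (int Q)"
    "\<bar>\<alpha> - of_int P / real Q\<bar> \<le> 1 / (2 * (real Q)\<^sup>2)" and Q: "Q \<ge> 1"
    unfolding good_approx_def by blast
  define j where "j = \<lfloor>real Q * y\<rfloor>"
  define r where "r k = nat ((int k * P + j) mod int Q)" for k :: nat
  have inj: "inj_on r {..<Q}" and surj: "r ` {..<Q} = {..<Q}"
    using bij_betw_residues[OF P(1) Q, of j] by (simp_all add: bij_betw_def r_def[abs_def])
  have bound: "1 / dist_int (y + real k * \<alpha>) \<ge> real Q / (real (r k) + 2)" if "k < Q" for k
  proof -
    have "int (r k) = (int k * P + j) mod int Q" using Q by (simp add: r_def)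
    then have "int k * P + j = (int k * P + j) div int Q * int Q + int (r k)" by simp
    then obtain m where m: "int k * P + j = m * int Q + int (r k)" by blast
    have "real_of_int (int k * P + j) = of_int (m * int Q + int (r k))" using m by simp
    then have m': "real k * of_int P + of_int j = of_int m * real Q + real (r k)" by simp
    have e: "\<bar>real k * (\<alpha> - of_int P / real Q)\<bar> \<le> real Q * (1 / (2 * (real Q)\<^sup>2))"
      using that unfolding abs_mult by (intro mult_mono P(2)) auto
    then have e: "\<bar>real k * (\<alpha> - of_int P / real Q)\<bar> \<le> (1 / 2) / real Q"
      using Q by (simp add: power2_eq_square)
    have "\<bar>real Q * (real k * (\<alpha> - of_int P / real Q))\<bar> \<le> 1 / 2"
      using mult_left_mono[OF e, of "real Q"] Q by (simp add: abs_mult)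
    moreover have "real Q * (real k * (\<alpha> - of_int P / real Q)) = real Q * real k * \<alpha> - real k * of_int P"
      using Q by (simp add: field_simps)
    moreover have "0 \<le> real Q * y - of_int j" "real Q * y - of_int j < 1" unfolding j_def by linarith+
    ultimately have "\<bar>real Q * y + real Q * real k * \<alpha> - of_int m * real Q\<bar> \<le> real (r k) + 2"
      using m' by linarith
    then have "real Q * \<bar>y + real k * \<alpha> - of_int m\<bar> \<le> real (r k) + 2"
    proof -
      have "real Q * \<bar>y + real k * \<alpha> - of_int m\<bar> = \<bar>real Q * (y + real k * \<alpha> - of_int m)\<bar>"
        by (simp add: abs_mult)
      also have "real Q * (y + real k * \<alpha> - of_int m) = real Q * y + real Q * real k * \<alpha> - of_int m * real Q"
        by (simp add: algebra_simps)
      finally show ?thesis using \<open>\<bar>real Q * y + real Q * real k * \<alpha> - of_int m * real Q\<bar> \<le> real (r k) + 2\<close> by simp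
    qed
    moreover have "real Q * dist_int (y + real k * \<alpha>) \<le> real Q * \<bar>y + real k * \<alpha> - of_int m\<bar>"
      by (intro mult_left_mono dist_int_le) simp
    ultimately have "real Q * dist_int (y + real k * \<alpha>) \<le> real (r k) + 2" by linarith
    moreover have "dist_int (y + real k * \<alpha>) > 0" using off by (simp add: dist_int_pos_iff)
    ultimately show ?thesis by (simp add: field_simps)
  qed
  have "ln (real Q) - 1 \<le> (\<Sum>i<Q. 1 / (real i + 2))"
  proof -
    have "(\<Sum>i<n. 1 / (real i + 2)) = harm (Suc n) - 1" for n
      by (induction n) (simp_all add: harm_Suc harm_expand inverse_eq_divide add_ac)
    moreover have "ln (real Q) \<le> ln (real (Suc Q) + 1)" using Q by simp
    ultimately show ?thesis using ln_le_harm[of "Suc Q"] by simp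
  qed
  then have "real Q * (ln (real Q) - 1) \<le> real Q * (\<Sum>i<Q. 1 / (real i + 2))"
    by (intro mult_left_mono) auto
  also have "\<dots> = (\<Sum>i\<in>r ` {..<Q}. real Q / (real i + 2))" by (simp add: surj sum_distrib_left)
  also have "\<dots> = (\<Sum>k<Q. real Q / (real (r k) + 2))" by (simp add: sum.reindex[OF inj])
  also have "\<dots> \<le> (\<Sum>k<Q. 1 / dist_int (y + real k * \<alpha>))" by (rule sum_mono) (use bound in simp)
  finally show ?thesis .
qed

section \<open>Hitting times of a shrinking target\<close>

text \<open>Every grid point \<open>J / Q\<close> is reached by some index below \<open>Q\<close>,
  and distinct grid points of an interval of length at most 1 have distinct indices. The numbers
  counted are the starting points, up to the shift \<open>\<beta>\<close>, whose orbit meets the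
  integers at step \<open>k\<close>.\<close>

lemma count_orbit_in_interval:
  assumes "good_approx \<alpha> Q" and "a \<le> b" "b - a \<le> 1"
  shows "real (card {k. k < Q \<and> (\<exists>n::int. of_int n - real k * \<alpha> - \<beta> \<in> {a..b})}) \<ge> real Q * (b - a) - 2"
proof -
  from assms obtain P where P: "coprime P (int Q)"
    "\<bar>\<alpha> - of_int P / real Q\<bar> \<le> 1 / (2 * (real Q)\<^sup>2)" and Q: "Q \<ge> 1"
    unfolding good_approx_def by blast
  \<comment> \<open>\<open>A\<close> and \<open>B\<close> are the ends of the interval in units of
    \<open>1 / Q\<close>, drawn in by 1/2, the largest displacement caused by replacing \<alpha> by
    \<open>P / Q\<close>. Rounding to integers costs one more, which explains the loss of 2.\<close>
  define A where "A = real Q * (a + \<beta>) + 1 / 2"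
  define B where "B = real Q * (b + \<beta>) - 1 / 2"
  let ?S = "{k. k < Q \<and> (\<exists>n::int. of_int n - real k * \<alpha> - \<beta> \<in> {a..b})}"
  have ex: "\<exists>k n. k < Q \<and> int k * P + J = n * int Q" for J
  proof -
    have "0 \<in> {..<Q}" using Q by simp
    then obtain k where "k < Q" "nat ((int k * P + J) mod int Q) = 0"
      using bij_betw_residues[OF P(1) Q, of J] unfolding bij_betw_def by (metis (no_types, lifting) imageE lessThan_iff)
    moreover have "(int k * P + J) mod int Q \<ge> 0" using Q by simp
    ultimately have "(int k * P + J) mod int Q = 0" by simp
    then have "int k * P + J = (int k * P + J) div int Q * int Q"
      by (simp add: minus_mod_eq_div_mult[symmetric])
    with \<open>k < Q\<close> show ?thesis by blast
  qed
  then obtain k n where kn: "k J < Q" "int (k J) * P + J = n J * int Q" for J by metis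
  have inj: "inj_on k {\<lceil>A\<rceil>..\<lfloor>B\<rfloor>}"
  proof (rule inj_onI, rule ccontr)
    fix J L assume JL: "J \<in> {\<lceil>A\<rceil>..\<lfloor>B\<rfloor>}" "L \<in> {\<lceil>A\<rceil>..\<lfloor>B\<rfloor>}" "k J = k L" "J \<noteq> L"
    have "J - L = n J * int Q - n L * int Q" using kn(2)[of J] kn(2)[of L] JL(3) by simp
    then have "int Q dvd J - L" by (metis dvd_diff dvd_triv_right)
    then have "int Q \<le> \<bar>J - L\<bar>" using dvd_imp_le_int[of "J - L" "int Q"] JL(4) by simp
    then have "real Q \<le> \<bar>real_of_int J - real_of_int L\<bar>" by linarith
    moreover have "A \<le> J" "A \<le> L" "J \<le> B" "L \<le> B" using JL by (auto simp: ceiling_le_iff le_floor_iff)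
    moreover have "B - A \<le> real Q * 1 - 1"
      using mult_left_mono[OF assms(3), of "real Q"] unfolding A_def B_def by (simp add: algebra_simps)
    ultimately show False by linarith
  qed
  have sub: "k ` {\<lceil>A\<rceil>..\<lfloor>B\<rfloor>} \<subseteq> ?S"
  proof safe
    fix J assume J: "J \<in> {\<lceil>A\<rceil>..\<lfloor>B\<rfloor>}"
    then have J': "A \<le> J" "J \<le> B" by (auto simp: ceiling_le_iff le_floor_iff)
    have "real_of_int (int (k J) * P + J) = of_int (n J * int Q)" using kn(2) by simp
    then have m: "real (k J) * of_int P + of_int J = of_int (n J) * real Q" by simp
    have "\<bar>real (k J) * (\<alpha> - of_int P / real Q)\<bar> \<le> real Q * (1 / (2 * (real Q)\<^sup>2))"
      using kn(1)[of J] unfolding abs_mult by (intro mult_mono P(2)) auto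
    then have e: "\<bar>real (k J) * (\<alpha> - of_int P / real Q)\<bar> \<le> (1 / 2) / real Q"
      using Q by (simp add: power2_eq_square)
    have "\<bar>real Q * (real (k J) * (\<alpha> - of_int P / real Q))\<bar> \<le> 1 / 2"
      using mult_left_mono[OF e, of "real Q"] Q by (simp add: abs_mult)
    moreover have "real Q * (real (k J) * (\<alpha> - of_int P / real Q)) = real Q * real (k J) * \<alpha> - real (k J) * of_int P"
      using Q by (simp add: field_simps)
    ultimately have "real Q * (a + \<beta>) \<le> of_int (n J) * real Q - real Q * real (k J) * \<alpha>"
      "of_int (n J) * real Q - real Q * real (k J) * \<alpha> \<le> real Q * (b + \<beta>)"
      using m J' unfolding A_def B_def by linarith+
    then have "real Q * a \<le> real Q * (of_int (n J) - real (k J) * \<alpha> - \<beta>)"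
      "real Q * (of_int (n J) - real (k J) * \<alpha> - \<beta>) \<le> real Q * b"
      by (simp_all add: algebra_simps)
    then have "of_int (n J) - real (k J) * \<alpha> - \<beta> \<in> {a..b}"
      using Q by simp
    then show "\<exists>n::int. of_int n - real (k J) * \<alpha> - \<beta> \<in> {a..b}" by blast
  qed (use kn in auto)
  have "card {\<lceil>A\<rceil>..\<lfloor>B\<rfloor>} \<le> card ?S"
    using card_mono[OF _ sub] card_image[OF inj] by simp
  moreover have "real (card {\<lceil>A\<rceil>..\<lfloor>B\<rfloor>}) \<ge> B - A - 1"
  proof -
    have "real_of_int (\<lfloor>B\<rfloor> - \<lceil>A\<rceil> + 1) \<ge> B - A - 1" by linarith
    then show ?thesis by simp
  qed
  ultimately have "real (card ?S) \<ge> B - A - 1" by linarith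
  then show ?thesis unfolding A_def B_def by (simp add: algebra_simps)
qed

text \<open>Only a quarter of the time \<open>Q\<close> is allowed. Index differences for the two
  orders of visits are then each at most about \<open>Q / 4\<close>, and their sum stays below
  \<open>Q\<close>, the range of \<open>good_approx_separated\<close>.\<close>

definition hits :: "real \<Rightarrow> nat \<Rightarrow> real \<Rightarrow> real set" where
  "hits \<alpha> Q \<delta> = {z. \<exists>k::nat. 4 * k < Q \<and> dist_int (z + real k * \<alpha>) < \<delta>}"

lemma hits_measurable [measurable]: "hits \<alpha> Q \<delta> \<in> sets borel"
  unfolding hits_def by measurable

text \<open>Two scales are needed. At the coarse scale \<open>Q'\<close> every block of
  \<open>Q'\<close> indices has about \<open>Q' h\<close> preimages of the integers in the interval;
  the first quarter of the time \<open>Q\<close> contains about \<open>Q / (4 Q')\<close> such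
  blocks. At the fine scale the preimages are \<open>1 / (2 Q)\<close>-separated, so their
  \<open>\<delta>\<close>-neighbourhoods are disjoint and the measures add up.\<close>

lemma hits_in_interval:
  assumes ga: "good_approx \<alpha> Q" and ga': "good_approx \<alpha> Q'"
    and h: "0 < h" "h \<le> 1" "8 \<le> real Q' * h" and QQ: "8 * Q' \<le> Q"
    and \<delta>: "0 < \<delta>" "\<delta> \<le> 1 / (4 * real Q)"
  shows "measure lborel ({a..<a + h} \<inter> hits \<alpha> Q \<delta>) \<ge> real Q * \<delta> / 8 * h"
proof -
  have Q': "Q' \<ge> 1" and Q: "Q \<ge> 1" using ga ga' by (auto simp: good_approx_def)
  define b where "b = Q div (4 * Q')"
  define S where "S = {k. 4 * k < Q \<and> (\<exists>n::int. of_int n - real k * \<alpha> \<in> {a + \<delta>..a + h - \<delta>})}"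
  define T where "T i = {k. k < Q' \<and> (\<exists>n::int. of_int n - real k * \<alpha> - real (i * Q') * \<alpha> \<in> {a + \<delta>..a + h - \<delta>})}" for i
  have finS: "finite S" by (rule finite_subset[of _ "{..Q}"]) (auto simp: S_def)
  have finT: "finite (T i)" for i by (rule finite_subset[of _ "{..<Q'}"]) (auto simp: T_def)
  have small: "real Q' * \<delta> \<le> 1 / 8"
  proof -
    have "real Q' * \<delta> \<le> (real Q / 8) * (1 / (4 * real Q))"
      using QQ \<delta> by (intro mult_mono) auto
    also have "\<dots> \<le> 1 / 8" using Q by simp
    finally show ?thesis .
  qed
  \<comment> \<open>The interval is shortened by \<open>\<delta>\<close> at both ends so that whole
    \<open>\<delta>\<close>-neighbourhoods fit. As \<open>Q' h\<close> is at least 8, this loss and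
    the loss of 2 in the count cost at most half of the points.\<close>
  have cardT: "real (card (T i)) \<ge> real Q' * h / 2" for i
  proof -
    have "\<delta> * 2 \<le> h"
    proof -
      have "real Q' * (\<delta> * 2) \<le> real Q' * h" using small h(3) by simp
      then show ?thesis using Q' by simp
    qed
    then have "real (card (T i)) \<ge> real Q' * ((a + h - \<delta>) - (a + \<delta>)) - 2"
      unfolding T_def using h \<delta> by (intro count_orbit_in_interval[OF ga']) auto
    then show ?thesis using small h(3) by (simp add: algebra_simps)
  qed
  have b4: "4 * (b * Q') \<le> Q" unfolding b_def by (metis div_times_less_eq_dividend mult.assoc mult.left_commute)
  have inj: "inj_on (\<lambda>(i, k). i * Q' + k) (SIGMA i:{..<b}. T i)"
  proof (rule inj_onI, clarsimp)
    fix i k j l assume *: "k \<in> T i" "l \<in> T j" "i * Q' + k = j * Q' + l"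
    then have "k < Q'" "l < Q'" by (auto simp: T_def)
    then have "(i * Q' + k) div Q' = i" "(j * Q' + l) div Q' = j" by auto
    then show "i = j \<and> k = l" using * by auto
  qed
  have "(\<lambda>(i, k). i * Q' + k) ` (SIGMA i:{..<b}. T i) \<subseteq> S"
  proof clarsimp
    fix i k assume i: "i < b" and k: "k \<in> T i"
    have "i * Q' + k < (i + 1) * Q'" using k by (simp add: T_def)
    also have "\<dots> \<le> b * Q'" using i by (intro mult_le_mono1) auto
    finally have *: "i * Q' + k < b * Q'" .
    have "4 * x < Q" if "x < y" "4 * y \<le> Q" for x y :: nat using that by linarith
    from this[OF *] have "4 * (i * Q' + k) < Q" using b4 by simp
    moreover obtain n :: int where "of_int n - real k * \<alpha> - real (i * Q') * \<alpha> \<in> {a + \<delta>..a + h - \<delta>}"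
      using k by (auto simp: T_def)
    moreover have "of_int n - real k * \<alpha> - real (i * Q') * \<alpha> = of_int n - real (i * Q' + k) * \<alpha>" for n :: int
      by (simp add: algebra_simps)
    ultimately show "i * Q' + k \<in> S" unfolding S_def by (metis (mono_tags, lifting) mem_Collect_eq)
  qed
  then have "card (SIGMA i:{..<b}. T i) \<le> card S"
    using card_mono[OF finS] by (metis card_image[OF inj])
  then have "(\<Sum>i<b. card (T i)) \<le> card S" using finT by simp
  then have "real (\<Sum>i<b. card (T i)) \<le> real (card S)" by (simp only: of_nat_le_iff)
  then have "(\<Sum>i<b. real (card (T i))) \<le> real (card S)" by (simp only: of_nat_sum)
  moreover have "(\<Sum>i<b. real Q' * h / 2) \<le> (\<Sum>i<b. real (card (T i)))"
    by (intro sum_mono cardT)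
  ultimately have S1: "real b * (real Q' * h / 2) \<le> real (card S)" by simp
  have "real b \<ge> real Q / (8 * real Q')"
  proof -
    have "(4 * Q') div (4 * Q') \<le> Q div (4 * Q')" by (rule div_le_mono) (use QQ in linarith)
    then have "b \<ge> 1" unfolding b_def using Q' by simp
    have "Q < (b + 1) * (4 * Q')" unfolding b_def
      using Q' dividend_less_div_times[of "4 * Q'" Q] by (simp add: algebra_simps)
    also from \<open>b \<ge> 1\<close> have "(b + 1) * (4 * Q') \<le> (2 * b) * (4 * Q')" by (intro mult_le_mono1) simp
    finally have "Q \<le> (2 * b) * (4 * Q')" by (rule less_imp_le_nat)
    then have "real Q \<le> real (2 * b * (4 * Q'))" by (simp only: of_nat_le_iff)
    then show ?thesis using Q' by (simp add: field_simps)
  qed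
  then have "real Q / (8 * real Q') * (real Q' * h / 2) \<le> real b * (real Q' * h / 2)"
    using h by (intro mult_right_mono) auto
  moreover have "real Q / (8 * real Q') * (real Q' * h / 2) = real Q * h / 16" using Q' by simp
  ultimately have cardS: "real (card S) \<ge> real Q * h / 16" using S1 by linarith
  obtain n where n: "of_int (n k) - real k * \<alpha> \<in> {a + \<delta>..a + h - \<delta>}" if "k \<in> S" for k
  proof -
    have "\<forall>k\<in>S. \<exists>n::int. of_int n - real k * \<alpha> \<in> {a + \<delta>..a + h - \<delta>}" by (simp add: S_def)
    from bchoice[OF this] show thesis using that by blast
  qed
  define z where "z k = of_int (n k) - real k * \<alpha>" for k
  define I where "I k = {z k - \<delta><..<z k + \<delta>}" for k
  have disj: "disjoint_family_on I S"
  unfolding disjoint_family_on_def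
  proof (intro ballI impI)
    fix k l assume kl: "k \<in> S" "l \<in> S" "k \<noteq> l"
    then have "dist_int (of_int (int k - int l) * \<alpha>) \<ge> 1 / (2 * real Q)"
      by (intro good_approx_separated[OF ga]) (auto simp: S_def)
    moreover have "dist_int (of_int (int k - int l) * \<alpha>) \<le> \<bar>z k - z l\<bar>"
      using dist_int_le[of "of_int (int k - int l) * \<alpha>" "n k - n l"] by (simp add: z_def algebra_simps)
    moreover have "1 / (2 * real Q) = 2 * (1 / (4 * real Q))" by simp
    ultimately have "\<bar>z k - z l\<bar> \<ge> 2 * \<delta>" using \<delta>(2) by linarith
    then show "I k \<inter> I l = {}" unfolding I_def by auto
  qed
  have sub: "(\<Union>k\<in>S. I k) \<subseteq> {a..<a + h} \<inter> hits \<alpha> Q \<delta>"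
  proof (rule UN_least)
    fix k assume k: "k \<in> S"
    show "I k \<subseteq> {a..<a + h} \<inter> hits \<alpha> Q \<delta>"
    proof
      fix x assume x: "x \<in> I k"
      have "dist_int (x + real k * \<alpha>) \<le> \<bar>x + real k * \<alpha> - of_int (n k)\<bar>" by (rule dist_int_le)
      also have "\<dots> < \<delta>" using x by (auto simp: I_def z_def)
      finally have "x \<in> hits \<alpha> Q \<delta>" using k by (auto simp: hits_def S_def)
      moreover have "x \<in> {a..<a + h}" using n[OF k] x by (auto simp: I_def z_def)
      ultimately show "x \<in> {a..<a + h} \<inter> hits \<alpha> Q \<delta>" by blast
    qed
  qed
  have "measure lborel (\<Union>k\<in>S. I k) = (\<Sum>k\<in>S. measure lborel (I k))"
  proof (rule measure_finite_Union[OF finS _ disj])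
    show "emeasure lborel (I k) \<noteq> \<infinity>" for k using \<delta> by (simp add: I_def)
  qed (auto simp: I_def)
  also have "\<dots> = real (card S) * (2 * \<delta>)" using \<delta> by (simp add: I_def)
  finally have "measure lborel (\<Union>k\<in>S. I k) = real (card S) * (2 * \<delta>)" .
  moreover have "measure lborel (\<Union>k\<in>S. I k) \<le> measure lborel ({a..<a + h} \<inter> hits \<alpha> Q \<delta>)"
    using finS h by (intro measure_mono_fmeasurable sub fmeasurable_Int_fmeasurable) (auto simp: I_def fmeasurable_def)
  moreover have "real Q * h / 16 * (2 * \<delta>) \<le> real (card S) * (2 * \<delta>)"
    using cardS \<delta> by (intro mult_right_mono) auto
  moreover have "real Q * h / 16 * (2 * \<delta>) = real Q * \<delta> / 8 * h" by simp
  ultimately show ?thesis by linarith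
qed

text \<open>\<open>B\<close> contains the endpoints of the intervals that make up \<open>V \<inter> {0..<1}\<close>.\<close>

definition separated_by :: "real set \<Rightarrow> real set \<Rightarrow> bool" where
  "separated_by B V \<longleftrightarrow> (\<forall>z\<in>{0..<1}. \<forall>w\<in>{0..<1}. z \<in> V \<longrightarrow> w \<notin> V \<longrightarrow>
     (\<exists>b\<in>B. min z w \<le> b \<and> b \<le> max z w))"

lemma separated_by_Diff:
  assumes "separated_by B V" "separated_by C E"
  shows "separated_by (B \<union> C) (V - E)"
  unfolding separated_by_def
proof (intro ballI impI)
  fix z w :: real assume *: "z \<in> {0..<1}" "w \<in> {0..<1}" "z \<in> V - E" "w \<notin> V - E"
  consider "w \<notin> V" | "w \<in> E" using * by blast
  then show "\<exists>b\<in>B \<union> C. min z w \<le> b \<and> b \<le> max z w"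
  proof cases
    case 1
    then show ?thesis using assms(1) * unfolding separated_by_def by blast
  next
    case 2
    then have "\<exists>b\<in>C. min w z \<le> b \<and> b \<le> max w z"
      using assms(2) * unfolding separated_by_def by blast
    then show ?thesis by (auto simp: min.commute max.commute)
  qed
qed

text \<open>By the intermediate value theorem, membership can change only at a point whose
  \<open>k\<close>-th image has distance exactly \<open>\<delta>\<close> from the integers. In the
  unit interval there are at most two such points for each \<open>k\<close>.\<close>

lemma separated_by_hits:
  assumes "Q \<ge> 1"
  obtains B where "finite B" "card B \<le> 2 * Q" "separated_by B (hits \<alpha> Q \<delta>)"
proof
  let ?K = "{k::nat. 4 * k < Q}"
  define B where "B = (\<lambda>(k, s). frac (s * \<delta> - real k * \<alpha>)) ` (?K \<times> {- 1, 1})"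
  have K: "?K \<subseteq> {..<Q}" by auto
  then have finK: "finite ?K" by (rule finite_subset) simp
  then show "finite B" by (simp add: B_def)
  have "card B \<le> card (?K \<times> {- 1, 1 :: real})" unfolding B_def using finK by (intro card_image_le) auto
  also have "\<dots> \<le> Q * 2"
    unfolding card_cartesian_product using card_mono[OF _ K] by (intro mult_le_mono) auto
  finally show "card B \<le> 2 * Q" by simp
  show "separated_by B (hits \<alpha> Q \<delta>)"
    unfolding separated_by_def
  proof (intro ballI impI)
    fix z w :: real assume *: "z \<in> {0..<1}" "w \<in> {0..<1}" "z \<in> hits \<alpha> Q \<delta>" "w \<notin> hits \<alpha> Q \<delta>"
    then obtain k where k: "4 * k < Q" "dist_int (z + real k * \<alpha>) < \<delta>" by (auto simp: hits_def)
    have k': "\<delta> \<le> dist_int (w + real k * \<alpha>)" using * k(1) by (auto simp: hits_def)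
    let ?f = "\<lambda>t. dist_int (t + real k * \<alpha>)"
    have cont: "continuous_on S ?f" for S
      by (rule continuous_on_compose2[OF continuous_on_dist_int[of UNIV]]) (auto intro!: continuous_intros)
    have "\<exists>t. min z w \<le> t \<and> t \<le> max z w \<and> ?f t = \<delta>"
    proof (cases "z \<le> w")
      case True
      then show ?thesis using IVT'[of ?f z \<delta> w] k k' cont by (auto simp: min_def max_def)
    next
      case False
      then show ?thesis using IVT2'[of ?f z \<delta> w] k k' cont by (auto simp: min_def max_def)
    qed
    then obtain t where t: "min z w \<le> t" "t \<le> max z w" "dist_int (t + real k * \<alpha>) = \<delta>" by blast
    obtain n where "dist_int (t + real k * \<alpha>) = \<bar>t + real k * \<alpha> - of_int n\<bar>" by (rule dist_int_obtain)
    with t(3) have "t = of_int n + ((- 1) * \<delta> - real k * \<alpha>) \<or> t = of_int n + (1 * \<delta> - real k * \<alpha>)" by auto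
    then obtain s where s: "s \<in> {- 1, 1}" "t = of_int n + (s * \<delta> - real k * \<alpha>)" by blast
    have "0 \<le> t" "t < 1" using t * by (auto simp: min_def max_def split: if_splits)
    then have "frac (s * \<delta> - real k * \<alpha>) = t"
      unfolding frac_unique_iff s(2) by simp
    then have "t \<in> B" unfolding B_def using s(1) k(1) by force
    with t show "\<exists>b\<in>B. min z w \<le> b \<and> b \<le> max z w" by blast
  qed
qed

text \<open>A cell of length \<open>1 / M\<close> that meets \<open>V\<close> either lies in
  \<open>V\<close>, and then contains its fraction of \<open>E\<close>, or contains a point of
  \<open>B\<close>. The cells are disjoint, so at most \<open>card B\<close> of them are of the
  second kind.\<close>

lemma measure_Int_ge_of_cells:
  assumes V: "V \<subseteq> {0..<1}" "V \<in> sets borel" and E: "E \<in> sets borel"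
    and sep: "separated_by B V" "finite B" and M: "M \<ge> 1" and \<theta>: "0 \<le> \<theta>"
    and cells: "\<And>c. measure lborel ({c..<c + 1 / real M} \<inter> E) \<ge> \<theta> * (1 / real M)"
  shows "measure lborel (V \<inter> E) \<ge> \<theta> * (measure lborel V - real (card B) / real M)"
proof -
  define cell where "cell i = {real i / real M..<real i / real M + 1 / real M}" for i :: nat
  have cell_iff: "x \<in> cell i \<longleftrightarrow> real i \<le> real M * x \<and> real M * x < real i + 1" for x i
    using M by (auto simp: cell_def field_simps)
  define G where "G = {i. i < M \<and> cell i \<subseteq> V}"
  define H where "H = {i. i < M \<and> cell i \<inter> B \<noteq> {}}"
  have fin: "finite G" "finite H" by (auto simp: G_def H_def)
  have disj: "i = j" if "x \<in> cell i" "x \<in> cell j" for x i j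
    using that unfolding cell_iff by linarith
  have meas_cell: "measure lborel (cell i) = 1 / real M" for i by (simp add: cell_def)
  have cell_fm: "cell i \<in> fmeasurable lborel" for i by (simp add: cell_def fmeasurable_def)
  have cover: "V \<subseteq> (\<Union>i\<in>G. cell i) \<union> (\<Union>i\<in>H. cell i)"
  proof
    fix x assume x: "x \<in> V"
    with V have x01: "0 \<le> x" "x < 1" by auto
    define i where "i = nat \<lfloor>real M * x\<rfloor>"
    have i: "real i \<le> real M * x" "real M * x < real i + 1" using x01 unfolding i_def by auto
    have "real M * x < real M * 1" using x01 M by (intro mult_strict_left_mono) auto
    with i(1) have "real i < real M" by linarith
    then have iM: "i < M" by simp
    have xi: "x \<in> cell i" using i by (simp add: cell_iff)
    show "x \<in> (\<Union>i\<in>G. cell i) \<union> (\<Union>i\<in>H. cell i)"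
    proof (cases "cell i \<subseteq> V")
      case False
      then obtain w where w: "w \<in> cell i" "w \<notin> V" by blast
      have "0 \<le> w"
        by (rule order_trans[of 0 "real i / real M"]) (use w(1) in \<open>auto simp: cell_def\<close>)
      moreover have "w < 1"
      proof -
        have "real M * w < real M * 1" using w(1) iM unfolding cell_iff by linarith
        then show ?thesis using M by (simp only: mult_less_cancel_left_pos of_nat_0_less_iff)
      qed
      ultimately obtain b where b: "b \<in> B" "min x w \<le> b" "b \<le> max x w"
        using sep(1) x w x01 unfolding separated_by_def by (metis atLeastLessThan_iff)
      then have "b \<in> cell i" using xi w(1) by (auto simp: cell_def min_def max_def split: if_splits)
      then show ?thesis using b(1) iM xi by (auto simp: H_def)
    qed (use xi iM in \<open>auto simp: G_def\<close>)
  qed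
  have cardH: "card H \<le> card B"
  proof -
    have "\<forall>i\<in>H. \<exists>x. x \<in> cell i \<inter> B" unfolding H_def by blast
    from bchoice[OF this] obtain g where g: "g i \<in> cell i \<inter> B" if "i \<in> H" for i by blast
    have "inj_on g H" by (rule inj_onI) (metis IntD1 disj g)
    then show ?thesis using g sep(2) by (intro card_inj_on_le[of g]) auto
  qed
  have "measure lborel V \<le> measure lborel ((\<Union>i\<in>G. cell i) \<union> (\<Union>i\<in>H. cell i))"
    using cover V fin by (intro measure_mono_fmeasurable fmeasurable.Un fmeasurable.finite_UN cell_fm) auto
  also have "\<dots> \<le> measure lborel (\<Union>i\<in>G. cell i) + measure lborel (\<Union>i\<in>H. cell i)"
    by (intro measure_Un_le) (auto simp: cell_def)
  also have "\<dots> \<le> (\<Sum>i\<in>G. measure lborel (cell i)) + (\<Sum>i\<in>H. measure lborel (cell i))"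
    by (intro add_mono measure_UNION_le fin) (auto simp: cell_def)
  also have "\<dots> = real (card G) / real M + real (card H) / real M" by (simp add: meas_cell)
  also have "\<dots> \<le> real (card G) / real M + real (card B) / real M"
    using cardH by (simp add: divide_right_mono)
  finally have 1: "measure lborel V - real (card B) / real M \<le> real (card G) / real M" by simp
  have "\<theta> * (real (card G) / real M) = (\<Sum>i\<in>G. \<theta> * (1 / real M))" by simp
  also have "\<dots> \<le> (\<Sum>i\<in>G. measure lborel (cell i \<inter> E))"
    unfolding cell_def by (intro sum_mono cells)
  also have "\<dots> = measure lborel (\<Union>i\<in>G. cell i \<inter> E)"
  proof (rule measure_finite_Union[symmetric])
    show "disjoint_family_on (\<lambda>i. cell i \<inter> E) G" using disj by (auto simp: disjoint_family_on_def)
    show "emeasure lborel (cell i \<inter> E) \<noteq> \<infinity>" for i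
      using fmeasurable_Int_fmeasurable[OF cell_fm[of i], of E] E by (auto simp: fmeasurable_def)
  qed (use fin E in \<open>auto simp: cell_def\<close>)
  also have "\<dots> \<le> measure lborel (V \<inter> E)"
  proof (rule measure_mono_fmeasurable)
    have "V \<in> fmeasurable lborel"
      by (rule fmeasurableI2[of "{0..<1}"]) (use V in \<open>auto simp: fmeasurable_def\<close>)
    then show "V \<inter> E \<in> fmeasurable lborel" using E by (intro fmeasurable_Int_fmeasurable) auto
  qed (use fin E in \<open>auto simp: cell_def G_def\<close>)
  finally have "\<theta> * (real (card G) / real M) \<le> measure lborel (V \<inter> E)" .
  moreover have "\<theta> * (measure lborel V - real (card B) / real M) \<le> \<theta> * (real (card G) / real M)"
    by (rule mult_left_mono[OF 1 \<theta>])
  ultimately show ?thesis by linarith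
qed

text \<open>Monotonicity bounds each block of \<open>t\<close> terms by \<open>t\<close> times its
  first term, so restricting attention to every \<open>t\<close>-th scale loses nothing from the
  divergence.\<close>

lemma summable_of_subsampled:
  fixes f :: "nat \<Rightarrow> real"
  assumes nonneg: "\<And>i. 0 \<le> f i" and dec: "\<And>i j. i \<le> j \<Longrightarrow> f j \<le> f i"
    and t: "t \<ge> 1" and sub: "summable (\<lambda>m. f (i0 + t * m))"
  shows "summable f"
proof -
  define g where "g i = f (i0 + i)" for i
  have bound: "sum g {..<n} \<le> real t * (\<Sum>m. f (i0 + t * m))" for n
  proof -
    have "sum g {..<n} \<le> sum g {..<n * t}"
      using t nonneg by (intro sum_mono2) (auto simp: g_def intro: order_less_le_trans)
    also have "\<dots> = (\<Sum>m<n. sum g {m * t..<m * t + t})" by (simp add: sum.nat_group)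
    also have "\<dots> \<le> (\<Sum>m<n. real t * f (i0 + t * m))"
    proof (rule sum_mono)
      fix m
      have "sum g {m * t..<m * t + t} \<le> (\<Sum>i\<in>{m * t..<m * t + t}. f (i0 + t * m))"
        by (rule sum_mono) (auto simp: g_def mult.commute intro: dec)
      then show "sum g {m * t..<m * t + t} \<le> real t * f (i0 + t * m)" by simp
    qed
    also have "\<dots> = real t * (\<Sum>m<n. f (i0 + t * m))" by (simp add: sum_distrib_left)
    also have "\<dots> \<le> real t * (\<Sum>m. f (i0 + t * m))"
      by (intro mult_left_mono sum_le_suminf sub) (auto simp: nonneg)
    finally show ?thesis .
  qed
  have "summable g" by (rule summableI_nonneg_bounded[OF _ bound]) (simp add: g_def nonneg)
  then show ?thesis unfolding g_def by (simp add: add.commute[of i0] summable_iff_shift)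
qed

section \<open>Almost every orbit hits the targets at infinitely many scales\<close>

lemma AE_lborel_periodic:
  assumes null: "{z\<in>{0..<1::real}. \<not> P z} \<in> null_sets lborel"
    and per: "\<And>z n. P (z - of_int n) \<longleftrightarrow> P z"
  shows "AE z in lborel. P z"
proof -
  let ?W = "{z\<in>{0..<1::real}. \<not> P z}"
  have "AE z in lborel. \<forall>n::int. z - of_int n \<notin> ?W"
  proof (subst AE_all_countable, intro allI)
    fix n :: int
    have "{z. z - of_int n \<in> ?W} \<in> null_sets lborel" by (rule null_sets_translation[OF null])
    from AE_not_in[OF this] show "AE z in lborel. z - of_int n \<notin> ?W" by simp
  qed
  then show ?thesis
  proof (rule AE_mp, intro AE_I2 impI)
    fix z :: real assume "\<forall>n::int. z - of_int n \<notin> ?W"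
    then have "frac z \<notin> ?W" by (simp add: frac_def)
    then have "P (frac z)" by (simp add: frac_lt_1)
    then show "P z" using per[of z "\<lfloor>z\<rfloor>"] by (simp add: frac_def)
  qed
qed

text \<open>What remains of the continued fraction. All conditions pass to subsequences, and the
  bound 3, being larger than \<open>exp 1\<close>, makes \<open>ln Q\<close> at least 1.\<close>

locale approx_sequence =
  fixes \<alpha> :: real and Q :: "nat \<Rightarrow> nat"
  assumes good: "good_approx \<alpha> (Q i)" and Q_ge: "Q i \<ge> 3" and doubling: "2 * Q i \<le> Q (Suc i)"
begin

lemma Q_mono: "i \<le> j \<Longrightarrow> Q i \<le> Q j"
proof (rule lift_Suc_mono_le[of Q])
  show "Q n \<le> Q (Suc n)" for n using doubling[of n] by simp
qed

lemma Q_power: "2 ^ s * Q i \<le> Q (i + s)"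
proof (induction s)
  case (Suc s)
  then show ?case using doubling[of "i + s"] by simp
qed simp

lemma ln_Q_ge: "1 \<le> ln (real (Q i))"
proof -
  have "exp 1 \<le> (3::real)" using exp_le .
  also have "(3::real) \<le> real (Q i)" using Q_ge[of i] by simp
  finally show ?thesis using Q_ge[of i] by (simp add: ln_ge_iff)
qed

abbreviation \<delta> :: "real \<Rightarrow> nat \<Rightarrow> real" where
  "\<delta> \<epsilon> i \<equiv> \<epsilon> / (real (Q i) * ln (real (Q i)))"

text \<open>The measure of the part of the unit interval avoided by a sparse subsequence of the events
  drops by a definite fraction of \<open>1 / ln Q\<close> at each step, because that part is a union of
  intervals which are long compared with the spacing of the next event.\<close>

lemma summable_if_avoided:
  assumes \<epsilon>: "0 < \<epsilon>" "\<epsilon> \<le> 1 / 4"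
    and W: "W \<in> sets borel" "W \<subseteq> {0..<1}" "\<And>i z. i \<ge> i0 \<Longrightarrow> z \<in> W \<Longrightarrow> z \<notin> hits \<alpha> (Q i) (\<delta> \<epsilon> i)"
    and pos: "measure lborel W > 0"
  shows "summable (\<lambda>i. 1 / ln (real (Q i)))"
proof -
  define w where "w = measure lborel W"
  define E where "E i = hits \<alpha> (Q i) (\<delta> \<epsilon> i)" for i
  \<comment> \<open>Cells of length \<open>1 / (K Q)\<close> with at most \<open>4 Q\<close>
    boundary points leave a bad part of measure at most \<open>4 / K\<close>, hence at most half of
    \<open>w\<close>.\<close>
  obtain K :: nat where K: "8 / w < real K" using reals_Archimedean2 by blast
  have w: "w > 0" using pos by (simp add: w_def)
  have K1: "K \<ge> 1" using K w by (cases K) (auto simp: field_simps)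
  obtain s where s: "8 * K < 2 ^ s" using less_exp by blast
  have s1: "s \<ge> 1" using s K1 by (cases s) auto
  have s8: "(8::nat) \<le> 2 ^ s" using s K1 by simp
  \<comment> \<open>Each step uses three scales: the cells belong to \<open>e m\<close>, the
    preimages are counted at \<open>e m + s\<close>, and the next event is at
    \<open>e m + 2 * s\<close>. The choice of \<open>s\<close> makes each scale exceed the previous
    one by the factors that \<open>hits_in_interval\<close> requires.\<close>
  define e where "e j = i0 + 2 * s * j" for j
  define V where "V m = {0..<1} - (\<Union>j\<in>{1..m}. E (e j))" for m
  have E_meas: "E i \<in> sets borel" for i by (simp add: E_def)
  have V_meas: "V m \<in> sets borel" for m unfolding V_def using E_meas by auto
  have V_sub: "V m \<subseteq> {0..<1}" for m by (auto simp: V_def)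
  have V_fm: "V m \<in> fmeasurable lborel" for m
    by (rule fmeasurableI2[of "{0..<1}"]) (use V_sub V_meas in \<open>auto simp: fmeasurable_def\<close>)
  have W_V: "W \<subseteq> V m" for m using W(2,3) by (auto simp: V_def E_def e_def)
  have V_ge: "w \<le> measure lborel (V m)" for m
    unfolding w_def using W V_fm W_V by (intro measure_mono_fmeasurable) auto
  have V_Suc: "V (Suc m) = V m - E (e (Suc m))" for m
    unfolding V_def by (subst atLeastAtMostSuc_conv) auto
  \<comment> \<open>The constant 4 reproduces itself: the new event adds at most \<open>2 Q\<close>
    boundary points, and the old \<open>4 Q\<close> is at most twice the new scale because the
    scales at least double.\<close>
  have boundary: "\<exists>B. finite B \<and> card B \<le> 4 * Q (e m) \<and> separated_by B (V m)" for m
  proof (induction m)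
    case 0
    have "separated_by {} (V 0)" by (auto simp: separated_by_def V_def)
    then show ?case by (intro exI[of _ "{}"]) auto
  next
    case (Suc m)
    then obtain B where B: "finite B" "card B \<le> 4 * Q (e m)" "separated_by B (V m)" by blast
    have "Q (e (Suc m)) \<ge> 1" using Q_ge[of "e (Suc m)"] by simp
    then obtain C where C: "finite C" "card C \<le> 2 * Q (e (Suc m))" "separated_by C (E (e (Suc m)))"
      unfolding E_def by (rule separated_by_hits)
    have "2 * Q (e m) \<le> Q (Suc (e m))" by (rule doubling)
    also have "\<dots> \<le> Q (e (Suc m))" using s1 by (intro Q_mono) (simp add: e_def)
    finally have "card (B \<union> C) \<le> 4 * Q (e (Suc m))"
      using card_Un_le[of B C] B(2) C(2) by linarith
    then show ?case unfolding V_Suc using separated_by_Diff[OF B(3) C(3)] B(1) C(1) by blast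
  qed
  have step: "\<epsilon> * w / 16 * (1 / ln (real (Q (e (Suc m))))) \<le> measure lborel (V m) - measure lborel (V (Suc m))" for m
  proof -
    obtain B where B: "finite B" "card B \<le> 4 * Q (e m)" "separated_by B (V m)" using boundary by blast
    define M where "M = K * Q (e m)"
    let ?Q = "Q (e (Suc m))" and ?Q' = "Q (e m + s)"
    let ?\<theta> = "real ?Q * \<delta> \<epsilon> (e (Suc m)) / 8"
    have M1: "M \<ge> 1" using K1 Q_ge[of "e m"] by (simp add: M_def)
    have "8 * K * Q (e m) \<le> 2 ^ s * Q (e m)" using s by (intro mult_le_mono1) simp
    also have "\<dots> \<le> ?Q'" by (rule Q_power)
    finally have Q'M: "8 * M \<le> ?Q'" by (simp add: M_def)
    have "8 * ?Q' \<le> 2 ^ s * ?Q'" using s8 by (intro mult_le_mono1)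
    also have "\<dots> \<le> Q (e m + s + s)" by (rule Q_power)
    finally have QQ': "8 * ?Q' \<le> ?Q" by (simp add: e_def algebra_simps)
    have lnQ: "ln (real ?Q) \<ge> 1" by (rule ln_Q_ge)
    have Qpos: "real ?Q > 0" using Q_ge[of "e (Suc m)"] by simp
    have \<theta>: "?\<theta> = \<epsilon> / 8 * (1 / ln (real ?Q))" using Qpos by simp
    have \<delta>: "0 < \<delta> \<epsilon> (e (Suc m))" "\<delta> \<epsilon> (e (Suc m)) \<le> 1 / (4 * real ?Q)"
    proof -
      show "0 < \<delta> \<epsilon> (e (Suc m))" by (intro divide_pos_pos mult_pos_pos \<epsilon>(1) Qpos less_le_trans[OF zero_less_one lnQ])
      have "\<delta> \<epsilon> (e (Suc m)) \<le> (1 / 4) / (real ?Q * 1)"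
        using \<epsilon> Qpos lnQ by (intro frac_le mult_left_mono) auto
      then show "\<delta> \<epsilon> (e (Suc m)) \<le> 1 / (4 * real ?Q)" by simp
    qed
    have \<theta>0: "0 \<le> ?\<theta>" by (intro divide_nonneg_nonneg mult_nonneg_nonneg less_imp_le[OF \<delta>(1)]) auto
    have "measure lborel (V m \<inter> E (e (Suc m))) \<ge> ?\<theta> * (measure lborel (V m) - real (card B) / real M)"
    proof (rule measure_Int_ge_of_cells[OF V_sub V_meas E_meas B(3,1) M1])
      show "0 \<le> ?\<theta>" by (rule \<theta>0)
      fix c
      have "8 * real M \<le> real ?Q'" using Q'M by (metis of_nat_le_iff of_nat_mult of_nat_numeral)
      then show "?\<theta> * (1 / real M) \<le> measure lborel ({c..<c + 1 / real M} \<inter> E (e (Suc m)))"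
        unfolding E_def using M1 \<delta> QQ'
        by (intro hits_in_interval[OF good good, of _ "e m + s"]) (auto simp: field_simps)
    qed
    moreover have "w / 2 \<le> measure lborel (V m) - real (card B) / real M"
    proof -
      have "real (card B) \<le> 4 * real (Q (e m))" using B(2) by (metis of_nat_le_iff of_nat_mult of_nat_numeral)
      then have "real (card B) / real M \<le> 4 * real (Q (e m)) / real M" by (intro divide_right_mono) auto
      also have "\<dots> = 4 / real K" using Q_ge[of "e m"] by (simp add: M_def)
      also have "\<dots> \<le> w / 2" using K w K1 by (simp add: field_simps)
      finally show ?thesis using V_ge[of m] by linarith
    qed
    ultimately have "?\<theta> * (w / 2) \<le> measure lborel (V m \<inter> E (e (Suc m)))"
      using \<theta>0 by (meson mult_left_mono order_trans)
    moreover have "measure lborel (V (Suc m)) = measure lborel (V m) - measure lborel (V m \<inter> E (e (Suc m)))"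
    proof -
      have "V m - E (e (Suc m)) = V m - V m \<inter> E (e (Suc m))" by blast
      then show ?thesis unfolding V_Suc
        using measurable_measure_Diff[OF V_fm, of "V m \<inter> E (e (Suc m))" m] V_meas E_meas by simp
    qed
    ultimately show ?thesis unfolding \<theta> by (simp add: algebra_simps)
  qed
  \<comment> \<open>The decrements telescope, and they start from the measure of the unit
    interval.\<close>
  have "summable (\<lambda>m. \<epsilon> * w / 16 * (1 / ln (real (Q (e (Suc m))))))"
  proof (rule summableI_nonneg_bounded)
    show "0 \<le> \<epsilon> * w / 16 * (1 / ln (real (Q (e (Suc n)))))" for n
      using \<epsilon> w ln_Q_ge[of "e (Suc n)"] by simp
    show "(\<Sum>m<n. \<epsilon> * w / 16 * (1 / ln (real (Q (e (Suc m)))))) \<le> measure lborel (V 0)" for n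
    proof -
      have "(\<Sum>m<n. \<epsilon> * w / 16 * (1 / ln (real (Q (e (Suc m)))))) \<le> (\<Sum>m<n. measure lborel (V m) - measure lborel (V (Suc m)))"
        by (rule sum_mono) (rule step)
      also have "\<dots> = measure lborel (V 0) - measure lborel (V n)"
        by (rule sum_lessThan_telescope')
      finally show ?thesis using measure_nonneg[of lborel "V n"] by linarith
    qed
  qed
  then have "summable (\<lambda>m. 1 / ln (real (Q (e (Suc m)))))"
    using \<epsilon> w by (subst (asm) summable_cmult_iff) auto
  then have "summable (\<lambda>m. 1 / ln (real (Q (i0 + 2 * s + 2 * s * m))))"
    by (simp add: e_def add.assoc)
  moreover have "0 \<le> 1 / ln (real (Q i))" for i using ln_Q_ge[of i] by simp
  moreover have "1 / ln (real (Q j)) \<le> 1 / ln (real (Q i))" if "i \<le> j" for i j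
    using ln_Q_ge[of i] Q_mono[OF that] Q_ge[of i] by (intro frac_le) auto
  moreover have "2 * s \<ge> 1" using s1 by simp
  ultimately show ?thesis
    by (intro summable_of_subsampled[of "\<lambda>i. 1 / ln (real (Q i))" "2 * s" "i0 + 2 * s"])
qed

text \<open>If the points that avoid all late targets had positive measure,
  \<open>summable_if_avoided\<close> would make the series converge. Integer translates and
  countably many values of \<open>\<epsilon>\<close> give the full statement.\<close>

lemma AE_infinitely_many_hits:
  assumes div: "\<not> summable (\<lambda>i. 1 / ln (real (Q i)))"
  shows "AE z in lborel. \<forall>\<epsilon>>0. \<forall>i0. \<exists>i\<ge>i0. z \<in> hits \<alpha> (Q i) (\<delta> \<epsilon> i)"
proof -
  have null: "AE z in lborel. \<exists>i\<ge>i0. z \<in> hits \<alpha> (Q i) (\<delta> \<epsilon> i)"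
    if \<epsilon>: "0 < \<epsilon>" "\<epsilon> \<le> 1 / 4" for \<epsilon> i0
  proof -
    define W where "W = {z\<in>{0..<1}. \<forall>i\<ge>i0. z \<notin> hits \<alpha> (Q i) (\<delta> \<epsilon> i)}"
    have W_meas: "W \<in> sets borel" unfolding W_def by measurable
    have W_fm: "W \<in> fmeasurable lborel"
      by (rule fmeasurableI2[of "{0..<1}"]) (use W_meas in \<open>auto simp: fmeasurable_def W_def\<close>)
    have "\<not> measure lborel W > 0"
    proof
      assume pos: "measure lborel W > 0"
      have "W \<subseteq> {0..<1}" "\<And>i z. i \<ge> i0 \<Longrightarrow> z \<in> W \<Longrightarrow> z \<notin> hits \<alpha> (Q i) (\<delta> \<epsilon> i)"
        unfolding W_def by blast+
      from summable_if_avoided[OF \<epsilon> W_meas this pos] div show False by blast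
    qed
    then have "measure lborel W = 0" using measure_nonneg[of lborel W] by linarith
    then have W_null: "W \<in> null_sets lborel"
      using W_fm W_meas by (intro null_setsI) (auto simp: fmeasurable_def emeasure_eq_ennreal_measure)
    show ?thesis
    proof (rule AE_lborel_periodic)
      show "{z\<in>{0..<1}. \<not> (\<exists>i\<ge>i0. z \<in> hits \<alpha> (Q i) (\<delta> \<epsilon> i))} \<in> null_sets lborel"
        using W_null by (simp add: W_def)
      fix z :: real and n :: int
      have "dist_int (z - of_int n + x) = dist_int (z + x)" for x
        using dist_int_diff_int[of "z + x" n] by (simp add: algebra_simps)
      then show "(\<exists>i\<ge>i0. z - of_int n \<in> hits \<alpha> (Q i) (\<delta> \<epsilon> i)) \<longleftrightarrow> (\<exists>i\<ge>i0. z \<in> hits \<alpha> (Q i) (\<delta> \<epsilon> i))"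
        by (simp add: hits_def)
    qed
  qed
  \<comment> \<open>The shift by 4 keeps the countably many radii within the range
    \<open>\<epsilon> \<le> 1 / 4\<close> treated above.\<close>
  have "AE z in lborel. \<forall>m i0. \<exists>i\<ge>i0. z \<in> hits \<alpha> (Q i) (\<delta> (1 / real (m + 4)) i)"
    by (subst AE_all_countable, intro allI, subst AE_all_countable, intro allI, rule null) auto
  then show ?thesis
  proof (rule AE_mp, intro AE_I2 impI allI)
    fix z \<epsilon> :: real and i0 assume z: "\<forall>m i0. \<exists>i\<ge>i0. z \<in> hits \<alpha> (Q i) (\<delta> (1 / real (m + 4)) i)" and "\<epsilon> > 0"
    obtain m where m: "inverse (real (Suc m)) < \<epsilon>" using reals_Archimedean[OF \<open>\<epsilon> > 0\<close>] by blast
    have "1 / real (m + 4) \<le> inverse (real (Suc m))" by (simp add: inverse_eq_divide frac_le)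
    with m have m': "1 / real (m + 4) \<le> \<epsilon>" by linarith
    obtain i where i: "i \<ge> i0" "z \<in> hits \<alpha> (Q i) (\<delta> (1 / real (m + 4)) i)" using z by blast
    have "\<delta> (1 / real (m + 4)) i \<le> \<delta> \<epsilon> i"
      using m' ln_Q_ge[of i] by (intro divide_right_mono) auto
    then have "z \<in> hits \<alpha> (Q i) (\<delta> \<epsilon> i)" using i(2) unfolding hits_def by (auto intro: order_less_le_trans)
    with i(1) show "\<exists>i\<ge>i0. z \<in> hits \<alpha> (Q i) (\<delta> \<epsilon> i)" by blast
  qed
qed

end

section \<open>Almost every orbit stays away from the targets at infinitely many scales\<close>

lemma measure_dist_int_less_le:
  assumes "0 < \<delta>" "\<delta> < 1 / 2"
  shows "measure lborel {z\<in>{0..<1}. dist_int (z + c) < \<delta>} \<le> 4 * \<delta>"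
proof -
  define n where "n = \<lceil>c - \<delta>\<rceil>"
  define I where "I m = {of_int m - c - \<delta><..<of_int m - c + \<delta>}" for m :: int
  have I: "measure lborel (I m) = 2 * \<delta>" "I m \<in> fmeasurable lborel" for m
    using assms by (auto simp: I_def fmeasurable_def)
  have "{z\<in>{0..<1}. dist_int (z + c) < \<delta>} \<subseteq> I n \<union> I (n + 1)"
  proof
    fix z assume z: "z \<in> {z\<in>{0..<1}. dist_int (z + c) < \<delta>}"
    obtain m where m: "dist_int (z + c) = \<bar>z + c - of_int m\<bar>" by (rule dist_int_obtain)
    have n: "c - \<delta> \<le> of_int n" "of_int n < c - \<delta> + 1" unfolding n_def by linarith+
    have "z \<in> I m" using z m by (auto simp: I_def)
    moreover have "of_int n - 1 < real_of_int m" "real_of_int m < of_int n + 2"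
      using n z m assms by auto
    then have "m = n \<or> m = n + 1" by linarith
    ultimately show "z \<in> I n \<union> I (n + 1)" by blast
  qed
  then have "measure lborel {z\<in>{0..<1}. dist_int (z + c) < \<delta>} \<le> measure lborel (I n \<union> I (n + 1))"
    using I by (intro measure_mono_fmeasurable fmeasurable.Un) auto
  also have "\<dots> \<le> measure lborel (I n) + measure lborel (I (n + 1))"
    by (intro measure_Un_le) (auto simp: I_def)
  finally show ?thesis using I by simp
qed

context approx_sequence
begin

lemma ln_Q_at_top: "filterlim (\<lambda>i. ln (real (Q i))) at_top sequentially"
proof -
  have "i \<le> Q i" for i
  proof -
    have "i \<le> 2 ^ i * 1" by (simp add: less_imp_le[OF less_exp])
    also have "\<dots> \<le> 2 ^ i * Q 0" using Q_ge[of 0] by (intro mult_le_mono2) simp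
    also have "\<dots> \<le> Q i" using Q_power[of i 0] by simp
    finally show ?thesis .
  qed
  then have "filterlim (\<lambda>i. real (Q i)) at_top sequentially"
    by (intro filterlim_at_top_mono[OF filterlim_real_sequentially]) auto
  then show ?thesis by (rule filterlim_compose[OF ln_at_top])
qed

text \<open>The two-sided window of \<open>3 Q\<close> indices contains all crossings up to slightly
  more than time \<open>Q\<close>, whatever the offset between index and time (at most 1) and the
  margins of the passages.\<close>

definition far :: "real \<Rightarrow> nat \<Rightarrow> bool" where
  "far z i \<longleftrightarrow> (\<forall>k::int. \<bar>k\<bar> \<le> 3 * int (Q i) \<longrightarrow> \<delta> 1 i \<le> dist_int (z + of_int k * \<alpha>))"

lemma far_measurable [measurable]: "Measurable.pred borel (\<lambda>z. far z i)"
  unfolding far_def by measurable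

lemma far_diff_int: "far (z - of_int n) i = far z i"
proof -
  have "dist_int (z - of_int n + x) = dist_int (z + x)" for x
    using dist_int_diff_int[of "z + x" n] by (simp add: algebra_simps)
  then show ?thesis by (simp add: far_def)
qed

lemma measure_not_far_le:
  assumes "ln (real (Q i)) \<ge> 2"
  shows "measure lborel {z\<in>{0..<1}. \<not> far (z + c) i} \<le> 28 / ln (real (Q i))"
proof -
  have Q: "real (Q i) \<ge> 3" using Q_ge[of i] by simp
  have d: "0 < \<delta> 1 i" "\<delta> 1 i < 1 / 2"
  proof -
    show "0 < \<delta> 1 i" using Q assms by (intro divide_pos_pos mult_pos_pos) linarith+
    have "3 * 2 \<le> real (Q i) * ln (real (Q i))" using Q assms by (intro mult_mono) auto
    then show "\<delta> 1 i < 1 / 2" by (simp add: field_simps)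
  qed
  let ?K = "{k::int. \<bar>k\<bar> \<le> 3 * int (Q i)}"
  have K: "?K = {- (3 * int (Q i))..3 * int (Q i)}" by auto
  have "measure lborel {z\<in>{0..<1}. \<not> far (z + c) i}
      = measure lborel (\<Union>k\<in>?K. {z\<in>{0..<1}. dist_int (z + (c + of_int k * \<alpha>)) < \<delta> 1 i})"
    by (rule arg_cong[of _ _ "measure lborel"]) (auto simp: far_def add.assoc not_le)
  also have "\<dots> \<le> (\<Sum>k\<in>?K. measure lborel {z\<in>{0..<1}. dist_int (z + (c + of_int k * \<alpha>)) < \<delta> 1 i})"
    unfolding K by (intro measure_UNION_le) auto
  also have "\<dots> \<le> (\<Sum>k\<in>?K. 4 * \<delta> 1 i)"
    using d by (intro sum_mono measure_dist_int_less_le) auto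
  also have "\<dots> = (6 * real (Q i) + 1) * (4 * \<delta> 1 i)" unfolding K by simp
  also have "\<dots> \<le> (7 * real (Q i)) * (4 * \<delta> 1 i)" using Q d by (intro mult_right_mono) auto
  also have "\<dots> = 28 / ln (real (Q i))" using Q by simp
  finally show ?thesis .
qed

text \<open>A union bound gives the failure at one scale, for both offsets together, measure at most
  \<open>56 / ln Q\<close>, which tends to 0. Failure at all scales from \<open>i0\<close> on is
  contained in each of these sets and hence null; no independence is involved.\<close>

lemma AE_infinitely_many_far:
  "AE z in lborel. \<forall>i0. \<exists>i\<ge>i0. far (z + b) i \<and> far (z + c) i"
proof (subst AE_all_countable, intro allI)
  fix i0
  define P where "P z = (\<exists>i\<ge>i0. far (z + b) i \<and> far (z + c) i)" for z
  have W_meas: "{z\<in>{0..<1}. \<not> P z} \<in> sets borel" unfolding P_def by measurable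
  have W_fm: "{z\<in>{0..<1}. \<not> P z} \<in> fmeasurable lborel"
    by (rule fmeasurableI2[of "{0..<1}"]) (use W_meas in \<open>auto simp: fmeasurable_def\<close>)
  have "\<forall>\<^sub>F i in sequentially. measure lborel {z\<in>{0..<1}. \<not> P z} \<le> 56 / ln (real (Q i))"
    using eventually_ge_at_top[of i0] ln_Q_at_top[unfolded filterlim_at_top, rule_format, of 2]
  proof eventually_elim
    case (elim i)
    have fm: "{z\<in>{0..<1}. \<not> far (z + x) i} \<in> fmeasurable lborel" for x
      by (rule fmeasurableI2[of "{0..<1}"]) (auto simp: fmeasurable_def)
    have "measure lborel {z\<in>{0..<1}. \<not> P z}
        \<le> measure lborel ({z\<in>{0..<1}. \<not> far (z + b) i} \<union> {z\<in>{0..<1}. \<not> far (z + c) i})"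
      using W_meas elim(1) by (intro measure_mono_fmeasurable fmeasurable.Un fm) (auto simp: P_def)
    also have "\<dots> \<le> measure lborel {z\<in>{0..<1}. \<not> far (z + b) i} + measure lborel {z\<in>{0..<1}. \<not> far (z + c) i}"
      by (intro measure_Un_le) auto
    also have "\<dots> \<le> 28 / ln (real (Q i)) + 28 / ln (real (Q i))"
      using elim(2) by (intro add_mono measure_not_far_le)
    finally show ?case by simp
  qed
  moreover have "((\<lambda>i. 56 / ln (real (Q i))) \<longlongrightarrow> 0) sequentially"
    by (rule tendsto_divide_0[OF tendsto_const filterlim_at_top_imp_at_infinity[OF ln_Q_at_top]])
  ultimately have "measure lborel {z\<in>{0..<1}. \<not> P z} \<le> 0"
    by (intro tendsto_le[OF sequentially_bot _ tendsto_const])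
  then have "measure lborel {z\<in>{0..<1}. \<not> P z} = 0" using measure_nonneg[of lborel "{z\<in>{0..<1}. \<not> P z}"] by linarith
  then have null: "{z\<in>{0..<1}. \<not> P z} \<in> null_sets lborel"
    using W_fm W_meas by (intro null_setsI) (auto simp: fmeasurable_def emeasure_eq_ennreal_measure)
  show "AE z in lborel. \<exists>i\<ge>i0. far (z + b) i \<and> far (z + c) i"
    unfolding P_def[symmetric]
  proof (rule AE_lborel_periodic[OF null])
    fix z :: real and n :: int
    have "far (z - of_int n + x) i = far (z + x) i" for x i
      using far_diff_int[of "z + x" n] by (simp add: algebra_simps)
    then show "P (z - of_int n) \<longleftrightarrow> P z" by (simp add: P_def)
  qed
qed

end

section \<open>Passage times near a stopping point\<close>

text \<open>The line \<open>(x1 + l, x2 + \<alpha> l)\<close> meets the vertical circle through a point \<open>(p1, p2)\<close> of the torus at the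
  times \<open>l = k + \<tau>\<close> with \<open>\<tau> = p1 - x1\<close> and integral \<open>k\<close>, at height \<open>y + k \<alpha>\<close> above the point,
  where \<open>y = x2 - p2 - \<alpha> (x1 - p1)\<close>.\<close>

definition crossings :: "real \<Rightarrow> real \<Rightarrow> real \<Rightarrow> int set" where
  "crossings \<tau> a b = {k. a \<le> of_int k + \<tau> \<and> of_int k + \<tau> \<le> b}"

lemma crossings_eq: "crossings \<tau> a b = {\<lceil>a - \<tau>\<rceil>..\<lfloor>b - \<tau>\<rfloor>}"
  by (auto simp: crossings_def ceiling_le_iff le_floor_iff)

lemma finite_crossings [simp, intro]: "finite (crossings \<tau> a b)"
  by (simp add: crossings_eq)

lemma card_crossings_le:
  assumes "a \<le> b + 1"
  shows "real (card (crossings \<tau> a b)) \<le> b - a + 1"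
proof (cases "\<lceil>a - \<tau>\<rceil> \<le> \<lfloor>b - \<tau>\<rfloor>")
  case True
  then have "real (card (crossings \<tau> a b)) = of_int \<lfloor>b - \<tau>\<rfloor> - of_int \<lceil>a - \<tau>\<rceil> + 1"
    by (simp add: crossings_eq)
  then show ?thesis by linarith
qed (use assms in \<open>simp add: crossings_eq\<close>)

definition crossing_sum :: "real \<Rightarrow> real \<Rightarrow> real \<Rightarrow> real \<Rightarrow> real \<Rightarrow> real" where
  "crossing_sum \<alpha> \<tau> y a b = (\<Sum>k\<in>crossings \<tau> a b. 1 / dist_int (y + of_int k * \<alpha>))"

lemma arctan_ge:
  fixes z :: real assumes "z > 0" shows "pi / 2 - 1 / z \<le> arctan z"
proof -
  have "arctan (1 / z) = pi / 2 - arctan z" using arctan_inverse[of z] assms by (simp add: sgn_if inverse_eq_divide)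
  moreover have "arctan (1 / z) \<le> 1 / z" using assms by (intro arctan_le_self) simp
  ultimately show ?thesis by linarith
qed

text \<open>\<open>G\<close> is the time density along the line near one stopping point, and \<open>A, B, C\<close> are the coefficients of
  the Hessian in the coordinates \<open>(s, w)\<close> of the point \<open>p + s (1, \<alpha>) + w (0, 1)\<close>. A passage at height \<open>w\<close>
  takes time asymptotic to \<open>\<kappa> / \<bar>w\<bar>\<close>.\<close>

locale singularity =
  fixes \<alpha> p1 p2 A B C :: real and G :: "real \<Rightarrow> real \<Rightarrow> real"
  assumes periodic: "G (a + of_int m) (b + of_int n) = G a b"
    and nonneg: "0 \<le> G a b"
    and cont: "\<not> (a - p1 \<in> \<int> \<and> b - p2 \<in> \<int>) \<Longrightarrow> isCont (\<lambda>(a, b). G a b) (a, b)"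
    and A_pos: "A > 0" and disc_pos: "A * C - B\<^sup>2 > 0"
    and asymptotic: "\<eta> > 0 \<Longrightarrow> \<exists>\<rho>>0. \<forall>s w. \<bar>s\<bar> \<le> \<rho> \<longrightarrow> \<bar>w\<bar> \<le> \<rho> \<longrightarrow> w \<noteq> 0 \<longrightarrow>
        (1 - \<eta>) * (2 / (A * s\<^sup>2 + 2 * B * s * w + C * w\<^sup>2)) \<le> G (p1 + s) (p2 + w + \<alpha> * s) \<and>
        G (p1 + s) (p2 + w + \<alpha> * s) \<le> (1 + \<eta>) * (2 / (A * s\<^sup>2 + 2 * B * s * w + C * w\<^sup>2))"
begin

definition F :: "real \<Rightarrow> real \<Rightarrow> real" where
  "F s w = 2 / (A * s\<^sup>2 + 2 * B * s * w + C * w\<^sup>2)"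

definition \<Theta> :: real where "\<Theta> = sqrt (A * C - B\<^sup>2)"

text \<open>The integral of \<open>F s w\<close> over all real \<open>s\<close> is
  \<open>\<kappa> / \<bar>w\<bar>\<close>, since completing the square gives an arctangent whose
  variation is \<pi>.\<close>

definition \<kappa> :: real where "\<kappa> = 2 * pi / \<Theta>"

lemma \<Theta>: "\<Theta> > 0" "\<Theta>\<^sup>2 = A * C - B\<^sup>2"
  using disc_pos by (simp_all add: \<Theta>_def)

lemma \<kappa>_pos: "\<kappa> > 0"
  using \<Theta> by (simp add: \<kappa>_def)

lemma quadratic_form: "A * (A * s\<^sup>2 + 2 * B * s * w + C * w\<^sup>2) = (A * s + B * w)\<^sup>2 + (\<Theta> * w)\<^sup>2"
  unfolding power_mult_distrib \<Theta>(2) by (simp add: power2_eq_square algebra_simps)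

lemma quadratic_form_pos: "w \<noteq> 0 \<Longrightarrow> A * s\<^sup>2 + 2 * B * s * w + C * w\<^sup>2 > 0"
proof -
  assume "w \<noteq> 0"
  then have "A * (A * s\<^sup>2 + 2 * B * s * w + C * w\<^sup>2) > 0"
    unfolding quadratic_form using \<Theta>(1) by (intro add_nonneg_pos) auto
  then show ?thesis using A_pos by (simp add: zero_less_mult_iff)
qed

lemma F_pos: "w \<noteq> 0 \<Longrightarrow> F s w > 0"
  using quadratic_form_pos[of w s] by (simp add: F_def)

text \<open>The antiderivative of \<open>F s w\<close> in \<open>s\<close>, from
  \<open>quadratic_form\<close>.\<close>

definition prim :: "real \<Rightarrow> real \<Rightarrow> real" where
  "prim w s = 2 / (\<Theta> * \<bar>w\<bar>) * arctan ((A * s + B * w) / (\<Theta> * \<bar>w\<bar>))"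

lemma prim_deriv:
  assumes "w \<noteq> 0"
  shows "((\<lambda>s. prim w (s - t)) has_real_derivative F (s - t) w) (at s within S)"
proof -
  define D where "D = \<Theta> * \<bar>w\<bar>"
  have D: "D > 0" using \<Theta> assms by (simp add: D_def)
  let ?u = "s - t"
  have "((\<lambda>s. prim w (s - t)) has_real_derivative
      2 / D * (inverse (1 + ((A * ?u + B * w) / D)\<^sup>2) * (A / D))) (at s within S)"
    unfolding prim_def D_def[symmetric] using D by (auto intro!: derivative_eq_intros)
  moreover have "2 / D * (inverse (1 + ((A * ?u + B * w) / D)\<^sup>2) * (A / D)) = 2 * A / (D\<^sup>2 + (A * ?u + B * w)\<^sup>2)"
    using D by (simp add: field_simps power2_eq_square)
  moreover have "D\<^sup>2 = (\<Theta> * w)\<^sup>2" by (simp add: D_def power_mult_distrib)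
  then have "D\<^sup>2 + (A * ?u + B * w)\<^sup>2 = A * (A * ?u\<^sup>2 + 2 * B * ?u * w + C * w\<^sup>2)"
    unfolding quadratic_form by simp
  ultimately show ?thesis using A_pos by (simp add: F_def)
qed

lemma F_has_integral:
  assumes "w \<noteq> 0" "a \<le> b"
  shows "((\<lambda>s. F (s - t) w) has_integral (prim w (b - t) - prim w (a - t))) {a..b}"
  using prim_deriv[OF assms(1), of t] assms(2)
  by (intro fundamental_theorem_of_calculus) (auto simp: has_real_derivative_iff_has_vector_derivative[symmetric])

lemma prim_diff_le: "prim w s - prim w t \<le> \<kappa> / \<bar>w\<bar>"
proof -
  have "arctan x - arctan y \<le> pi" for x y :: real
    using arctan_bounded[of x] arctan_bounded[of y] by linarith
  then have "2 / (\<Theta> * \<bar>w\<bar>) * (arctan ((A * s + B * w) / (\<Theta> * \<bar>w\<bar>)) - arctan ((A * t + B * w) / (\<Theta> * \<bar>w\<bar>)))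
      \<le> 2 / (\<Theta> * \<bar>w\<bar>) * pi"
    using \<Theta> by (intro mult_left_mono) auto
  then show ?thesis by (simp add: prim_def \<kappa>_def algebra_simps)
qed

text \<open>The error has to be uniform in \<open>w\<close>. For small \<open>w\<close> both
  arctangents are within a multiple of \<open>\<bar>w\<bar>\<close> of their limits, and the factor
  \<open>1 / \<bar>w\<bar>\<close> turns this into a constant. For large \<open>w\<close> the main
  term \<open>\<kappa> / \<bar>w\<bar>\<close> is itself bounded by the error term.\<close>

lemma prim_diff_ge:
  assumes \<rho>: "\<rho> > 0" and w: "w \<noteq> 0"
  shows "prim w \<rho> - prim w (- \<rho>) \<ge> \<kappa> / \<bar>w\<bar> - (8 + 2 * \<kappa> * \<bar>B\<bar>) / (A * \<rho>)"
proof (cases "2 * \<bar>B * w\<bar> \<le> A * \<rho>")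
  case True
  define D where "D = \<Theta> * \<bar>w\<bar>"
  have D: "D > 0" using \<Theta> w by (simp add: D_def)
  define z where "z = A * \<rho> / (2 * D)"
  have z: "z > 0" using A_pos \<rho> D by (simp add: z_def)
  have "z \<le> (A * \<rho> + B * w) / D" "z \<le> (A * \<rho> - B * w) / D"
    using True D by (auto simp: z_def field_simps)
  then have "arctan z \<le> arctan ((A * \<rho> + B * w) / D)" "arctan z \<le> arctan ((A * \<rho> - B * w) / D)"
    by (simp_all add: arctan_le_iff)
  moreover have "arctan ((A * (- \<rho>) + B * w) / D) = - arctan ((A * \<rho> - B * w) / D)"
    by (subst arctan_minus[symmetric]) (simp add: minus_divide_left)
  ultimately have "pi - 2 / z \<le> arctan ((A * \<rho> + B * w) / D) - arctan ((A * (- \<rho>) + B * w) / D)"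
    using arctan_ge[OF z] by simp
  then have "2 / D * (pi - 2 / z) \<le> 2 / D * (arctan ((A * \<rho> + B * w) / D) - arctan ((A * (- \<rho>) + B * w) / D))"
    using D by (intro mult_left_mono) auto
  also have "\<dots> = prim w \<rho> - prim w (- \<rho>)" by (simp add: prim_def D_def algebra_simps)
  also have "2 / D * (pi - 2 / z) = \<kappa> / \<bar>w\<bar> - 8 / (A * \<rho>)"
    using D A_pos \<rho> w \<Theta>(1) by (simp add: z_def \<kappa>_def D_def field_simps)
  finally have "prim w \<rho> - prim w (- \<rho>) \<ge> \<kappa> / \<bar>w\<bar> - 8 / (A * \<rho>)" .
  moreover have "8 / (A * \<rho>) \<le> (8 + 2 * \<kappa> * \<bar>B\<bar>) / (A * \<rho>)"
    using A_pos \<rho> \<kappa>_pos by (intro divide_right_mono) auto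
  ultimately show ?thesis by linarith
next
  case False
  have "prim w (- \<rho>) \<le> prim w \<rho>"
    unfolding prim_def using \<Theta> A_pos \<rho>
    by (intro mult_left_mono) (auto simp: arctan_le_iff intro!: divide_right_mono)
  moreover have "\<kappa> / \<bar>w\<bar> \<le> 2 * \<kappa> * \<bar>B\<bar> / (A * \<rho>)"
  proof -
    have "A * \<rho> * \<kappa> \<le> 2 * \<bar>B * w\<bar> * \<kappa>" using False \<kappa>_pos by (intro mult_right_mono) auto
    then show ?thesis using w A_pos \<rho> by (simp add: field_simps abs_mult)
  qed
  moreover have "2 * \<kappa> * \<bar>B\<bar> / (A * \<rho>) \<le> (8 + 2 * \<kappa> * \<bar>B\<bar>) / (A * \<rho>)"
    using A_pos \<rho> by (intro divide_right_mono) auto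
  ultimately show ?thesis by linarith
qed

text \<open>By periodicity it suffices to look at the unit square without open neighbourhoods of the
  singular points, a compact set on which \<open>G\<close> is continuous. The neighbourhoods are
  parallelograms in the coordinates \<open>(s, w)\<close>, so they match the region where the
  asymptotics hold.\<close>

lemma bounded_away:
  assumes "\<rho> > 0"
  shows "\<exists>M\<ge>0. \<forall>a b. (\<forall>m n::int. \<not> (\<bar>a - p1 - of_int m\<bar> < \<rho> \<and> \<bar>b - p2 - of_int n - \<alpha> * (a - p1 - of_int m)\<bar> < \<rho>))
    \<longrightarrow> G a b \<le> M"
proof -
  define N where "N m n = {(a, b). \<bar>a - p1 - of_int m\<bar> < \<rho> \<and> \<bar>b - p2 - of_int n - \<alpha> * (a - p1 - of_int m)\<bar> < \<rho>}" for m n :: int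
  have N_open: "open (N m n)" for m n
    unfolding N_def case_prod_unfold by (intro open_Collect_conj open_Collect_less continuous_intros)
  define S where "S = ({0..1} \<times> {0..1}) - (\<Union>m n. N m n)"
  have "compact S" unfolding S_def by (intro compact_diff compact_Times compact_Icc open_UN ballI N_open)
  moreover have "continuous_on S (\<lambda>(a, b). G a b)"
  proof (rule continuous_at_imp_continuous_on, clarify)
    fix a b assume ab: "(a, b) \<in> S"
    have "\<not> (a - p1 \<in> \<int> \<and> b - p2 \<in> \<int>)"
    proof
      assume "a - p1 \<in> \<int> \<and> b - p2 \<in> \<int>"
      then obtain m n :: int where "a - p1 = of_int m" "b - p2 = of_int n" by (auto elim!: Ints_cases)
      then have "(a, b) \<in> N m n" using assms by (simp add: N_def)
      with ab show False by (auto simp: S_def)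
    qed
    then show "isCont (\<lambda>(a, b). G a b) (a, b)" by (rule cont)
  qed
  ultimately have "compact ((\<lambda>(a, b). G a b) ` S)" by (rule compact_continuous_image[rotated])
  then have "bounded ((\<lambda>(a, b). G a b) ` S)" by (rule compact_imp_bounded)
  then obtain M where M: "\<And>a b. (a, b) \<in> S \<Longrightarrow> norm (G a b) \<le> M" unfolding bounded_iff by fastforce
  have "G a b \<le> max 0 M" if "\<forall>m n::int. \<not> (\<bar>a - p1 - of_int m\<bar> < \<rho> \<and> \<bar>b - p2 - of_int n - \<alpha> * (a - p1 - of_int m)\<bar> < \<rho>)" for a b
  proof -
    have "(frac a, frac b) \<notin> N m n" for m n
      using that[rule_format, of "m + \<lfloor>a\<rfloor>" "n + \<lfloor>b\<rfloor>"] by (auto simp: N_def frac_def algebra_simps)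
    then have "(frac a, frac b) \<in> S" by (auto simp: S_def frac_lt_1 less_imp_le)
    from M[OF this] have "G (frac a) (frac b) \<le> M" by simp
    moreover have "G (frac a) (frac b) = G a b"
      using periodic[of "frac a" "\<lfloor>a\<rfloor>" "frac b" "\<lfloor>b\<rfloor>"] by (simp add: frac_def)
    ultimately show ?thesis by simp
  qed
  then show ?thesis by (intro exI[of _ "max 0 M"]) auto
qed

definition offset :: "real \<Rightarrow> real \<Rightarrow> real" where
  "offset x1 x2 = x2 - p2 - \<alpha> * (x1 - p1)"

definition off_orbit :: "real \<Rightarrow> real \<Rightarrow> bool" where
  "off_orbit x1 x2 \<longleftrightarrow> (\<forall>k::int. offset x1 x2 + of_int k * \<alpha> \<notin> \<int>)"

abbreviation along :: "real \<Rightarrow> real \<Rightarrow> real \<Rightarrow> real" where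
  "along x1 x2 l \<equiv> G (x1 + l) (x2 + \<alpha> * l)"

text \<open>The signed height of a passage. Its absolute value is \<open>dist_int\<close>, but the
  term \<open>2 * B * s * w\<close> of the quadratic form needs the sign.\<close>

definition residual :: "real \<Rightarrow> real" where "residual z = z - of_int (round z)"

lemma residual: "\<bar>residual z\<bar> = dist_int z"
  by (simp add: residual_def dist_int_def)

text \<open>An integer translation moves the \<open>k\<close>-th passage to the chosen
  representative of the stopping point, where the local asymptotics are formulated.\<close>

lemma along_at_crossing:
  "along x1 x2 l = G (p1 + (l - (of_int k + (p1 - x1))))
     (p2 + residual (offset x1 x2 + of_int k * \<alpha>) + \<alpha> * (l - (of_int k + (p1 - x1))))"
proof -
  let ?s = "l - (of_int k + (p1 - x1))" and ?z = "offset x1 x2 + of_int k * \<alpha>"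
  have 1: "x1 + l = (p1 + ?s) + of_int k" by simp
  have 2: "x2 + \<alpha> * l = (p2 + residual ?z + \<alpha> * ?s) + of_int (round ?z)"
    by (simp add: residual_def offset_def algebra_simps)
  show ?thesis unfolding 1 2 by (rule periodic)
qed

lemma continuous_along:
  assumes "off_orbit x1 x2"
  shows "continuous_on S (along x1 x2)"
proof (rule continuous_at_imp_continuous_on, rule ballI)
  fix l
  have "\<not> (x1 + l - p1 \<in> \<int> \<and> x2 + \<alpha> * l - p2 \<in> \<int>)"
  proof
    assume "x1 + l - p1 \<in> \<int> \<and> x2 + \<alpha> * l - p2 \<in> \<int>"
    then obtain k n :: int where k: "x1 + l - p1 = of_int k" and n: "x2 + \<alpha> * l - p2 = of_int n"
      by (auto elim!: Ints_cases)
    have l: "l = of_int k - x1 + p1" using k by simp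
    have "offset x1 x2 + of_int k * \<alpha> = of_int n"
      using n unfolding l offset_def by (simp add: algebra_simps)
    then show False using assms unfolding off_orbit_def by (metis Ints_of_int)
  qed
  then have c: "isCont (\<lambda>(a, b). G a b) (x1 + l, x2 + \<alpha> * l)" by (rule cont)
  have "isCont (\<lambda>l. (x1 + l, x2 + \<alpha> * l)) l" by (intro continuous_intros)
  from isCont_o2[OF this c] show "isCont (along x1 x2) l" by simp
qed

lemma integrable_along:
  "off_orbit x1 x2 \<Longrightarrow> along x1 x2 integrable_on {a..b}"
  by (intro integrable_continuous_real continuous_along)

lemma crossing_residual_nonzero:
  assumes "off_orbit x1 x2"
  shows "residual (offset x1 x2 + of_int k * \<alpha>) \<noteq> 0"
proof -
  have "dist_int (offset x1 x2 + of_int k * \<alpha>) \<noteq> 0"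
    using assms unfolding off_orbit_def dist_int_eq_0_iff by blast
  then show ?thesis using residual[of "offset x1 x2 + of_int k * \<alpha>"] by auto
qed

text \<open>The order of the quantifiers matters: \<open>\<rho>0\<close> depends on
  \<open>\<eta>\<close> only, so one \<open>\<rho>\<close> can serve two stopping points, and
  \<open>M\<close> does not depend on the line. The window is widened by \<open>\<rho>\<close>
  because a crossing just outside \<open>{0..R}\<close> still contributes.\<close>

proposition integral_along_le:
  assumes "\<eta> > 0"
  shows "\<exists>\<rho>0>0. \<forall>\<rho>. 0 < \<rho> \<longrightarrow> \<rho> \<le> \<rho>0 \<longrightarrow> (\<exists>M\<ge>0. \<forall>x1 x2 R. off_orbit x1 x2 \<longrightarrow> 0 \<le> R \<longrightarrow>
     integral {0..R} (along x1 x2) \<le> (1 + \<eta>) * \<kappa> * crossing_sum \<alpha> (p1 - x1) (offset x1 x2) (- \<rho>) (R + \<rho>) + M * R)"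
proof -
  obtain \<rho>0 where \<rho>0: "\<rho>0 > 0" and asym: "\<And>s w. \<bar>s\<bar> \<le> \<rho>0 \<Longrightarrow> \<bar>w\<bar> \<le> \<rho>0 \<Longrightarrow> w \<noteq> 0 \<Longrightarrow>
      G (p1 + s) (p2 + w + \<alpha> * s) \<le> (1 + \<eta>) * F s w"
    using asymptotic[OF assms] unfolding F_def by blast
  have "\<exists>M\<ge>0. \<forall>x1 x2 R. off_orbit x1 x2 \<longrightarrow> 0 \<le> R \<longrightarrow>
     integral {0..R} (along x1 x2) \<le> (1 + \<eta>) * \<kappa> * crossing_sum \<alpha> (p1 - x1) (offset x1 x2) (- \<rho>) (R + \<rho>) + M * R"
    if \<rho>: "0 < \<rho>" "\<rho> \<le> \<rho>0" for \<rho>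
  proof -
    obtain M where M0: "M \<ge> 0" and M: "\<And>a b. (\<And>m n::int. \<not> (\<bar>a - p1 - of_int m\<bar> < \<rho> \<and> \<bar>b - p2 - of_int n - \<alpha> * (a - p1 - of_int m)\<bar> < \<rho>))
        \<Longrightarrow> G a b \<le> M"
      using bounded_away[OF \<rho>(1)] by blast
    have "integral {0..R} (along x1 x2) \<le> (1 + \<eta>) * \<kappa> * crossing_sum \<alpha> (p1 - x1) (offset x1 x2) (- \<rho>) (R + \<rho>) + M * R"
      if off: "off_orbit x1 x2" and R: "0 \<le> R" for x1 x2 R
    proof -
      define K where "K = crossings (p1 - x1) (- \<rho>) (R + \<rho>)"
      define t where "t k = of_int k + (p1 - x1)" for k :: int
      define w where "w k = residual (offset x1 x2 + of_int k * \<alpha>)" for k :: int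
      have w: "w k \<noteq> 0" for k unfolding w_def by (rule crossing_residual_nonzero[OF off])
      \<comment> \<open>Far from the singularity the density is at most \<open>M\<close>. Near it a
        single crossing \<open>m\<close> dominates, and the other summands are only added because
        they are nonnegative.\<close>
      have pointwise: "along x1 x2 l \<le> M + (\<Sum>k\<in>K. (1 + \<eta>) * F (l - t k) (w k))" if l: "l \<in> {0..R}" for l
      proof (cases "\<exists>m n::int. \<bar>x1 + l - p1 - of_int m\<bar> < \<rho> \<and> \<bar>x2 + \<alpha> * l - p2 - of_int n - \<alpha> * (x1 + l - p1 - of_int m)\<bar> < \<rho>")
        case False
        then have "along x1 x2 l \<le> M" by (intro M) blast
        moreover have "0 \<le> (\<Sum>k\<in>K. (1 + \<eta>) * F (l - t k) (w k))"
          using assms F_pos[OF w] by (intro sum_nonneg mult_nonneg_nonneg) (auto simp: less_imp_le)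
        ultimately show ?thesis by linarith
      next
        case True
        then obtain m n :: int where m: "\<bar>x1 + l - p1 - of_int m\<bar> < \<rho>"
          and n: "\<bar>x2 + \<alpha> * l - p2 - of_int n - \<alpha> * (x1 + l - p1 - of_int m)\<bar> < \<rho>" by blast
        have e1: "x1 + l - p1 - of_int m = l - t m" by (simp add: t_def)
        have e2: "x2 + \<alpha> * l - p2 - of_int n - \<alpha> * (x1 + l - p1 - of_int m) = offset x1 x2 + of_int m * \<alpha> - of_int n"
          by (simp add: offset_def algebra_simps)
        have "dist_int (offset x1 x2 + of_int m * \<alpha>) \<le> \<rho>"
          using dist_int_le[of "offset x1 x2 + of_int m * \<alpha>" n] n unfolding e2 by linarith
        then have "\<bar>w m\<bar> \<le> \<rho>0" using \<rho> residual unfolding w_def by (metis order_trans)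
        moreover have "\<bar>l - t m\<bar> \<le> \<rho>0" using m \<rho> unfolding e1 by linarith
        ultimately have "along x1 x2 l \<le> (1 + \<eta>) * F (l - t m) (w m)"
          unfolding along_at_crossing[of x1 l x2 m] t_def[symmetric] w_def[symmetric] using w by (intro asym)
        also have "\<dots> \<le> (\<Sum>k\<in>K. (1 + \<eta>) * F (l - t k) (w k))"
        proof (rule member_le_sum)
          show "m \<in> K" using m l unfolding e1 by (auto simp: K_def crossings_def t_def)
          show "0 \<le> (1 + \<eta>) * F (l - t k) (w k)" for k
            using assms F_pos[OF w[of k], of "l - t k"] by (intro mult_nonneg_nonneg) linarith+
        qed (simp add: K_def)
        finally show ?thesis using M0 by linarith
      qed
      have "((\<lambda>l. M + (\<Sum>k\<in>K. (1 + \<eta>) * F (l - t k) (w k))) has_integral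
          (R - 0) * M + (\<Sum>k\<in>K. (1 + \<eta>) * (prim (w k) (R - t k) - prim (w k) (0 - t k)))) {0..R}"
        using R has_integral_const_real[of M 0 R]
        by (intro has_integral_add has_integral_sum has_integral_mult_right F_has_integral w) (auto simp: K_def)
      from has_integral_le[OF integrable_integral[OF integrable_along[OF off]] this pointwise]
      have "integral {0..R} (along x1 x2) \<le> M * R + (\<Sum>k\<in>K. (1 + \<eta>) * (prim (w k) (R - t k) - prim (w k) (0 - t k)))"
        by (simp add: mult.commute)
      also have "\<dots> \<le> M * R + (\<Sum>k\<in>K. (1 + \<eta>) * (\<kappa> / \<bar>w k\<bar>))"
        using assms by (intro add_left_mono sum_mono mult_left_mono prim_diff_le) auto
      also have "(\<Sum>k\<in>K. (1 + \<eta>) * (\<kappa> / \<bar>w k\<bar>)) = (1 + \<eta>) * \<kappa> * crossing_sum \<alpha> (p1 - x1) (offset x1 x2) (- \<rho>) (R + \<rho>)"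
        by (simp add: crossing_sum_def K_def w_def residual sum_distrib_left)
      finally show ?thesis by simp
    qed
    with M0 show ?thesis by blast
  qed
  with \<rho>0 show ?thesis by blast
qed

text \<open>With \<open>\<rho> \<le> 1 / 4\<close> the windows of half-width \<open>\<rho>\<close>
  around different crossings are disjoint, and the crossings are restricted so that the windows lie
  in \<open>{0..R}\<close>. Each window falls short of its main term by at most a constant, and
  there are at most \<open>R + 1\<close> of them.\<close>

proposition integral_along_ge:
  assumes "\<eta> > 0" "\<eta> < 1"
  shows "\<exists>\<rho>0>0. \<forall>\<rho>. 0 < \<rho> \<longrightarrow> \<rho> \<le> \<rho>0 \<longrightarrow> (\<exists>M\<ge>0. \<forall>x1 x2 R. off_orbit x1 x2 \<longrightarrow> 0 \<le> R \<longrightarrow>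
     (1 - \<eta>) * \<kappa> * crossing_sum \<alpha> (p1 - x1) (offset x1 x2) \<rho> (R - \<rho>) - M * (R + 1) \<le> integral {0..R} (along x1 x2))"
proof -
  obtain \<rho>1 where \<rho>1: "\<rho>1 > 0" and asym: "\<And>s w. \<bar>s\<bar> \<le> \<rho>1 \<Longrightarrow> \<bar>w\<bar> \<le> \<rho>1 \<Longrightarrow> w \<noteq> 0 \<Longrightarrow>
      (1 - \<eta>) * F s w \<le> G (p1 + s) (p2 + w + \<alpha> * s)"
    using asymptotic[OF assms(1)] unfolding F_def by blast
  define \<rho>0 where "\<rho>0 = min \<rho>1 (1 / 4)"
  have \<rho>0: "\<rho>0 > 0" using \<rho>1 by (simp add: \<rho>0_def)
  have "\<exists>M\<ge>0. \<forall>x1 x2 R. off_orbit x1 x2 \<longrightarrow> 0 \<le> R \<longrightarrow>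
     (1 - \<eta>) * \<kappa> * crossing_sum \<alpha> (p1 - x1) (offset x1 x2) \<rho> (R - \<rho>) - M * (R + 1) \<le> integral {0..R} (along x1 x2)"
    if \<rho>: "0 < \<rho>" "\<rho> \<le> \<rho>0" for \<rho>
  proof -
    \<comment> \<open>The first summand is the truncation error of one passage; the second covers
      passages higher than \<open>\<rho>\<close>, where the asymptotics say nothing but the main
      term is at most \<open>\<kappa> / \<rho>\<close>.\<close>
    define M where "M = (8 + 2 * \<kappa> * \<bar>B\<bar>) / (A * \<rho>) + \<kappa> / \<rho>"
    have M1: "0 \<le> (8 + 2 * \<kappa> * \<bar>B\<bar>) / (A * \<rho>)" "0 \<le> \<kappa> / \<rho>"
      using A_pos \<rho> \<kappa>_pos by (auto intro!: divide_nonneg_nonneg mult_nonneg_nonneg add_nonneg_nonneg)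
    then have M0: "M \<ge> 0" by (simp add: M_def)
    have \<rho>': "\<rho> \<le> \<rho>1" "\<rho> \<le> 1 / 4" using \<rho> by (auto simp: \<rho>0_def)
    have "(1 - \<eta>) * \<kappa> * crossing_sum \<alpha> (p1 - x1) (offset x1 x2) \<rho> (R - \<rho>) - M * (R + 1) \<le> integral {0..R} (along x1 x2)"
      if off: "off_orbit x1 x2" and R: "0 \<le> R" for x1 x2 R
    proof -
      define K where "K = crossings (p1 - x1) \<rho> (R - \<rho>)"
      define t where "t k = of_int k + (p1 - x1)" for k :: int
      define w where "w k = residual (offset x1 x2 + of_int k * \<alpha>)" for k :: int
      define I where "I k = {t k - \<rho>..t k + \<rho>}" for k
      have w: "w k \<noteq> 0" for k unfolding w_def by (rule crossing_residual_nonzero[OF off])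
      have finK: "finite K" by (simp add: K_def)
      have single: "(1 - \<eta>) * (\<kappa> / \<bar>w k\<bar>) - M \<le> integral (I k) (along x1 x2)" for k
      proof (cases "\<bar>w k\<bar> \<le> \<rho>")
        case True
        have "((\<lambda>l. (1 - \<eta>) * F (l - t k) (w k)) has_integral
            (1 - \<eta>) * (prim (w k) (t k + \<rho> - t k) - prim (w k) (t k - \<rho> - t k))) (I k)"
          unfolding I_def using \<rho> by (intro has_integral_mult_right F_has_integral w) auto
        moreover have "(along x1 x2 has_integral integral (I k) (along x1 x2)) (I k)"
          unfolding I_def by (intro integrable_integral integrable_along off)
        moreover have "(1 - \<eta>) * F (l - t k) (w k) \<le> along x1 x2 l" if "l \<in> I k" for l
          unfolding along_at_crossing[of x1 l x2 k] t_def[symmetric] w_def[symmetric]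
          using that True \<rho>' w by (intro asym) (auto simp: I_def)
        ultimately have "(1 - \<eta>) * (prim (w k) (t k + \<rho> - t k) - prim (w k) (t k - \<rho> - t k)) \<le> integral (I k) (along x1 x2)"
          by (rule has_integral_le)
        moreover have "(1 - \<eta>) * (\<kappa> / \<bar>w k\<bar> - (8 + 2 * \<kappa> * \<bar>B\<bar>) / (A * \<rho>)) \<le> (1 - \<eta>) * (prim (w k) \<rho> - prim (w k) (- \<rho>))"
          using assms(2) \<rho>(1) w by (intro mult_left_mono prim_diff_ge) auto
        moreover have "(1 - \<eta>) * ((8 + 2 * \<kappa> * \<bar>B\<bar>) / (A * \<rho>)) \<le> M"
          using mult_right_mono[of "1 - \<eta>" 1, OF _ M1(1)] assms(1) M1(2) by (simp add: M_def)
        ultimately show ?thesis by (simp add: right_diff_distrib)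
      next
        case False
        have "(1 - \<eta>) * (\<kappa> / \<bar>w k\<bar>) \<le> 1 * (\<kappa> / \<rho>)"
          using False assms \<rho> \<kappa>_pos by (intro mult_mono divide_left_mono) auto
        moreover have "0 \<le> integral (I k) (along x1 x2)"
          unfolding I_def by (intro integral_nonneg integrable_along off) (simp add: nonneg)
        ultimately show ?thesis using M1 by (simp add: M_def)
      qed
      have disj: "k = j" if "l \<in> I k" "l \<in> I j" for l k j
      proof -
        have "\<bar>real_of_int k - of_int j\<bar> < 1" using that \<rho>' by (auto simp: I_def t_def)
        then have "\<bar>k - j\<bar> < 1" by linarith
        then show ?thesis by linarith
      qed
      have I_sub: "I k \<subseteq> {0..R}" if "k \<in> K" for k
        using that by (auto simp: I_def K_def crossings_def t_def)
      have "((\<lambda>l. \<Sum>k\<in>K. if l \<in> I k then along x1 x2 l else 0) has_integral (\<Sum>k\<in>K. integral (I k) (along x1 x2))) {0..R}"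
      proof (intro has_integral_sum finK)
        fix k assume k: "k \<in> K"
        have "(along x1 x2 has_integral integral (I k) (along x1 x2)) (I k)"
          unfolding I_def by (intro integrable_integral integrable_along off)
        then show "((\<lambda>l. if l \<in> I k then along x1 x2 l else 0) has_integral integral (I k) (along x1 x2)) {0..R}"
          by (rule has_integral_restrict[OF I_sub[OF k], THEN iffD2])
      qed
      moreover have "(along x1 x2 has_integral integral {0..R} (along x1 x2)) {0..R}"
        by (intro integrable_integral integrable_along off)
      moreover have "(\<Sum>k\<in>K. if l \<in> I k then along x1 x2 l else 0) \<le> along x1 x2 l" for l
      proof (cases "\<exists>k\<in>K. l \<in> I k")
        case True
        then obtain k where k: "k \<in> K" "l \<in> I k" by blast
        have "(\<Sum>j\<in>K. if l \<in> I j then along x1 x2 l else 0) = (\<Sum>j\<in>K. if j = k then along x1 x2 l else 0)"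
          using disj k by (intro sum.cong) auto
        then show ?thesis using k finK by simp
      next
        case False
        then have "(\<Sum>k\<in>K. if l \<in> I k then along x1 x2 l else 0) = 0" by (intro sum.neutral) auto
        then show ?thesis using nonneg by simp
      qed
      ultimately have "(\<Sum>k\<in>K. integral (I k) (along x1 x2)) \<le> integral {0..R} (along x1 x2)"
        by (rule has_integral_le)
      moreover have "(\<Sum>k\<in>K. (1 - \<eta>) * (\<kappa> / \<bar>w k\<bar>) - M) \<le> (\<Sum>k\<in>K. integral (I k) (along x1 x2))"
        by (intro sum_mono single)
      moreover have "(\<Sum>k\<in>K. (1 - \<eta>) * (\<kappa> / \<bar>w k\<bar>) - M)
          = (1 - \<eta>) * \<kappa> * crossing_sum \<alpha> (p1 - x1) (offset x1 x2) \<rho> (R - \<rho>) - M * real (card K)"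
        by (simp add: crossing_sum_def K_def w_def residual sum_distrib_left sum_subtractf)
      moreover have "M * real (card K) \<le> M * (R + 1)"
        using card_crossings_le[of \<rho> "R - \<rho>" "p1 - x1"] \<rho> \<rho>' R M0 unfolding K_def by (intro mult_left_mono) auto
      ultimately show ?thesis by linarith
    qed
    with M0 show ?thesis by blast
  qed
  with \<rho>0 show ?thesis by blast
qed

end

section \<open>Sums over the crossings of a vertical circle\<close>

lemma crossing_sum_mono:
  assumes "c \<le> a" "b \<le> d"
  shows "crossing_sum \<alpha> \<tau> y a b \<le> crossing_sum \<alpha> \<tau> y c d"
  unfolding crossing_sum_def using assms
  by (intro sum_mono2 finite_crossings) (auto simp: crossings_def)

lemma crossing_sum_nonneg: "0 \<le> crossing_sum \<alpha> \<tau> y a b"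
  unfolding crossing_sum_def by (intro sum_nonneg) auto

lemma crossing_sum_split:
  "crossing_sum \<alpha> \<tau> y a c \<le> crossing_sum \<alpha> \<tau> y a b + crossing_sum \<alpha> \<tau> y b c"
proof -
  have "crossing_sum \<alpha> \<tau> y a c \<le> (\<Sum>k\<in>crossings \<tau> a b \<union> crossings \<tau> b c. 1 / dist_int (y + of_int k * \<alpha>))"
    unfolding crossing_sum_def by (intro sum_mono2 finite_UnI finite_crossings) (auto simp: crossings_def)
  also have "\<dots> \<le> crossing_sum \<alpha> \<tau> y a b + crossing_sum \<alpha> \<tau> y b c"
    unfolding crossing_sum_def
    using sum_nonneg[of "crossings \<tau> a b \<inter> crossings \<tau> b c" "\<lambda>k. 1 / dist_int (y + of_int k * \<alpha>)"]
    by (subst sum_Un) auto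
  finally show ?thesis .
qed

text \<open>For a stopping point translated by \<open>r (1, \<alpha>)\<close> and an integer vector:
  its crossings have the same heights, only delayed by \<open>r\<close> and renumbered by
  \<open>m\<close>.\<close>

lemma crossing_sum_shift:
  "crossing_sum \<alpha> (\<tau> + r + of_int m) (y + of_int m * \<alpha> - of_int n) a b = crossing_sum \<alpha> \<tau> y (a - r) (b - r)"
  unfolding crossing_sum_def
proof (rule sum.reindex_bij_witness[of _ "\<lambda>k. k - m" "\<lambda>k. k + m"])
  fix k assume "k \<in> crossings (\<tau> + r + of_int m) a b"
  then show "k + m \<in> crossings \<tau> (a - r) (b - r)" by (auto simp: crossings_def)
  show "1 / dist_int (y + of_int (k + m) * \<alpha>) = 1 / dist_int (y + of_int m * \<alpha> - of_int n + of_int k * \<alpha>)"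
    using dist_int_diff_int[of "y + of_int (k + m) * \<alpha>" n] by (simp add: algebra_simps)
qed (auto simp: crossings_def)

text \<open>The constant 14 is 2 from the closest admissible points plus 4 times 3, since
  \<open>1 + ln (2 * Q)\<close> is at most \<open>3 * ln Q\<close>.\<close>

lemma crossing_sum_le:
  assumes ga: "good_approx \<alpha> Q" and Q: "ln (real Q) \<ge> 1" and ab: "b - a < real Q"
    and far: "\<And>k. k \<in> crossings \<tau> a b \<Longrightarrow> 1 / (real Q * ln (real Q)) \<le> dist_int (y + of_int k * \<alpha>)"
  shows "crossing_sum \<alpha> \<tau> y a b \<le> 14 * (real Q * ln (real Q))"
proof -
  have Q1: "Q \<ge> 1" using ga by (simp add: good_approx_def)
  have diff: "\<bar>k - l\<bar> < int Q" if kl: "k \<in> crossings \<tau> a b" "l \<in> crossings \<tau> a b" for k l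
  proof -
    have "\<bar>real_of_int k - of_int l\<bar> < real Q" using kl ab by (auto simp: crossings_def)
    then have "real_of_int \<bar>k - l\<bar> < of_int (int Q)" by simp
    then show ?thesis by (simp only: of_int_less_iff)
  qed
  have pos: "0 < 1 / (real Q * ln (real Q))"
    using Q Q1 by (intro divide_pos_pos mult_pos_pos less_le_trans[OF zero_less_one Q]) auto
  have "crossing_sum \<alpha> \<tau> y a b \<le> 2 / (1 / (real Q * ln (real Q))) + 4 * real Q * (1 + ln (2 * real Q))"
    unfolding crossing_sum_def by (rule good_approx_sum_le[OF ga finite_crossings diff far pos])
  also have "ln (2 * real Q) \<le> 1 + ln (real Q)"
    using Q1 ln_2_less_1 by (simp add: ln_mult)
  then have "4 * real Q * (1 + ln (2 * real Q)) \<le> 4 * real Q * (3 * ln (real Q))"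
    using Q by (intro mult_left_mono) auto
  finally show ?thesis by (simp add: algebra_simps)
qed

text \<open>The crossings are cut into \<open>m\<close> blocks of \<open>Q\<close> consecutive ones,
  and \<open>good_approx_sum_ge\<close> applies to each block from its own starting height.\<close>

lemma crossing_sum_ge:
  assumes ga: "good_approx \<alpha> Q" and off: "\<And>k::int. y + of_int k * \<alpha> \<notin> \<int>" and ab: "real (m * Q) \<le> b - a"
  shows "crossing_sum \<alpha> \<tau> y a b \<ge> real m * (real Q * (ln (real Q) - 1))"
proof -
  define k0 where "k0 = \<lceil>a - \<tau>\<rceil>"
  have k0: "a - \<tau> \<le> of_int k0" "of_int k0 < a - \<tau> + 1" unfolding k0_def by linarith+
  define f where "f i = 1 / dist_int (y + of_int (k0 + int i) * \<alpha>)" for i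
  have "real m * (real Q * (ln (real Q) - 1)) = (\<Sum>j<m. real Q * (ln (real Q) - 1))" by simp
  also have "\<dots> \<le> (\<Sum>j<m. sum f {j * Q..<j * Q + Q})"
  proof (rule sum_mono)
    fix j
    have "real Q * (ln (real Q) - 1) \<le> (\<Sum>i<Q. 1 / dist_int ((y + of_int (k0 + int (j * Q)) * \<alpha>) + real i * \<alpha>))"
    proof (rule good_approx_sum_ge[OF ga])
      fix i :: nat
      show "y + real_of_int (k0 + int (j * Q)) * \<alpha> + real i * \<alpha> \<notin> \<int>"
        using off[of "k0 + int (j * Q) + int i"] by (simp add: algebra_simps)
    qed
    also have "\<dots> = (\<Sum>i<Q. f (i + j * Q))"
      by (intro sum.cong) (auto simp: f_def algebra_simps)
    also have "\<dots> = sum f {j * Q..<j * Q + Q}"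
      using sum.shift_bounds_nat_ivl[of f 0 "j * Q" Q] by (simp add: lessThan_atLeast0 add.commute)
    finally show "real Q * (ln (real Q) - 1) \<le> sum f {j * Q..<j * Q + Q}" .
  qed
  also have "\<dots> = sum f {..<m * Q}" by (rule sum.nat_group)
  also have "\<dots> = (\<Sum>k\<in>(\<lambda>i. k0 + int i) ` {..<m * Q}. 1 / dist_int (y + of_int k * \<alpha>))"
    by (subst sum.reindex) (auto simp: inj_on_def f_def)
  also have "\<dots> \<le> crossing_sum \<alpha> \<tau> y a b"
    unfolding crossing_sum_def
  proof (rule sum_mono2)
    show "(\<lambda>i. k0 + int i) ` {..<m * Q} \<subseteq> crossings \<tau> a b"
    proof clarify
      fix i assume "i < m * Q"
      then have "i + 1 \<le> m * Q" by simp
      then have "real (i + 1) \<le> real (m * Q)" by (simp only: of_nat_le_iff)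
      then show "k0 + int i \<in> crossings \<tau> a b" using k0 ab by (simp add: crossings_def)
    qed
  qed auto
  finally show ?thesis .
qed

section \<open>Time spent near one stopping point along a line\<close>

locale flow_line =
  singularity \<alpha> p1 p2 A B C G + approx_sequence \<alpha> Q
  for \<alpha> p1 p2 A B C G Q +
  fixes x1 x2 :: real
  assumes off: "off_orbit x1 x2" and near: "\<bar>p1 - x1\<bar> \<le> 1"
begin

definition time :: "real \<Rightarrow> real" where "time R = integral {0..R} (along x1 x2)"

abbreviation "y \<equiv> offset x1 x2"
abbreviation "S \<equiv> crossing_sum \<alpha> (p1 - x1) y"
abbreviation "L i \<equiv> real (Q i) * ln (real (Q i))"

lemma time_nonneg: "0 \<le> time R"
  unfolding time_def by (intro integral_nonneg integrable_along off nonneg ballI)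

lemma time_mono: "R \<le> R' \<Longrightarrow> time R \<le> time R'"
  unfolding time_def by (intro integral_subset_le integrable_along off nonneg ballI) auto

lemma L_ge: "L i \<ge> real (Q i)" "L i \<ge> 3"
proof -
  have "real (Q i) * 1 \<le> L i" by (intro mult_left_mono ln_Q_ge) simp
  then show "L i \<ge> real (Q i)" by simp
  then show "L i \<ge> 3" using Q_ge[of i] by linarith
qed

lemma L_at_top: "filterlim L at_top sequentially"
proof (rule filterlim_at_top_mono[OF ln_Q_at_top])
  have "1 * ln (real (Q i)) \<le> L i" for i
    using ln_Q_ge[of i] Q_ge[of i] by (intro mult_right_mono) auto
  then show "\<forall>\<^sub>F i in sequentially. ln (real (Q i)) \<le> L i" by simp
qed

lemma time_le_on_far:
  obtains K where "K > 0" "\<And>i. far y i \<Longrightarrow> time (real (Q i) + 1) \<le> K * L i"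
proof -
  obtain \<rho>0 where \<rho>0: "\<rho>0 > 0" "\<And>\<rho>. 0 < \<rho> \<Longrightarrow> \<rho> \<le> \<rho>0 \<Longrightarrow> (\<exists>M\<ge>0. \<forall>x1 x2 R. off_orbit x1 x2 \<longrightarrow> 0 \<le> R \<longrightarrow>
     integral {0..R} (along x1 x2) \<le> (1 + 1) * \<kappa> * crossing_sum \<alpha> (p1 - x1) (offset x1 x2) (- \<rho>) (R + \<rho>) + M * R)"
    using integral_along_le[of 1] by auto
  define \<rho> where "\<rho> = min \<rho>0 (1 / 4)"
  have \<rho>: "0 < \<rho>" "\<rho> \<le> \<rho>0" "\<rho> \<le> 1 / 4" using \<rho>0(1) by (auto simp: \<rho>_def)
  obtain M where M: "M \<ge> 0" "\<And>R. 0 \<le> R \<Longrightarrow> time R \<le> 2 * \<kappa> * S (- \<rho>) (R + \<rho>) + M * R"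
    using \<rho>0(2)[OF \<rho>(1,2)] off unfolding time_def by auto
  have "time (real (Q i) + 1) \<le> (56 * \<kappa> + 2 * M) * L i" if far: "far y i" for i
  proof -
    let ?Q = "real (Q i)"
    have Q3: "?Q \<ge> 3" using Q_ge[of i] by simp
    \<comment> \<open>The bound needs fewer than \<open>Q\<close> time units, because only then are
      the points separated. The window here is slightly longer and is therefore cut in the
      middle.\<close>
    have half: "S a b \<le> 14 * L i" if ab: "b - a < ?Q" "- 1 \<le> a" "b \<le> 2 * ?Q" for a b
    proof (rule crossing_sum_le[OF good ln_Q_ge ab(1)])
      fix k assume "k \<in> crossings (p1 - x1) a b"
      then have "- 2 \<le> real_of_int k" "real_of_int k \<le> 2 * ?Q + 1"
        using ab near by (auto simp: crossings_def)
      then have "\<bar>k\<bar> \<le> 3 * int (Q i)" using Q3 by linarith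
      then show "1 / L i \<le> dist_int (y + of_int k * \<alpha>)" using far unfolding far_def by blast
    qed
    have "S (- \<rho>) (?Q + 1 + \<rho>) \<le> S (- \<rho>) ((?Q + 1) / 2) + S ((?Q + 1) / 2) (?Q + 1 + \<rho>)"
      by (rule crossing_sum_split)
    also have "\<dots> \<le> 14 * L i + 14 * L i"
      using \<rho> Q3 by (intro add_mono half) (auto simp: field_simps)
    finally have "2 * \<kappa> * S (- \<rho>) (?Q + 1 + \<rho>) \<le> 2 * \<kappa> * (28 * L i)"
      using \<kappa>_pos by (intro mult_left_mono) auto
    moreover have "?Q + 1 \<le> 2 * L i" using L_ge(1)[of i] Q3 by linarith
    then have "M * (?Q + 1) \<le> M * (2 * L i)" using M(1) by (rule mult_left_mono)
    ultimately show ?thesis using M(2)[of "?Q + 1"] by (simp add: algebra_simps)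
  qed
  moreover have "56 * \<kappa> + 2 * M > 0" using \<kappa>_pos M(1) by simp
  ultimately show thesis using that by blast
qed

lemma time_ge:
  obtains c K where "c > 0" "K \<ge> 0"
    "\<And>i m R. 0 \<le> R \<Longrightarrow> real (m * Q i) \<le> R - 1 \<Longrightarrow> c * (real m * (real (Q i) * (ln (real (Q i)) - 1))) - K * (R + 1) \<le> time R"
proof -
  obtain \<rho>0 where \<rho>0: "\<rho>0 > 0" "\<And>\<rho>. 0 < \<rho> \<Longrightarrow> \<rho> \<le> \<rho>0 \<Longrightarrow> (\<exists>M\<ge>0. \<forall>x1 x2 R. off_orbit x1 x2 \<longrightarrow> 0 \<le> R \<longrightarrow>
     (1 - 1/2) * \<kappa> * crossing_sum \<alpha> (p1 - x1) (offset x1 x2) \<rho> (R - \<rho>) - M * (R + 1) \<le> integral {0..R} (along x1 x2))"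
    using integral_along_ge[of "1/2"] by auto
  define \<rho> where "\<rho> = min \<rho>0 (1 / 4)"
  have \<rho>: "0 < \<rho>" "\<rho> \<le> \<rho>0" "\<rho> \<le> 1 / 4" using \<rho>0(1) by (auto simp: \<rho>_def)
  obtain M where M: "M \<ge> 0" "\<And>R. 0 \<le> R \<Longrightarrow> (\<kappa> / 2) * S \<rho> (R - \<rho>) - M * (R + 1) \<le> time R"
    using \<rho>0(2)[OF \<rho>(1,2)] off unfolding time_def by auto
  have "\<kappa> / 2 * (real m * (real (Q i) * (ln (real (Q i)) - 1))) - M * (R + 1) \<le> time R"
    if R: "0 \<le> R" "real (m * Q i) \<le> R - 1" for i m R
  proof -
    have "real m * (real (Q i) * (ln (real (Q i)) - 1)) \<le> S \<rho> (R - \<rho>)"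
      using off \<rho> R by (intro crossing_sum_ge[OF good]) (auto simp: off_orbit_def)
    then have "\<kappa> / 2 * (real m * (real (Q i) * (ln (real (Q i)) - 1))) \<le> (\<kappa> / 2) * S \<rho> (R - \<rho>)"
      using \<kappa>_pos by (intro mult_left_mono) auto
    with M(2)[OF R(1)] show ?thesis by linarith
  qed
  moreover have "\<kappa> / 2 > 0" using \<kappa>_pos by simp
  ultimately show thesis using M(1) that by blast
qed

text \<open>A fixed scale suffices. Each block of length \<open>Q i\<close> takes time of order
  \<open>Q i * ln (Q i)\<close>, so the time is at least of order \<open>R * ln (Q i)\<close> for
  all large \<open>R\<close>, and \<open>ln (Q i)\<close> can be chosen as large as desired.\<close>

lemma time_superlinear:
  assumes "\<epsilon> > 0"
  obtains R0 where "R0 > 0" "\<And>R. R \<ge> R0 \<Longrightarrow> R + 1 \<le> \<epsilon> * time R"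
proof -
  obtain c K where c: "c > 0" "K \<ge> 0" and
    bound: "\<And>i m R. 0 \<le> R \<Longrightarrow> real (m * Q i) \<le> R - 1 \<Longrightarrow> c * (real m * (real (Q i) * (ln (real (Q i)) - 1))) - K * (R + 1) \<le> time R"
    by (rule time_ge) blast
  \<comment> \<open>Chosen so that \<open>c * (D - 1) / 4 = K + 1 / \<epsilon>\<close>: the part
    \<open>K\<close> pays for the error term, and a quarter of \<open>R + 1\<close> is what complete
    blocks certainly cover.\<close>
  define D where "D = (K + 1 / \<epsilon>) * 4 / c + 1"
  obtain i where i: "ln (real (Q i)) \<ge> D"
    using ln_Q_at_top unfolding filterlim_at_top by (auto simp: eventually_sequentially)
  define R0 where "R0 = 2 * real (Q i) + 4"
  have "R + 1 \<le> \<epsilon> * time R" if R: "R \<ge> R0" for R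
  proof -
    define m where "m = nat \<lfloor>(R - 1) / real (Q i)\<rfloor>"
    have Q: "real (Q i) \<ge> 3" using Q_ge[of i] by simp
    have R1: "R > 1" using R Q by (simp add: R0_def)
    have m: "real m \<le> (R - 1) / real (Q i)" "(R - 1) / real (Q i) < real m + 1"
      unfolding m_def using R1 Q by simp_all
    have m': "real (m * Q i) \<le> R - 1" "R - 1 < real m * real (Q i) + real (Q i)"
      using m Q by (simp_all add: field_simps)
    have "(R + 1) / 4 \<le> real m * real (Q i)" using m' R Q by (simp add: R0_def)
    then have "(R + 1) / 4 * (D - 1) \<le> real m * real (Q i) * (ln (real (Q i)) - 1)"
      using i R1 c assms by (intro mult_mono) (auto simp: D_def)
    then have "c * ((R + 1) / 4 * (D - 1)) \<le> c * (real m * (real (Q i) * (ln (real (Q i)) - 1)))"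
      using c by (intro mult_left_mono) (auto simp: mult.assoc)
    moreover have "c * ((R + 1) / 4 * (D - 1)) = (R + 1) * (K + 1 / \<epsilon>)" using c by (simp add: D_def)
    ultimately have "(R + 1) * (K + 1 / \<epsilon>) - K * (R + 1) \<le> time R"
      using bound[of R m i] m'(1) R1 by linarith
    then have "(R + 1) / \<epsilon> \<le> time R" by (simp add: algebra_simps)
    then show ?thesis using assms by (simp add: field_simps)
  qed
  moreover have "R0 > 0" by (simp add: R0_def)
  ultimately show thesis using that by blast
qed

lemma time_ge_L:
  obtains c where "c > 0" "\<forall>\<^sub>F i in sequentially. c * L i \<le> time (real (Q i) + 1)"
proof -
  obtain c K where c: "c > 0" "K \<ge> 0" and
    bound: "\<And>i m R. 0 \<le> R \<Longrightarrow> real (m * Q i) \<le> R - 1 \<Longrightarrow> c * (real m * (real (Q i) * (ln (real (Q i)) - 1))) - K * (R + 1) \<le> time R"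
    by (rule time_ge) blast
  have "\<forall>\<^sub>F i in sequentially. ln (real (Q i)) \<ge> 2 * (c + 2 * K) / c"
    using ln_Q_at_top unfolding filterlim_at_top by blast
  then have "\<forall>\<^sub>F i in sequentially. c / 2 * L i \<le> time (real (Q i) + 1)"
  proof eventually_elim
    case (elim i)
    have Q: "real (Q i) \<ge> 3" using Q_ge[of i] by simp
    have "c * (real (Q i) * (ln (real (Q i)) - 1)) - K * (real (Q i) + 1 + 1) \<le> time (real (Q i) + 1)"
      using bound[of "real (Q i) + 1" 1 i] by simp
    moreover have "K * (real (Q i) + 1 + 1) \<le> K * (2 * real (Q i))" using c Q by (intro mult_left_mono) auto
    moreover have "(c + 2 * K) * real (Q i) \<le> c / 2 * L i"
    proof -
      have "c + 2 * K \<le> c / 2 * ln (real (Q i))" using elim c by (simp add: field_simps)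
      then have "(c + 2 * K) * real (Q i) \<le> c / 2 * ln (real (Q i)) * real (Q i)"
        using Q by (intro mult_right_mono) auto
      then show ?thesis by (simp add: algebra_simps)
    qed
    ultimately show ?case by (simp add: algebra_simps)
  qed
  then show thesis using c that[of "c / 2"] by simp
qed

end

lemma exp_beats_square:
  fixes c K :: real
  assumes "c > 0"
  shows "\<forall>\<^sub>F x in at_top. K * x\<^sup>2 < exp (c * x)"
proof -
  have "((\<lambda>x. (c * x) ^ 2 / exp (c * x)) \<longlongrightarrow> 0) at_top"
    by (rule filterlim_compose[OF tendsto_power_div_exp_0])
       (use assms in \<open>auto intro!: filterlim_tendsto_pos_mult_at_top filterlim_ident\<close>)
  then have "\<forall>\<^sub>F x in at_top. (c * x) ^ 2 / exp (c * x) < c\<^sup>2 / (\<bar>K\<bar> + 1)"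
    using assms by (intro order_tendstoD) auto
  then show ?thesis
  proof eventually_elim
    case (elim x)
    then have "c\<^sup>2 * ((\<bar>K\<bar> + 1) * x\<^sup>2) < c\<^sup>2 * exp (c * x)"
      by (simp add: field_simps power_mult_distrib)
    then have "(\<bar>K\<bar> + 1) * x\<^sup>2 < exp (c * x)" using assms by simp
    moreover have "K * x\<^sup>2 \<le> (\<bar>K\<bar> + 1) * x\<^sup>2" by (intro mult_right_mono) auto
    ultimately show ?case by linarith
  qed
qed

context flow_line
begin

text \<open>A factor \<open>g\<close> gained over every step \<open>r\<close> would force growth
  like \<open>exp (c * R)\<close> with \<open>c = ln g / r\<close>. At the scales where the orbit is
  far, however, the time is at most \<open>K * Q * ln Q\<close>, hence polynomial in
  \<open>Q\<close>.\<close>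

lemma time_subexponential:
  assumes far: "\<And>i0. \<exists>i\<ge>i0. far y i" and g: "g > 1" and r: "r > 0"
  shows "\<exists>R\<ge>R0. time (R + r) < g * time R"
proof (rule ccontr)
  assume "\<not> (\<exists>R\<ge>R0. time (R + r) < g * time R)"
  then have neg: "g * time R \<le> time (R + r)" if "R \<ge> R0" for R using that by (meson not_le)
  obtain R1 where R1: "R1 > 0" "\<And>R. R \<ge> R1 \<Longrightarrow> R + 1 \<le> 1 * time R" using time_superlinear[OF zero_less_one] by blast
  define a where "a = max R0 R1"
  have ta: "time a \<ge> 1" using R1(2)[of a] R1(1) by (auto simp: a_def)
  have grow: "g ^ n * time a \<le> time (a + real n * r)" for n
  proof (induction n)
    case (Suc n)
    have "g ^ Suc n * time a = g * (g ^ n * time a)" by simp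
    also have "\<dots> \<le> g * time (a + real n * r)" using Suc g by (intro mult_left_mono) auto
    also have "\<dots> \<le> time (a + real n * r + r)" by (rule neg) (use r in \<open>auto simp: a_def intro: add_increasing2\<close>)
    finally show ?case by (simp add: algebra_simps)
  qed simp
  obtain K where K: "K > 0" "\<And>i. far y i \<Longrightarrow> time (real (Q i) + 1) \<le> K * L i" using time_le_on_far by blast
  define c where "c = ln g / r"
  have c: "c > 0" using g r by (simp add: c_def)
  define e where "e = exp (c * (a + r))"
  have "\<forall>\<^sub>F x in at_top. (K * e) * x\<^sup>2 < exp (c * x)" by (rule exp_beats_square[OF c])
  then have "\<forall>\<^sub>F x in at_top. (K * e) * x\<^sup>2 < exp (c * x) \<and> a \<le> x"
    using eventually_ge_at_top[of a] by (rule eventually_conj)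
  then obtain x0 where x0: "\<And>x. x \<ge> x0 \<Longrightarrow> (K * e) * x\<^sup>2 < exp (c * x) \<and> a \<le> x"
    unfolding eventually_at_top_linorder by blast
  have "filterlim (\<lambda>i. real (Q i)) at_top sequentially"
  proof (rule filterlim_at_top_mono[OF ln_Q_at_top])
    have "ln (real (Q i)) \<le> real (Q i)" for i using Q_ge[of i] ln_le_minus_one[of "real (Q i)"] by simp
    then show "\<forall>\<^sub>F i in sequentially. ln (real (Q i)) \<le> real (Q i)" by simp
  qed
  then obtain i0 where i0: "\<And>i. i \<ge> i0 \<Longrightarrow> real (Q i) \<ge> x0"
    unfolding filterlim_at_top eventually_sequentially by blast
  obtain i where i: "i \<ge> i0" "far y i" using far by blast
  define q where "q = real (Q i)"
  have q: "K * e * q\<^sup>2 < exp (c * q)" "a \<le> q" "q \<ge> 3"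
    using x0[OF i0[OF i(1)]] Q_ge[of i] by (auto simp: q_def)
  \<comment> \<open>The number of whole steps from \<open>a\<close> to \<open>q\<close>. The
    incomplete step and the start at \<open>a\<close> cost at most the factor
    \<open>e = exp (c * (a + r))\<close>.\<close>
  define n where "n = nat \<lfloor>(q - a) / r\<rfloor>"
  have n: "real n \<le> (q - a) / r" "(q - a) / r < real n + 1" unfolding n_def using q r by auto
  have n': "a + real n * r \<le> q" "q - a - r \<le> real n * r" using n r by (auto simp: field_simps)
  have "c * (q - (a + r)) \<le> c * (real n * r)" using n'(2) c by (intro mult_left_mono) auto
  also have "\<dots> = real n * ln g" using r by (simp add: c_def)
  finally have "exp (c * (q - (a + r))) \<le> exp (real n * ln g)" by simp
  also have "\<dots> = g ^ n" using g by (simp add: exp_of_nat_mult)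
  also have "\<dots> = g ^ n * 1" by simp
  also have "\<dots> \<le> g ^ n * time a" using ta g by (intro mult_left_mono) auto
  also have "\<dots> \<le> time (a + real n * r)" by (rule grow)
  also have "\<dots> \<le> time (q + 1)" using n'(1) by (intro time_mono) auto
  also have "\<dots> \<le> K * L i" using K(2)[OF i(2)] by (simp add: q_def)
  also have "L i \<le> q * q" unfolding q_def
    using ln_le_minus_one[of "real (Q i)"] Q_ge[of i] by (intro mult_left_mono) auto
  finally have "exp (c * (q - (a + r))) \<le> K * q\<^sup>2" using K(1) by (simp add: power2_eq_square)
  then have "exp (c * (q - (a + r))) * e \<le> K * q\<^sup>2 * e" by (intro mult_right_mono) (auto simp: e_def)
  moreover have "exp (c * (q - (a + r))) * e = exp (c * q)"
    unfolding e_def exp_add[symmetric] by (simp add: algebra_simps)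
  ultimately show False using q(1) by (simp add: algebra_simps)
qed

end

section \<open>Shares of the two stopping points\<close>

locale two_lines =
  sp: flow_line \<alpha> p1 p2 Ap Bp Cp Gp Q x1 x2 + sq: flow_line \<alpha> q1 q2 Aq Bq Cq Gq Q x1 x2
  for \<alpha> p1 p2 Ap Bp Cp Gp q1 q2 Aq Bq Cq Gq Q x1 x2
begin

definition T :: "real \<Rightarrow> real" where "T R = sp.time R + sq.time R"

lemma T_ge: "sp.time R \<le> T R" "sq.time R \<le> T R"
  using sp.time_nonneg[of R] sq.time_nonneg[of R] by (auto simp: T_def)

text \<open>At a scale where the orbit is far from both points, both times at \<open>Q + 1\<close>
  lie between fixed multiples of the same quantity \<open>Q * ln Q\<close>.\<close>

lemma mixed_share:
  assumes far: "\<And>i0. \<exists>i\<ge>i0. sp.far sp.y i \<and> sp.far sq.y i"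
  obtains c where "c > 0" "\<And>B. \<exists>R\<ge>0. B \<le> T R \<and> c * T R \<le> sp.time R \<and> c * T R \<le> sq.time R"
proof -
  obtain K1 where K1: "K1 > 0" "\<And>i. sp.far sp.y i \<Longrightarrow> sp.time (real (Q i) + 1) \<le> K1 * sp.L i" using sp.time_le_on_far by blast
  obtain K2 where K2: "K2 > 0" "\<And>i. sp.far sq.y i \<Longrightarrow> sq.time (real (Q i) + 1) \<le> K2 * sp.L i" using sq.time_le_on_far by blast
  obtain c1 where c1: "c1 > 0" "\<forall>\<^sub>F i in sequentially. c1 * sp.L i \<le> sp.time (real (Q i) + 1)" using sp.time_ge_L by blast
  obtain c2 where c2: "c2 > 0" "\<forall>\<^sub>F i in sequentially. c2 * sp.L i \<le> sq.time (real (Q i) + 1)" using sq.time_ge_L by blast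
  define c where "c = min c1 c2 / (K1 + K2)"
  have c: "c > 0" using c1 c2 K1 K2 by (simp add: c_def)
  have "\<exists>R\<ge>0. B \<le> T R \<and> c * T R \<le> sp.time R \<and> c * T R \<le> sq.time R" for B
  proof -
    have "\<forall>\<^sub>F i in sequentially. c1 * sp.L i \<le> sp.time (real (Q i) + 1) \<and> c2 * sp.L i \<le> sq.time (real (Q i) + 1) \<and> B / c1 \<le> sp.L i"
      using c1(2) c2(2) sp.L_at_top[unfolded filterlim_at_top, rule_format, of "B / c1"] by eventually_elim auto
    then obtain i0 where i0: "\<And>i. i \<ge> i0 \<Longrightarrow> c1 * sp.L i \<le> sp.time (real (Q i) + 1) \<and> c2 * sp.L i \<le> sq.time (real (Q i) + 1) \<and> B / c1 \<le> sp.L i"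
      unfolding eventually_sequentially by blast
    obtain i where i: "i \<ge> i0" "sp.far sp.y i" "sp.far sq.y i" using far by blast
    let ?R = "real (Q i) + 1"
    have *: "c1 * sp.L i \<le> sp.time ?R" "c2 * sp.L i \<le> sq.time ?R" "B / c1 \<le> sp.L i" using i0[OF i(1)] by auto
    have "T ?R \<le> (K1 + K2) * sp.L i" using K1(2)[OF i(2)] K2(2)[OF i(3)] by (simp add: T_def algebra_simps)
    then have "c * T ?R \<le> c * ((K1 + K2) * sp.L i)" using c by (intro mult_left_mono) auto
    also have "\<dots> = min c1 c2 * sp.L i" using K1 K2 by (simp add: c_def)
    finally have le: "c * T ?R \<le> min c1 c2 * sp.L i" .
    have "min c1 c2 * sp.L i \<le> c1 * sp.L i" "min c1 c2 * sp.L i \<le> c2 * sp.L i"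
      using sp.L_ge(2)[of i] by (auto intro!: mult_right_mono simp del: mult_le_cancel_right)
    with le * have "c * T ?R \<le> sp.time ?R" "c * T ?R \<le> sq.time ?R" by linarith+
    moreover have "B \<le> c1 * sp.L i" using *(3) c1(1) by (simp add: field_simps)
    then have "B \<le> T ?R" using *(1) T_ge(1)[of ?R] by linarith
    ultimately show ?thesis by (intro exI[of _ ?R]) auto
  qed
  with c that show thesis by blast
qed

text \<open>While the orbit comes extremely close to \<open>p\<close> it has not come similarly close to \<open>q\<close> before.\<close>

definition well_separated :: "real \<Rightarrow> nat \<Rightarrow> bool" where
  "well_separated \<rho> i \<longleftrightarrow> (\<forall>m::int. q1 - p1 - 2 * \<rho> \<le> of_int m \<longrightarrow> of_int m \<le> real (Q i) / 4 + 3 \<longrightarrow>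
      2 / sp.L i \<le> dist_int (q2 - p2 - \<alpha> * (q1 - p1) + of_int m * \<alpha>))"

text \<open>The orbit is stopped right after a passage at height below \<open>e / L\<close>, where
  \<open>L = Q ln Q\<close>. That passage alone takes time of order \<open>L / e\<close>. Every
  earlier or simultaneous passage near \<open>q\<close> has height at least \<open>1 / L\<close>, as
  otherwise the heights would violate the separation, so the time near \<open>q\<close> is at most
  of order \<open>L\<close>.\<close>

lemma share_near_one:
  assumes hits: "\<And>\<epsilon> i0. \<epsilon> > 0 \<Longrightarrow> \<exists>i\<ge>i0. sp.y \<in> hits \<alpha> (Q i) (sp.\<delta> \<epsilon> i)"
    and \<rho>s: "\<rho>s > 0" and sep: "\<forall>\<^sub>F i in sequentially. well_separated \<rho>s i" and \<epsilon>: "\<epsilon> > 0"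
  shows "\<exists>R\<ge>0. B \<le> T R \<and> sq.time R \<le> \<epsilon> * T R"
proof -
  obtain \<rho>1 where \<rho>1: "\<rho>1 > 0" "\<And>\<rho>. 0 < \<rho> \<Longrightarrow> \<rho> \<le> \<rho>1 \<Longrightarrow> (\<exists>M\<ge>0. \<forall>x1 x2 R. sp.off_orbit x1 x2 \<longrightarrow> 0 \<le> R \<longrightarrow>
     (1 - 1/2) * sp.\<kappa> * crossing_sum \<alpha> (p1 - x1) (sp.offset x1 x2) \<rho> (R - \<rho>) - M * (R + 1) \<le> integral {0..R} (sp.along x1 x2))"
    using sp.integral_along_ge[of "1/2"] by auto
  obtain \<rho>2 where \<rho>2: "\<rho>2 > 0" "\<And>\<rho>. 0 < \<rho> \<Longrightarrow> \<rho> \<le> \<rho>2 \<Longrightarrow> (\<exists>M\<ge>0. \<forall>x1 x2 R. sq.off_orbit x1 x2 \<longrightarrow> 0 \<le> R \<longrightarrow>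
     integral {0..R} (sq.along x1 x2) \<le> (1 + 1) * sq.\<kappa> * crossing_sum \<alpha> (q1 - x1) (sq.offset x1 x2) (- \<rho>) (R + \<rho>) + M * R)"
    using sq.integral_along_le[of 1] by auto
  define \<rho> where "\<rho> = min (min \<rho>1 \<rho>2) (min \<rho>s (1 / 4))"
  have \<rho>: "0 < \<rho>" "\<rho> \<le> \<rho>1" "\<rho> \<le> \<rho>2" "\<rho> \<le> 1 / 4" "\<rho> \<le> \<rho>s" using \<rho>1(1) \<rho>2(1) \<rho>s by (auto simp: \<rho>_def)
  obtain M1 where M1: "M1 \<ge> 0" "\<And>R. 0 \<le> R \<Longrightarrow> (sp.\<kappa> / 2) * sp.S \<rho> (R - \<rho>) - M1 * (R + 1) \<le> sp.time R"
    using \<rho>1(2)[OF \<rho>(1,2)] sp.off unfolding sp.time_def by auto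
  obtain M2 where M2: "M2 \<ge> 0" "\<And>R. 0 \<le> R \<Longrightarrow> sq.time R \<le> 2 * sq.\<kappa> * sq.S (- \<rho>) (R + \<rho>) + M2 * R"
    using \<rho>2(2)[OF \<rho>(1,3)] sq.off unfolding sq.time_def by auto
  define K where "K = 28 * sq.\<kappa> + M2"
  have K: "K > 0" using sq.\<kappa>_pos M2(1) by (simp add: K_def)
  \<comment> \<open>The time near \<open>p\<close> will be at least \<open>D * L\<close>: the first
    entry makes the share of \<open>q\<close> at most \<open>\<epsilon>\<close>, the last makes the
    total time exceed \<open>B\<close>.\<close>
  define D where "D = max (K / \<epsilon>) (max 1 B)"
  have D: "D \<ge> 1" "D \<ge> B" "D \<ge> K / \<epsilon>" by (auto simp: D_def)
  from D(3) have D3: "D * \<epsilon> \<ge> K" using \<epsilon> by (simp add: field_simps)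
  \<comment> \<open>Small enough that the close passage contributes \<open>(D + 2 * M1) * L\<close>;
    the part \<open>2 * M1\<close> absorbs the linear error, since
    \<open>R + 1 \<le> 2 * L\<close>.\<close>
  define e where "e = min 1 (sp.\<kappa> / (2 * (D + 2 * M1)))"
  have e: "0 < e" "e \<le> 1" "D + 2 * M1 \<le> sp.\<kappa> / 2 / e"
  proof -
    have pos: "D + 2 * M1 > 0" using D M1 by linarith
    show "0 < e" "e \<le> 1" using pos sp.\<kappa>_pos by (auto simp: e_def)
    have "e \<le> sp.\<kappa> / (2 * (D + 2 * M1))" by (simp add: e_def)
    then show "D + 2 * M1 \<le> sp.\<kappa> / 2 / e" using pos \<open>0 < e\<close> by (simp add: field_simps)
  qed
  have ypos: "dist_int (sp.y + real k * \<alpha>) > 0" for k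
    using sp.off[unfolded sp.off_orbit_def, rule_format, of "int k"] by (simp add: dist_int_pos_iff)
  \<comment> \<open>Excludes the indices 0 and 1, whose crossings may lie before or at the start of
    the orbit. From index 2 on the crossing time is at least 1, so the whole passage lies in
    \<open>{0..R}\<close>.\<close>
  define d0 where "d0 = min (dist_int (sp.y + real 0 * \<alpha>)) (dist_int (sp.y + real 1 * \<alpha>))"
  have d0: "d0 > 0" using ypos[of 0] ypos[of 1] unfolding d0_def by simp
  have "\<forall>\<^sub>F i in sequentially. well_separated \<rho>s i \<and> e / d0 \<le> sp.L i"
    using sep sp.L_at_top[unfolded filterlim_at_top, rule_format, of "e / d0"] by eventually_elim auto
  then obtain i0 where i0: "\<And>i. i \<ge> i0 \<Longrightarrow> well_separated \<rho>s i \<and> e / d0 \<le> sp.L i"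
    unfolding eventually_sequentially by blast
  obtain i where i: "i \<ge> i0" "sp.y \<in> hits \<alpha> (Q i) (sp.\<delta> e i)" using hits[OF e(1)] by blast
  then obtain k where k: "4 * k < Q i" "dist_int (sp.y + real k * \<alpha>) < e / sp.L i"
    by (auto simp: hits_def)
  have Lpos: "sp.L i \<ge> 3" by (rule sp.L_ge)
  have "e / sp.L i \<le> d0" using i0[OF i(1)] d0 Lpos by (simp add: field_simps)
  then have "\<not> dist_int (sp.y + real k * \<alpha>) \<ge> d0" using k(2) by linarith
  then have "k \<noteq> 0 \<and> k \<noteq> 1" unfolding d0_def by (metis min.cobounded1 min.cobounded2)
  then have k2: "k \<ge> 2" by linarith
  define d where "d = dist_int (sp.y + real k * \<alpha>)"
  have d: "d > 0" "d < e / sp.L i" using ypos k(2) by (auto simp: d_def)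
  define l where "l = real k + (p1 - x1)"
  define R where "R = l + \<rho>"
  have kQ: "real k < real (Q i) / 4"
  proof -
    have "real (4 * k) < real (Q i)" using k(1) by (simp only: of_nat_less_iff)
    then show ?thesis by simp
  qed
  have Q3: "real (Q i) \<ge> 3" using sp.Q_ge[of i] by simp
  have l: "l \<ge> 1" "l < real (Q i) / 4 + 1" using k2 kQ sp.near by (auto simp: l_def)
  have R: "R \<ge> 0" "R + 1 \<le> 2 * sp.L i" using l \<rho> Q3 sp.L_ge(1)[of i] unfolding R_def by linarith+
  have "1 / d \<le> sp.S \<rho> (R - \<rho>)"
  proof -
    have "int k \<in> crossings (p1 - x1) \<rho> (R - \<rho>)" using l \<rho> by (simp add: crossings_def R_def l_def)
    then have "1 / dist_int (sp.y + of_int (int k) * \<alpha>) \<le> sp.S \<rho> (R - \<rho>)"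
      unfolding crossing_sum_def by (intro member_le_sum) auto
    then show ?thesis by (simp add: d_def)
  qed
  moreover have "sp.L i / e \<le> 1 / d" using d e Lpos by (simp add: field_simps)
  ultimately have "sp.\<kappa> / 2 * (sp.L i / e) \<le> sp.\<kappa> / 2 * sp.S \<rho> (R - \<rho>)"
    using sp.\<kappa>_pos by (intro mult_left_mono) auto
  moreover have "(D + 2 * M1) * sp.L i \<le> sp.\<kappa> / 2 / e * sp.L i"
    using e(3) Lpos by (intro mult_right_mono) auto
  moreover have "M1 * (R + 1) \<le> M1 * (2 * sp.L i)" using R M1 by (intro mult_left_mono) auto
  moreover have "sp.\<kappa> / 2 * (sp.L i / e) = sp.\<kappa> / 2 / e * sp.L i" by simp
  moreover have "(D + 2 * M1) * x = D * x + M1 * (2 * x)" for x by (simp add: algebra_simps)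
  note this[of "sp.L i"]
  ultimately have P: "D * sp.L i \<le> sp.time R" using M1(2)[OF R(1)] by linarith
  have "sq.S (- \<rho>) (R + \<rho>) \<le> 14 * sp.L i"
  proof (rule crossing_sum_le[OF sp.good sp.ln_Q_ge])
    show "R + \<rho> - - \<rho> < real (Q i)" using l \<rho> Q3 unfolding R_def by linarith
    fix j assume j: "j \<in> crossings (q1 - x1) (- \<rho>) (R + \<rho>)"
    define m where "m = int k - j"
    have "q1 - p1 - 2 * \<rho> \<le> of_int m" using j by (auto simp: crossings_def m_def R_def l_def)
    moreover have "of_int m \<le> real (Q i) / 4 + 3" using j kQ sq.near \<rho> by (auto simp: crossings_def m_def)
    ultimately have m: "2 / sp.L i \<le> dist_int (q2 - p2 - \<alpha> * (q1 - p1) + of_int m * \<alpha>)"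
      using i0[OF i(1)] \<rho>(5) unfolding well_separated_def by auto
    \<comment> \<open>The height difference of passage \<open>k\<close> at \<open>p\<close> and
      passage \<open>j\<close> at \<open>q\<close> does not depend on the starting point, only on
      \<open>m = k - j\<close>. Hence separation is a condition on the scale alone.\<close>
    have "q2 - p2 - \<alpha> * (q1 - p1) + of_int m * \<alpha> = (sp.y + real k * \<alpha>) - (sq.y + of_int j * \<alpha>)"
      by (simp add: sp.offset_def sq.offset_def m_def algebra_simps)
    then have "2 / sp.L i \<le> d + dist_int (sq.y + of_int j * \<alpha>)"
      using m dist_int_triangle_diff[of "sp.y + real k * \<alpha>" "sq.y + of_int j * \<alpha>"] by (simp add: d_def)
    moreover have "d \<le> 1 / sp.L i"
    proof -
      have "e / sp.L i \<le> 1 / sp.L i" using e Lpos by (intro divide_right_mono) auto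
      then show ?thesis using d by linarith
    qed
    ultimately have "2 * (1 / sp.L i) \<le> d + dist_int (sq.y + of_int j * \<alpha>)" "d \<le> 1 / sp.L i"
      by (simp_all only: times_divide_eq_right mult_1_right)
    moreover have "u \<le> z" if "2 * u \<le> d + z" "d \<le> u" for u z :: real using that by linarith
    ultimately show "1 / sp.L i \<le> dist_int (sq.y + of_int j * \<alpha>)" by blast
  qed
  then have "2 * sq.\<kappa> * sq.S (- \<rho>) (R + \<rho>) \<le> 2 * sq.\<kappa> * (14 * sp.L i)"
    using sq.\<kappa>_pos by (intro mult_left_mono) auto
  moreover have "M2 * R \<le> M2 * sp.L i"
    using M2(1) l \<rho> Q3 sp.L_ge(1)[of i] unfolding R_def by (intro mult_left_mono) linarith+
  ultimately have Z: "sq.time R \<le> K * sp.L i" using M2(2)[OF R(1)] by (simp add: K_def algebra_simps)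
  have "K * sp.L i \<le> (\<epsilon> * D) * sp.L i" using D3 Lpos by (intro mult_right_mono) (auto simp: mult.commute)
  also have "\<dots> = \<epsilon> * (D * sp.L i)" by simp
  also have "\<dots> \<le> \<epsilon> * T R" using P T_ge(1)[of R] \<epsilon> by (intro mult_left_mono) auto
  finally have "sq.time R \<le> \<epsilon> * T R" using Z by linarith
  moreover have "B \<le> T R"
  proof -
    have "B * 1 \<le> D * sp.L i" using D Lpos by (intro mult_mono) auto
    then show ?thesis using P T_ge(1)[of R] by linarith
  qed
  ultimately show ?thesis using R(1) by blast
qed

end

section \<open>Stopping points on one orbit\<close>

locale two_lines_same_orbit = two_lines +
  fixes r :: real and m1 m2 :: int
  assumes r_pos: "r > 0" and same_orbit: "q1 = p1 + r + of_int m1" "q2 = p2 + r * \<alpha> + of_int m2"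
begin

text \<open>The line passes \<open>q\<close> exactly \<open>r\<close> time units after
  \<open>p\<close> and at the same height, so the two sums differ only by a shift of the
  window.\<close>

lemma Sq_eq: "sq.S a b = sp.S (a - r) (b - r)"
proof -
  have "q1 - x1 = p1 - x1 + r + of_int m1" by (simp add: same_orbit)
  moreover have "sq.y = sp.y + of_int m1 * \<alpha> - of_int m2"
    unfolding sp.offset_def sq.offset_def by (simp add: same_orbit algebra_simps)
  ultimately show ?thesis by (simp only: crossing_sum_shift)
qed

text \<open>As each \<open>\<kappa>\<close> is \<open>2 * pi\<close> over the root of a Hessian
  determinant, this is the weight of the point mass at \<open>p\<close> in the limit measure
  \<open>mu_infinity\<close>.\<close>

definition share :: real where "share = sp.\<kappa> / (sp.\<kappa> + sq.\<kappa>)"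

abbreviation "ratio \<equiv> sq.\<kappa> / sp.\<kappa>"

lemma share: "0 < share" "share < 1" "share * (1 + ratio) = 1"
proof -
  have k: "sp.\<kappa> > 0" "sq.\<kappa> > 0" by (rule sp.\<kappa>_pos sq.\<kappa>_pos)+
  then show "0 < share" "share < 1" by (simp_all add: share_def)
  have "1 + ratio = (sp.\<kappa> + sq.\<kappa>) / sp.\<kappa>" using k by (simp add: field_simps)
  then show "share * (1 + ratio) = 1" using k by (simp add: share_def)
qed

lemma ratio_pos: "ratio > 0" using sp.\<kappa>_pos sq.\<kappa>_pos by simp

text \<open>Every passage near \<open>q\<close> was preceded by one near \<open>p\<close> at the
  same height, so the time near \<open>q\<close> is at most about \<open>ratio\<close> times the
  time near \<open>p\<close>. The errors are linear in \<open>R\<close> and vanish against the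
  superlinear time.\<close>

lemma share_liminf:
  assumes \<epsilon>: "\<epsilon> > 0"
  obtains R0 where "\<And>R. R \<ge> R0 \<Longrightarrow> (share - \<epsilon>) * T R \<le> sp.time R"
proof -
  define e where "e = \<epsilon> / 2"
  have e: "e > 0" using \<epsilon> by (simp add: e_def)
  \<comment> \<open>The solution of \<open>(1 + \<eta>) / (1 - \<eta>) = 1 + e\<close>, the loss in
    comparing an upper bound for \<open>q\<close> with a lower bound for \<open>p\<close>.\<close>
  define \<eta> where "\<eta> = e / (2 + e)"
  have \<eta>: "0 < \<eta>" "\<eta> < 1" "1 + \<eta> = (1 + e) * (1 - \<eta>)" using e by (auto simp: \<eta>_def field_simps)
  obtain \<rho>1 where \<rho>1: "\<rho>1 > 0" "\<And>\<rho>. 0 < \<rho> \<Longrightarrow> \<rho> \<le> \<rho>1 \<Longrightarrow> (\<exists>M\<ge>0. \<forall>x1 x2 R. sp.off_orbit x1 x2 \<longrightarrow> 0 \<le> R \<longrightarrow>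
     (1 - \<eta>) * sp.\<kappa> * crossing_sum \<alpha> (p1 - x1) (sp.offset x1 x2) \<rho> (R - \<rho>) - M * (R + 1) \<le> integral {0..R} (sp.along x1 x2))"
    using sp.integral_along_ge[OF \<eta>(1,2)] by auto
  obtain \<rho>2 where \<rho>2: "\<rho>2 > 0" "\<And>\<rho>. 0 < \<rho> \<Longrightarrow> \<rho> \<le> \<rho>2 \<Longrightarrow> (\<exists>M\<ge>0. \<forall>x1 x2 R. sq.off_orbit x1 x2 \<longrightarrow> 0 \<le> R \<longrightarrow>
     integral {0..R} (sq.along x1 x2) \<le> (1 + \<eta>) * sq.\<kappa> * crossing_sum \<alpha> (q1 - x1) (sq.offset x1 x2) (- \<rho>) (R + \<rho>) + M * R)"
    using sq.integral_along_le[OF \<eta>(1)] by auto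
  define \<rho> where "\<rho> = min (min \<rho>1 \<rho>2) (r / 2)"
  have \<rho>: "0 < \<rho>" "\<rho> \<le> \<rho>1" "\<rho> \<le> \<rho>2" "2 * \<rho> \<le> r" using \<rho>1(1) \<rho>2(1) r_pos by (auto simp: \<rho>_def)
  obtain M1 where M1: "M1 \<ge> 0" "\<And>R. 0 \<le> R \<Longrightarrow> (1 - \<eta>) * sp.\<kappa> * sp.S \<rho> (R - \<rho>) - M1 * (R + 1) \<le> sp.time R"
    using \<rho>1(2)[OF \<rho>(1,2)] sp.off unfolding sp.time_def by auto
  obtain M2 where M2: "M2 \<ge> 0" "\<And>R. 0 \<le> R \<Longrightarrow> sq.time R \<le> (1 + \<eta>) * sq.\<kappa> * sq.S (- \<rho>) (R + \<rho>) + M2 * R"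
    using \<rho>2(2)[OF \<rho>(1,3)] sq.off unfolding sq.time_def by auto
  \<comment> \<open>The passages near \<open>q\<close> whose counterparts near \<open>p\<close>
    happened before the window of \<open>p\<close> opens. Their number and cost do not depend on
    \<open>R\<close>.\<close>
  define c0 where "c0 = (1 + \<eta>) * sq.\<kappa> * sp.S (- \<rho> - r) \<rho>"
  have c0: "c0 \<ge> 0" using \<eta> sq.\<kappa>_pos crossing_sum_nonneg by (auto simp: c0_def intro!: mult_nonneg_nonneg)
  define D where "D = (1 + e) * ratio * M1 + c0 + M2 + 1"
  have D: "D > 0" unfolding D_def using e ratio_pos M1 M2 c0
    by (intro add_nonneg_pos add_nonneg_nonneg mult_nonneg_nonneg) auto
  obtain R1 where R1: "R1 > 0" "\<And>R. R \<ge> R1 \<Longrightarrow> R + 1 \<le> e / D * sp.time R"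
    using sp.time_superlinear[OF divide_pos_pos[OF e D]] by blast
  have "(share - \<epsilon>) * T R \<le> sp.time R" if R: "R \<ge> R1" for R
  proof -
    have R0: "R \<ge> 0" using R R1 by simp
    have "sq.S (- \<rho>) (R + \<rho>) \<le> sp.S (- \<rho> - r) \<rho> + sp.S \<rho> (R + \<rho> - r)"
      unfolding Sq_eq by (rule crossing_sum_split)
    \<comment> \<open>The delay \<open>r\<close> swallows both margins, since
      \<open>2 * \<rho> \<le> r\<close>.\<close>
    also have "sp.S \<rho> (R + \<rho> - r) \<le> sp.S \<rho> (R - \<rho>)" using \<rho> by (intro crossing_sum_mono) auto
    finally have "(1 + \<eta>) * sq.\<kappa> * sq.S (- \<rho>) (R + \<rho>) \<le> (1 + \<eta>) * sq.\<kappa> * (sp.S (- \<rho> - r) \<rho> + sp.S \<rho> (R - \<rho>))"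
      using \<eta> sq.\<kappa>_pos by (intro mult_left_mono) auto
    also have "\<dots> = c0 + (1 + e) * ratio * ((1 - \<eta>) * sp.\<kappa> * sp.S \<rho> (R - \<rho>))"
    proof -
      have "(1 + \<eta>) * sq.\<kappa> = (1 + e) * ratio * ((1 - \<eta>) * sp.\<kappa>)" using sp.\<kappa>_pos by (simp add: \<eta>(3))
      then have "(1 + \<eta>) * sq.\<kappa> * sp.S \<rho> (R - \<rho>) = (1 + e) * ratio * ((1 - \<eta>) * sp.\<kappa>) * sp.S \<rho> (R - \<rho>)"
        by (rule arg_cong)
      then show ?thesis by (simp only: c0_def distrib_left mult.assoc)
    qed
    also have "\<dots> \<le> c0 + (1 + e) * ratio * (sp.time R + M1 * (R + 1))"
      using M1(2)[OF R0] e ratio_pos by (intro add_left_mono mult_left_mono mult_nonneg_nonneg) auto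
    also have "\<dots> = (1 + e) * ratio * sp.time R + ((1 + e) * ratio * M1 * (R + 1) + c0)"
      by (simp only: distrib_left mult.assoc add_ac)
    finally have "sq.time R \<le> (1 + e) * ratio * sp.time R + ((1 + e) * ratio * M1 * (R + 1) + c0 + M2 * R)"
      using M2(2)[OF R0] by linarith
    also have "(1 + e) * ratio * M1 * (R + 1) + c0 + M2 * R \<le> D * (R + 1)"
      using R0 c0 M2 by (simp add: D_def algebra_simps)
    also have "D * (R + 1) \<le> D * (e / D * sp.time R)" using R1(2)[OF R] D by (intro mult_left_mono) auto
    also have "D * (e / D * sp.time R) = e * sp.time R" using D by simp
    finally have "sq.time R \<le> ((1 + e) * ratio + e) * sp.time R" by (simp add: algebra_simps)
    then have "T R \<le> (1 + e) * (1 + ratio) * sp.time R" by (simp add: T_def algebra_simps)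
    then have "share * T R \<le> share * ((1 + e) * (1 + ratio) * sp.time R)"
      using share by (intro mult_left_mono) auto
    also have "\<dots> = (share * (1 + ratio)) * ((1 + e) * sp.time R)" by (simp only: mult_ac)
    also have "\<dots> = sp.time R + e * sp.time R" unfolding share(3) by (simp add: algebra_simps)
    also have "e * sp.time R \<le> \<epsilon> * T R"
      using e T_ge[of R] sp.time_nonneg[of R] by (intro mult_mono) (auto simp: e_def)
    finally show ?thesis by (simp add: algebra_simps)
  qed
  then show thesis by (rule that)
qed

text \<open>The visits to \<open>q\<close> repeat those to \<open>p\<close> with delay \<open>r\<close>, so the share of \<open>p\<close> exceeds its lower bound
  for all late times only if the time spent near \<open>p\<close> grows exponentially.\<close>

lemma share_limsup_le:
  assumes far: "\<And>i0. \<exists>i\<ge>i0. sp.far sp.y i" and \<epsilon>: "\<epsilon> > 0"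
  shows "\<exists>R\<ge>0. B \<le> T R \<and> sp.time R \<le> (share + \<epsilon>) * T R"
proof -
  define e where "e = min (\<epsilon> / 3) (1 / 4)"
  have e: "e > 0" "e \<le> 1 / 4" "3 * e \<le> \<epsilon>" using \<epsilon> by (auto simp: e_def)
  \<comment> \<open>The solution of \<open>(1 - \<eta>) / (1 + \<eta>) = 1 - e\<close>; this time
    \<open>q\<close> is bounded from below and \<open>p\<close> from above.\<close>
  define \<eta> where "\<eta> = e / (2 - e)"
  have \<eta>: "0 < \<eta>" "\<eta> < 1" "1 - \<eta> = (1 - e) * (1 + \<eta>)" using e by (auto simp: \<eta>_def field_simps)
  obtain \<rho>1 where \<rho>1: "\<rho>1 > 0" "\<And>\<rho>. 0 < \<rho> \<Longrightarrow> \<rho> \<le> \<rho>1 \<Longrightarrow> (\<exists>M\<ge>0. \<forall>x1 x2 R. sq.off_orbit x1 x2 \<longrightarrow> 0 \<le> R \<longrightarrow>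
     (1 - \<eta>) * sq.\<kappa> * crossing_sum \<alpha> (q1 - x1) (sq.offset x1 x2) \<rho> (R - \<rho>) - M * (R + 1) \<le> integral {0..R} (sq.along x1 x2))"
    using sq.integral_along_ge[OF \<eta>(1,2)] by auto
  obtain \<rho>2 where \<rho>2: "\<rho>2 > 0" "\<And>\<rho>. 0 < \<rho> \<Longrightarrow> \<rho> \<le> \<rho>2 \<Longrightarrow> (\<exists>M\<ge>0. \<forall>x1 x2 R. sp.off_orbit x1 x2 \<longrightarrow> 0 \<le> R \<longrightarrow>
     integral {0..R} (sp.along x1 x2) \<le> (1 + \<eta>) * sp.\<kappa> * crossing_sum \<alpha> (p1 - x1) (sp.offset x1 x2) (- \<rho>) (R + \<rho>) + M * R)"
    using sp.integral_along_le[OF \<eta>(1)] by auto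
  define \<rho> where "\<rho> = min (min \<rho>1 \<rho>2) (r / 2)"
  have \<rho>: "0 < \<rho>" "\<rho> \<le> \<rho>1" "\<rho> \<le> \<rho>2" "2 * \<rho> \<le> r" using \<rho>1(1) \<rho>2(1) r_pos by (auto simp: \<rho>_def)
  obtain M1 where M1: "M1 \<ge> 0" "\<And>R. 0 \<le> R \<Longrightarrow> (1 - \<eta>) * sq.\<kappa> * sq.S \<rho> (R - \<rho>) - M1 * (R + 1) \<le> sq.time R"
    using \<rho>1(2)[OF \<rho>(1,2)] sq.off unfolding sq.time_def by auto
  obtain M2 where M2: "M2 \<ge> 0" "\<And>R. 0 \<le> R \<Longrightarrow> sp.time R \<le> (1 + \<eta>) * sp.\<kappa> * sp.S (- \<rho>) (R + \<rho>) + M2 * R"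
    using \<rho>2(2)[OF \<rho>(1,3)] sp.off unfolding sp.time_def by auto
  \<comment> \<open>By time \<open>R + r'\<close> every passage near \<open>p\<close> counted up to
    \<open>R\<close> has been repeated completely near \<open>q\<close>: the delay plus one margin
    for each of the two estimates.\<close>
  define r' where "r' = r + 2 * \<rho>"
  have r': "r' > 0" using \<rho> r_pos by (simp add: r'_def)
  define D where "D = (1 - e) * ratio * M2 + M1 * (r' + 1) + 1"
  have D: "D > 0" unfolding D_def using e ratio_pos M1 M2 r'
    by (intro add_nonneg_pos add_nonneg_nonneg mult_nonneg_nonneg) auto
  obtain R1 where R1: "R1 > 0" "\<And>R. R \<ge> R1 \<Longrightarrow> R + 1 \<le> e * ratio / D * sp.time R"
    using sp.time_superlinear[OF divide_pos_pos[OF mult_pos_pos[OF e(1) ratio_pos] D]] by blast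
  obtain R2 where R2: "R2 > 0" "\<And>R. R \<ge> R2 \<Longrightarrow> R + 1 \<le> 1 * sp.time R"
    using sp.time_superlinear[OF zero_less_one] by blast
  \<comment> \<open>A moment at which \<open>p\<close> gains almost nothing during the delay, so
    that comparing \<open>p\<close> at \<open>R\<close> with \<open>q\<close> at
    \<open>R + r'\<close> is nearly a comparison at the same time.\<close>
  obtain R where R: "R \<ge> max (max R1 R2) B" "sp.time (R + r') < (1 + e) * sp.time R"
    using sp.time_subexponential[OF far _ r', of "1 + e" "max (max R1 R2) B"] e by fastforce
  have R0: "R \<ge> 0" using R R1 by simp
  let ?P = "sp.time R" and ?P' = "sp.time (R + r')" and ?Z' = "sq.time (R + r')"
  have "sp.S (- \<rho>) (R + \<rho>) \<le> sp.S (\<rho> - r) (R + r' - \<rho> - r)"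
    using \<rho> by (intro crossing_sum_mono) (auto simp: r'_def)
  then have "sp.S (- \<rho>) (R + \<rho>) \<le> sq.S \<rho> (R + r' - \<rho>)" by (simp add: Sq_eq)
  then have "(1 - \<eta>) * sq.\<kappa> * sp.S (- \<rho>) (R + \<rho>) \<le> (1 - \<eta>) * sq.\<kappa> * sq.S \<rho> (R + r' - \<rho>)"
    using \<eta> sq.\<kappa>_pos by (intro mult_left_mono) auto
  also have "\<dots> \<le> ?Z' + M1 * (R + r' + 1)" using M1(2)[of "R + r'"] R0 r' by simp
  also have "(1 - \<eta>) * sq.\<kappa> * sp.S (- \<rho>) (R + \<rho>) = (1 - e) * ratio * ((1 + \<eta>) * sp.\<kappa> * sp.S (- \<rho>) (R + \<rho>))"
    unfolding \<eta>(3) using sp.\<kappa>_pos by simp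
  finally have "(1 - e) * ratio * ((1 + \<eta>) * sp.\<kappa> * sp.S (- \<rho>) (R + \<rho>)) \<le> ?Z' + M1 * (R + r' + 1)" .
  moreover have "(1 - e) * ratio * (?P - M2 * R) \<le> (1 - e) * ratio * ((1 + \<eta>) * sp.\<kappa> * sp.S (- \<rho>) (R + \<rho>))"
    using M2(2)[OF R0] e ratio_pos by (intro mult_left_mono mult_nonneg_nonneg) auto
  moreover have "(1 - e) * ratio * (?P - M2 * R) = (1 - e) * ratio * ?P - (1 - e) * ratio * M2 * R"
    by (simp only: right_diff_distrib mult.assoc)
  ultimately have "(1 - e) * ratio * ?P \<le> ?Z' + ((1 - e) * ratio * M2 * R + M1 * (R + r' + 1))"
    by linarith
  also have "(1 - e) * ratio * M2 * R + M1 * (R + r' + 1) \<le> D * (R + 1)"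
  proof -
    have "(1 - e) * ratio * M2 * R \<le> (1 - e) * ratio * M2 * (R + 1)"
      using e ratio_pos M2 by (intro mult_left_mono mult_nonneg_nonneg) auto
    moreover have "M1 * (R + r' + 1) \<le> M1 * ((r' + 1) * (R + 1))"
      using M1 R0 r' by (intro mult_left_mono) (auto simp: algebra_simps)
    ultimately show ?thesis using R0 by (simp add: D_def algebra_simps)
  qed
  also have "D * (R + 1) \<le> D * (e * ratio / D * ?P)" using R1(2)[of R] R D by (intro mult_left_mono) auto
  also have "D * (e * ratio / D * ?P) = e * ratio * ?P" using D by simp
  finally have "(1 - e) * ratio * ?P \<le> ?Z' + e * ratio * ?P" by simp
  moreover have "(1 - 2 * e) * k * x = (1 - e) * k * x - e * k * x" for k x :: real by (simp add: algebra_simps)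
  note this[of ratio ?P]
  ultimately have Z': "(1 - 2 * e) * ratio * ?P \<le> ?Z'" by linarith
  have "(1 - 3 * e) * ?P' \<le> (1 - 3 * e) * ((1 + e) * ?P)"
    using R(2) e by (intro mult_left_mono) auto
  also have "\<dots> = ((1 - 3 * e) * (1 + e)) * ?P" by simp
  also have "\<dots> \<le> (1 - 2 * e) * ?P"
    using sp.time_nonneg e by (intro mult_right_mono) (auto simp: algebra_simps)
  finally have "ratio * ((1 - 3 * e) * ?P') \<le> ratio * ((1 - 2 * e) * ?P)"
    using ratio_pos by (intro mult_left_mono) auto
  moreover have "k * ((1 - 3 * e) * a) = (1 - 3 * e) * k * a" "k * ((1 - 2 * e) * a) = (1 - 2 * e) * k * a" for k a :: real
    by (simp_all add: algebra_simps)
  note this(1)[of ratio ?P'] this(2)[of ratio ?P]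
  ultimately have Z'': "(1 - 3 * e) * ratio * ?P' \<le> ?Z'" using Z' by linarith
  have "(1 - 3 * e) * ?P' \<le> 1 * ?P'" using sp.time_nonneg e by (intro mult_right_mono) auto
  moreover have "(1 - 3 * e) * (1 + k) * a = (1 - 3 * e) * a + (1 - 3 * e) * k * a" for k a :: real
    by (simp add: algebra_simps)
  note this[of ratio ?P']
  ultimately have "(1 - 3 * e) * (1 + ratio) * ?P' \<le> T (R + r')" using Z'' unfolding T_def by linarith
  then have "share * ((1 - 3 * e) * (1 + ratio) * ?P') \<le> share * T (R + r')"
    using share by (intro mult_left_mono) auto
  moreover have "share * ((1 - 3 * e) * (1 + ratio) * ?P') = (share * (1 + ratio)) * ((1 - 3 * e) * ?P')"
    by (simp only: mult_ac)
  ultimately have "(1 - 3 * e) * ?P' \<le> share * T (R + r')" unfolding share(3) by simp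
  moreover have "3 * e * ?P' \<le> \<epsilon> * T (R + r')"
    using e T_ge[of "R + r'"] sp.time_nonneg[of "R + r'"] by (intro mult_mono) auto
  ultimately have "?P' \<le> (share + \<epsilon>) * T (R + r')" by (simp add: algebra_simps)
  moreover have "B \<le> T (R + r')"
    using R2(2)[of R] R sp.time_mono[of R "R + r'"] r' T_ge(1)[of "R + r'"] by auto
  ultimately show ?thesis using R0 r' by (intro exI[of _ "R + r'"]) auto
qed

end

section \<open>Continued fractions\<close>

fun cf_num :: "(nat \<Rightarrow> int) \<Rightarrow> nat \<Rightarrow> int" where
  "cf_num a 0 = a 0"
| "cf_num a (Suc 0) = a 1 * a 0 + 1"
| "cf_num a (Suc (Suc n)) = a (Suc (Suc n)) * cf_num a (Suc n) + cf_num a n"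

fun cf_den :: "(nat \<Rightarrow> int) \<Rightarrow> nat \<Rightarrow> int" where
  "cf_den a 0 = 1"
| "cf_den a (Suc 0) = a 1"
| "cf_den a (Suc (Suc n)) = a (Suc (Suc n)) * cf_den a (Suc n) + cf_den a n"

text \<open>\<open>cfrac_value\<close> removes the first partial quotient, whereas the recursion for
  numerators and denominators adds the last one. This lemma and the next translate between the
  two.\<close>

lemma cf_num_shift: "cf_num a (Suc n) = a 0 * cf_num (\<lambda>k. a (Suc k)) n + cf_den (\<lambda>k. a (Suc k)) n"
  by (induction n rule: cf_num.induct[where ?P = "\<lambda>_ n. P n" for P]) (simp_all add: algebra_simps)

lemma cf_den_shift: "cf_den a (Suc n) = cf_num (\<lambda>k. a (Suc k)) n"
  by (induction n rule: cf_num.induct[where ?P = "\<lambda>_ n. P n" for P]) (simp_all add: algebra_simps)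

lemma cf_det: "cf_num a (Suc n) * cf_den a n - cf_num a n * cf_den a (Suc n) = (- 1) ^ n"
  by (induction n) (simp_all add: algebra_simps)

lemma coprime_cf: "coprime (cf_num a n) (cf_den a n)"
proof (cases n)
  case (Suc m)
  have "is_unit d" if "d dvd cf_num a n" "d dvd cf_den a n" for d
  proof -
    have "d dvd cf_num a (Suc m) * cf_den a m - cf_num a m * cf_den a (Suc m)"
      using that Suc by (intro dvd_diff) auto
    then have "d dvd (- 1) ^ m" unfolding cf_det .
    then show ?thesis by (cases "even m") auto
  qed
  then show ?thesis by (auto intro: coprimeI)
qed simp

lemma cf_den_pos:
  assumes "\<And>k. k \<ge> 1 \<Longrightarrow> 1 \<le> a k"
  shows "cf_den a n \<ge> 1"
proof (induction n rule: cf_num.induct[where ?P = "\<lambda>_ n. P n" for P])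
  case (3 a' n)
  have "1 * 1 \<le> a (Suc (Suc n)) * cf_den a (Suc n)"
    using 3 assms[of "Suc (Suc n)"] by (intro mult_mono) auto
  then show ?case using 3 by simp
qed (use assms in auto)

lemma cfrac_value_eq:
  assumes "\<And>k. k \<ge> 1 \<Longrightarrow> 1 \<le> a k"
  shows "cfrac_value (map a [0..<Suc n]) = of_int (cf_num a n) / of_int (cf_den a n)"
  using assms
proof (induction n arbitrary: a)
  case (Suc n)
  let ?b = "\<lambda>k. a (Suc k)"
  have b: "1 \<le> ?b k" for k using Suc.prems[of "Suc k"] by simp
  have "map a [0..<Suc (Suc n)] = a 0 # map ?b [0..<Suc n]" by (rule map_upt_Suc)
  moreover have "map ?b [0..<Suc n] = ?b 0 # map (\<lambda>k. ?b (Suc k)) [0..<n]" by (rule map_upt_Suc)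
  ultimately have "cfrac_value (map a [0..<Suc (Suc n)]) = of_int (a 0) + 1 / cfrac_value (map ?b [0..<Suc n])"
    by (simp only: cfrac_value.simps)
  also have "\<dots> = of_int (a 0) + 1 / (of_int (cf_num ?b n) / of_int (cf_den ?b n))"
    using Suc.IH[of ?b] b by simp
  also have "\<dots> = of_int (cf_num a (Suc n)) / of_int (cf_den a (Suc n))"
    using cf_den_pos[of a "Suc n"] Suc.prems unfolding cf_num_shift cf_den_shift by (simp add: field_simps)
  finally show ?case .
qed simp

lemma convergent_denom_eq:
  assumes "\<And>k. k \<ge> 1 \<Longrightarrow> 1 \<le> a k"
  shows "convergent_denom a n = cf_den a n"
  using cf_den_pos[of a n] assms coprime_cf[of a n]
  by (simp add: convergent_denom_def convergent_cfrac_def cfrac_value_eq[OF assms]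
      Fract_of_int_quotient[symmetric] quotient_of_Fract normalize_stable del: upt_Suc)

text \<open>Each convergent is a convex combination of the previous two, so the segments between
  neighbours are nested and all contain the limit. Their lengths follow from
  \<open>cf_det\<close>.\<close>

lemma cfrac_approximation:
  assumes "has_cfrac_expansion \<alpha> a"
  shows "\<bar>\<alpha> - of_int (cf_num a n) / of_int (cf_den a n)\<bar> \<le> 1 / (of_int (cf_den a n) * of_int (cf_den a (Suc n)))"
proof -
  have a: "\<And>k. k \<ge> 1 \<Longrightarrow> 1 \<le> a k" using assms by (auto simp: has_cfrac_expansion_def)
  define c where "c n = (of_int (cf_num a n) / of_int (cf_den a n) :: real)" for n
  have q: "(of_int (cf_den a n) :: real) \<ge> 1" for n using cf_den_pos[of a n] a by simp
  have q0: "(of_int (cf_den a n) :: real) > 0" for n using q[of n] by linarith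
  have lim: "c \<longlonglongrightarrow> \<alpha>"
    using assms cfrac_value_eq[OF a] by (simp add: has_cfrac_expansion_def convergent_cfrac_def c_def[abs_def] of_rat_divide del: upt_Suc)
  have step: "c (Suc (Suc n)) \<in> closed_segment (c n) (c (Suc n))" for n
  proof -
    let ?u = "(of_int (a (Suc (Suc n))) * of_int (cf_den a (Suc n)) / of_int (cf_den a (Suc (Suc n))) :: real)"
    have rec: "(of_int (cf_den a (Suc (Suc n))) :: real) = of_int (a (Suc (Suc n))) * of_int (cf_den a (Suc n)) + of_int (cf_den a n)" by simp
    have ge: "(of_int (a (Suc (Suc n))) :: real) \<ge> 1" using a[of "Suc (Suc n)"] by simp
    have u: "0 \<le> ?u" "?u \<le> 1"
      using q0[of "Suc (Suc n)"] q0[of "Suc n"] q0[of n] ge unfolding rec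
      by (auto simp del: cf_den.simps)
    have "1 - ?u = of_int (cf_den a n) / of_int (cf_den a (Suc (Suc n)))"
      using q0[of "Suc (Suc n)"] unfolding rec by (simp add: field_simps del: cf_den.simps)
    then have "(1 - ?u) * c n + ?u * c (Suc n) = c (Suc (Suc n))"
      using q0[of "Suc (Suc n)"] q0[of "Suc n"] q0[of n]
      by (simp add: c_def add_divide_distrib[symmetric] del: cf_den.simps)
    then show ?thesis using u by (force simp: closed_segment_def)
  qed
  have nested: "c (n + k) \<in> closed_segment (c n) (c (Suc n))" for n k
  proof (induction k arbitrary: n)
    case (Suc k)
    have "c (Suc n + k) \<in> closed_segment (c (Suc n)) (c (Suc (Suc n)))" by (rule Suc)
    moreover have "closed_segment (c (Suc n)) (c (Suc (Suc n))) \<subseteq> closed_segment (c n) (c (Suc n))"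
      using step[of n] by (simp add: subset_closed_segment)
    ultimately show ?case by auto
  qed simp
  have "closed (closed_segment (c n) (c (Suc n)))" by (rule closed_segment)
  then have "\<alpha> \<in> closed_segment (c n) (c (Suc n))"
    by (rule closed_sequentially) (use nested[of n] LIMSEQ_ignore_initial_segment[OF lim, of n] in \<open>auto simp: add.commute[of _ n]\<close>)
  then have "\<bar>\<alpha> - c n\<bar> \<le> \<bar>c (Suc n) - c n\<bar>"
    using dist_in_closed_segment[of \<alpha> "c n" "c (Suc n)"] by (simp add: dist_real_def abs_minus_commute)
  also have "c (Suc n) - c n = (-1) ^ n / (of_int (cf_den a n) * of_int (cf_den a (Suc n)))"
  proof -
    have "(of_int (cf_num a (Suc n) * cf_den a n - cf_num a n * cf_den a (Suc n)) :: real) = of_int ((- 1) ^ n)"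
      unfolding cf_det ..
    then show ?thesis using q0[of n] q0[of "Suc n"] by (simp add: c_def field_simps)
  qed
  also have "\<bar>(-1) ^ n / (of_int (cf_den a n) * of_int (cf_den a (Suc n)))\<bar> = (1 :: real) / (of_int (cf_den a n) * of_int (cf_den a (Suc n)))"
    using q0[of n] q0[of "Suc n"] by (simp add: abs_mult power_abs)
  finally show ?thesis by (simp add: c_def)
qed

lemma cf_den_mono:
  assumes "\<And>k. k \<ge> 1 \<Longrightarrow> 1 \<le> a k" "m \<le> n"
  shows "cf_den a m \<le> cf_den a n"
  using assms(2)
proof (rule lift_Suc_mono_le[of "cf_den a", rotated])
  fix n
  show "cf_den a n \<le> cf_den a (Suc n)"
  proof (cases n)
    case 0
    then show ?thesis using assms(1)[of 1] by simp
  next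
    case (Suc k)
    have "1 * cf_den a n \<le> a (Suc n) * cf_den a n"
      using cf_den_pos[of a n] assms(1) by (intro mult_right_mono) (auto intro: order_trans[of _ 1])
    moreover have "0 \<le> cf_den a k" using cf_den_pos[of a k] assms(1) by simp
    ultimately show ?thesis using Suc by simp
  qed
qed

lemma cf_den_doubling:
  assumes "\<And>k. k \<ge> 1 \<Longrightarrow> 1 \<le> a k" "2 \<le> a (Suc n)"
  shows "2 * cf_den a n \<le> cf_den a (Suc n)"
proof (cases n)
  case (Suc k)
  have "2 * cf_den a n \<le> a (Suc n) * cf_den a n"
    using cf_den_pos[of a n] assms by (intro mult_right_mono) (auto intro: order_trans[of _ 1])
  moreover have "0 \<le> cf_den a k" using cf_den_pos[of a k] assms(1) by simp
  ultimately show ?thesis using Suc by simp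
qed (use assms in simp)

text \<open>A partial quotient \<open>a (n + 1) \<ge> 2\<close> doubles the denominator. This
  supplies both the factor 1/2 in \<open>good_approx\<close> and the growth of the subsequence, as
  the next element of \<open>B\<close> is at least \<open>n + 1\<close>. The indices
  \<open>n \<ge> 2\<close> with \<open>a n \<ge> 2\<close> have denominator at least 3.\<close>

lemma approx_sequence_of_cfrac:
  assumes cf: "has_cfrac_expansion \<alpha> a" and B: "infinite B"
    "B \<subseteq> {n. 2 \<le> n \<and> 2 \<le> a n \<and> 2 \<le> a (n + 1)}"
  shows "approx_sequence \<alpha> (\<lambda>i. nat (convergent_denom a (enumerate B i)))"
proof -
  have a: "\<And>k. k \<ge> 1 \<Longrightarrow> 1 \<le> a k" using cf by (auto simp: has_cfrac_expansion_def)
  have d: "nat (convergent_denom a n) = nat (cf_den a n)" for n using convergent_denom_eq[OF a] by simp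
  have pos: "cf_den a n \<ge> 1" for n using cf_den_pos[of a] a by blast
  have r: "real (nat (cf_den a n)) = of_int (cf_den a n)" for n using pos[of n] by simp
  have mem: "enumerate B i \<in> B" for i using B(1) by (rule enumerate_in_set)
  show ?thesis
    unfolding d
  proof
    fix i
    define n where "n = enumerate B i"
    have n: "2 \<le> n" "2 \<le> a n" "2 \<le> a (Suc n)" using mem[of i] B(2) by (auto simp: n_def)
    have dbl: "2 * cf_den a n \<le> cf_den a (Suc n)" by (rule cf_den_doubling) (use a n in auto)
    show "good_approx \<alpha> (nat (cf_den a (enumerate B i)))"
      unfolding good_approx_def n_def[symmetric]
    proof (intro conjI exI)
      show "1 \<le> nat (cf_den a n)" using pos[of n] by simp
      show "coprime (cf_num a n) (int (nat (cf_den a n)))" using coprime_cf[of a n] pos[of n] by simp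
      have "\<bar>\<alpha> - of_int (cf_num a n) / of_int (cf_den a n)\<bar> \<le> 1 / (of_int (cf_den a n) * of_int (cf_den a (Suc n)))"
        by (rule cfrac_approximation[OF cf])
      also have "\<dots> \<le> 1 / (of_int (cf_den a n) * (2 * of_int (cf_den a n)))"
      proof -
        have "(2 * of_int (cf_den a n) :: real) \<le> of_int (cf_den a (Suc n))"
          using dbl by (metis of_int_le_iff of_int_mult of_int_numeral)
        moreover have "(of_int (cf_den a n) :: real) \<ge> 1" using pos[of n] by simp
        ultimately show ?thesis by (intro divide_left_mono mult_left_mono mult_pos_pos) auto
      qed
      finally show "\<bar>\<alpha> - of_int (cf_num a n) / real (nat (cf_den a n))\<bar> \<le> 1 / (2 * (real (nat (cf_den a n)))\<^sup>2)"
        unfolding r by (simp add: power2_eq_square mult_ac)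
    qed
    obtain k where k: "n = Suc (Suc k)" using n(1) by (metis Suc_le_D numeral_2_eq_2 Suc_le_mono)
    have "2 * 1 \<le> a n * cf_den a (Suc k)" using n pos[of "Suc k"] by (intro mult_mono) auto
    then have "cf_den a n \<ge> 3" unfolding k using pos[of k] k by simp
    then show "3 \<le> nat (cf_den a (enumerate B i))" by (simp add: n_def)
    have "Suc n \<le> enumerate B (Suc i)" unfolding n_def using enumerate_step[OF B(1), of i] by simp
    then have "cf_den a (Suc n) \<le> cf_den a (enumerate B (Suc i))" by (intro cf_den_mono) (use a in auto)
    with dbl have "2 * cf_den a n \<le> cf_den a (enumerate B (Suc i))" by linarith
    then show "2 * nat (cf_den a (enumerate B i)) \<le> nat (cf_den a (enumerate B (Suc i)))"
      unfolding n_def[symmetric] using pos[of n] by linarith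
  qed
qed

lemma not_summable_enumerate:
  fixes f :: "nat \<Rightarrow> real"
  assumes "infinite B" "\<not> f summable_on B" "\<And>n. n \<in> B \<Longrightarrow> 0 \<le> f n"
  shows "\<not> summable (\<lambda>i. f (enumerate B i))"
proof
  assume s: "summable (\<lambda>i. f (enumerate B i))"
  have mem: "enumerate B i \<in> B" for i using assms(1) by (rule enumerate_in_set)
  have "(\<lambda>i. f (enumerate B i)) summable_on UNIV"
    using s assms(3) mem by (subst summable_on_UNIV_nonneg_real_iff) auto
  then have "(f \<circ> enumerate B) summable_on UNIV" by (simp add: o_def)
  then have "f summable_on (enumerate B ` UNIV)"
    using bij_enumerate[OF assms(1)] by (subst summable_on_reindex) (auto simp: bij_betw_def)
  then show False using assms(2) bij_enumerate[OF assms(1)] by (simp add: bij_betw_def)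
qed

text \<open>A finite real sum would be carried by the continuous map \<open>ennreal\<close> to a
  finite value of the extended sum.\<close>

lemma not_summable_on_of_infsum_ennreal:
  fixes f :: "'a \<Rightarrow> real"
  assumes "(\<Sum>\<^sub>\<infinity>n\<in>A. ennreal (f n)) = \<infinity>" "\<And>n. n \<in> A \<Longrightarrow> 0 \<le> f n"
  shows "\<not> f summable_on A"
proof
  assume "f summable_on A"
  then obtain s where s: "(f has_sum s) A" by (auto simp: summable_on_def)
  have "((\<lambda>n. ennreal (f n)) has_sum ennreal s) A"
    unfolding has_sum_def
  proof (rule Lim_transform_eventually)
    show "((\<lambda>F. ennreal (sum f F)) \<longlongrightarrow> ennreal s) (finite_subsets_at_top A)"
      using s unfolding has_sum_def by (rule tendsto_ennrealI)
    show "\<forall>\<^sub>F F in finite_subsets_at_top A. ennreal (sum f F) = (\<Sum>n\<in>F. ennreal (f n))"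
      by (rule eventually_finite_subsets_at_top_weakI) (use assms(2) in \<open>auto simp: sum_ennreal subset_eq\<close>)
  qed
  then have "(\<Sum>\<^sub>\<infinity>n\<in>A. ennreal (f n)) = ennreal s" by (rule infsumI)
  with assms(1) show False by simp
qed

section \<open>The torus and empirical measures\<close>

lemma to_torus_add: "to_torus (u + v) = to_torus u + to_torus v"
  by (simp add: plus_torus.abs_eq)

lemma to_torus_eq_iff: "to_torus u = to_torus v \<longleftrightarrow> (\<forall>i. u $ i - v $ i \<in> \<int>)"
  by (simp add: torus.abs_eq_iff lattice_equiv_def)

lemma to_torus_rep [simp]: "to_torus (torus_rep x) = x"
  by (rule Quotient3_abs_rep[OF Quotient3_torus])

lemma continuous_to_torus: "continuous_on S to_torus"
proof -
  have "open (to_torus -` B)" if "open B" for B using that by (simp add: open_torus_def)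
  then have "continuous_on UNIV to_torus" by (simp add: continuous_on_open_vimage)
  then show ?thesis by (rule continuous_on_subset) simp
qed

lemma continuous_on_torus_iff:
  fixes f :: "torus \<Rightarrow> 'b::topological_space"
  shows "continuous_on UNIV f \<longleftrightarrow> continuous_on UNIV (\<lambda>v. f (to_torus v))"
proof
  assume "continuous_on UNIV f"
  then show "continuous_on UNIV (\<lambda>v. f (to_torus v))"
    by (rule continuous_on_compose2[OF _ continuous_to_torus]) simp
next
  assume *: "continuous_on UNIV (\<lambda>v. f (to_torus v))"
  have "open (f -` B)" if "open B" for B
  proof -
    have "open ((\<lambda>v. f (to_torus v)) -` B)" using * that by (simp add: continuous_on_open_vimage)
    moreover have "(\<lambda>v. f (to_torus v)) -` B = to_torus -` (f -` B)" by auto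
    ultimately show ?thesis by (simp add: open_torus_def)
  qed
  then show "continuous_on UNIV f" by (simp add: continuous_on_open_vimage)
qed

definition frac_vec :: "real^2 \<Rightarrow> real^2" where "frac_vec v = (\<chi> i. frac (v $ i))"

lemma to_torus_frac_vec [simp]: "to_torus (frac_vec v) = to_torus v"
  by (simp add: to_torus_eq_iff frac_vec_def frac_def)

lemma compact_torus: "compact (UNIV :: torus set)"
proof -
  have "compact (cbox 0 1 :: (real^2) set)" by (rule compact_cbox)
  then have "compact (to_torus ` cbox 0 1)" by (rule compact_continuous_image[OF continuous_to_torus])
  moreover have "to_torus ` cbox 0 1 = UNIV"
  proof -
    have "x \<in> to_torus ` cbox 0 1" for x
    proof
      show "x = to_torus (frac_vec (torus_rep x))" by simp
      show "frac_vec (torus_rep x) \<in> cbox 0 1"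
        by (simp add: mem_box_cart frac_vec_def frac_lt_1 less_imp_le)
    qed
    then show ?thesis by blast
  qed
  ultimately show ?thesis by simp
qed

text \<open>On the compact set where \<open>g\<close> is not small, \<open>\<phi>\<close> has a
  positive minimum. Thus a function that vanishes where \<open>\<phi>\<close> does has time averages
  tending to 0 as soon as those of \<open>\<phi>\<close> do.\<close>

lemma dominated_by_zero_function:
  fixes \<phi> g :: "torus \<Rightarrow> real"
  assumes \<phi>: "continuous_on UNIV \<phi>" "\<And>x. 0 \<le> \<phi> x" and g: "continuous_on UNIV g"
    and zero: "\<And>x. \<phi> x = 0 \<Longrightarrow> g x = 0" and \<eta>: "\<eta> > 0"
  obtains K where "K \<ge> 0" "\<And>x. \<bar>g x\<bar> \<le> \<eta> + K * \<phi> x"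
proof -
  define S where "S = {x. \<eta> \<le> \<bar>g x\<bar>}"
  have "closed S" unfolding S_def using g by (intro closed_Collect_le continuous_intros)
  then have S: "compact S" using compact_Int_closed[OF compact_torus] by simp
  show thesis
  proof (cases "S = {}")
    case True
    then show thesis using \<phi>(2) that[of 0] by (auto simp: S_def not_le less_imp_le)
  next
    case False
    obtain a where a: "a \<in> S" "\<And>x. x \<in> S \<Longrightarrow> \<phi> a \<le> \<phi> x"
      using continuous_attains_inf[OF S False continuous_on_subset[OF \<phi>(1)]] by auto
    have "continuous_on S (\<lambda>x. \<bar>g x\<bar>)" using continuous_on_subset[OF g] by (intro continuous_intros) auto
    then obtain b where b: "b \<in> S" "\<And>x. x \<in> S \<Longrightarrow> \<bar>g x\<bar> \<le> \<bar>g b\<bar>"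
      using continuous_attains_sup[OF S False] by blast
    have "\<phi> a \<noteq> 0" using a(1) zero[of a] \<eta> by (auto simp: S_def)
    then have pos: "\<phi> a > 0" using \<phi>(2)[of a] by linarith
    show thesis
    proof (rule that[of "\<bar>g b\<bar> / \<phi> a"])
      show "0 \<le> \<bar>g b\<bar> / \<phi> a" using pos by simp
      fix x
      show "\<bar>g x\<bar> \<le> \<eta> + \<bar>g b\<bar> / \<phi> a * \<phi> x"
      proof (cases "x \<in> S")
        case True
        have "\<bar>g x\<bar> \<le> \<bar>g b\<bar> / \<phi> a * \<phi> a" using b(2)[OF True] pos by simp
        also have "\<dots> \<le> \<bar>g b\<bar> / \<phi> a * \<phi> x" using a(2)[OF True] pos by (intro mult_left_mono) auto
        finally show ?thesis using \<eta> by linarith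
      next
        case False
        have "0 \<le> \<bar>g b\<bar> / \<phi> a * \<phi> x" using pos \<phi>(2) by (intro mult_nonneg_nonneg) auto
        then show ?thesis using False by (simp add: S_def)
      qed
    qed
  qed
qed

definition time_average :: "(real \<Rightarrow> torus \<Rightarrow> torus) \<Rightarrow> torus \<Rightarrow> (torus \<Rightarrow> real) \<Rightarrow> real \<Rightarrow> real" where
  "time_average \<Phi> x f t = 1 / t * integral {0..t} (\<lambda>s. f (\<Phi> s x))"

text \<open>The image under the orbit of the normalised Lebesgue measure on \<open>{0..t}\<close>.
  Existence has to be shown since \<open>is_empirical_measure\<close> is only a predicate.\<close>

lemma empirical_measure_exists:
  assumes cont: "continuous_on UNIV (\<lambda>s. \<Phi> s x)" and t: "t > 0"
  shows "\<exists>\<mu>. is_empirical_measure \<Phi> x t \<mu>"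
proof -
  define M where "M = density lborel (\<lambda>s. ennreal (indicator {0..t} s / t))"
  have meas: "(\<lambda>s. \<Phi> s x) \<in> borel_measurable borel" using cont by (rule borel_measurable_continuous_onI)
  then have meas': "(\<lambda>s. \<Phi> s x) \<in> measurable M borel" by (simp add: M_def)
  have "emeasure M (space M) = 1"
  proof -
    have "emeasure M (space M) = (\<integral>\<^sup>+s. ennreal (1 / t) * indicator {0..t} s \<partial>lborel)"
      unfolding M_def by (subst emeasure_density) (auto intro!: nn_integral_cong split: split_indicator)
    also have "\<dots> = ennreal (1 / t) * ennreal t"
      using t by (subst nn_integral_cmult_indicator) auto
    also have "\<dots> = 1" using t by (simp add: ennreal_mult[symmetric])
    finally show ?thesis .
  qed
  then have "prob_space M" by (rule prob_spaceI)
  then have prob: "prob_space (distr M borel (\<lambda>s. \<Phi> s x))" by (rule prob_space.prob_space_distr[OF _ meas'])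
  have "(\<integral>y. f y \<partial>distr M borel (\<lambda>s. \<Phi> s x)) = 1 / t * integral {0..t} (\<lambda>s. f (\<Phi> s x))"
    if f: "continuous_on UNIV f" for f :: "torus \<Rightarrow> real"
  proof -
    have f_meas: "f \<in> borel_measurable borel" using f by (rule borel_measurable_continuous_onI)
    have fc: "continuous_on UNIV (\<lambda>s. f (\<Phi> s x))" by (rule continuous_on_compose2[OF f cont]) simp
    then have fc_meas: "(\<lambda>s. f (\<Phi> s x)) \<in> borel_measurable borel" by (rule borel_measurable_continuous_onI)
    have "(\<integral>y. f y \<partial>distr M borel (\<lambda>s. \<Phi> s x)) = (\<integral>s. f (\<Phi> s x) \<partial>M)"
      by (rule integral_distr[OF meas' f_meas])
    also have "\<dots> = (\<integral>s. (indicator {0..t} s / t) *\<^sub>R f (\<Phi> s x) \<partial>lborel)"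
      unfolding M_def using t fc_meas by (intro integral_density) auto
    also have "\<dots> = (\<integral>s. 1 / t * (indicator {0..t} s *\<^sub>R f (\<Phi> s x)) \<partial>lborel)"
      by (simp add: field_simps)
    also have "\<dots> = 1 / t * (\<integral>s. indicator {0..t} s *\<^sub>R f (\<Phi> s x) \<partial>lborel)"
      by (rule integral_mult_right_zero)
    also have "(\<integral>s. indicator {0..t} s *\<^sub>R f (\<Phi> s x) \<partial>lborel) = integral {0..t} (\<lambda>s. f (\<Phi> s x))"
      using set_borel_integral_eq_integral(2)[OF borel_integrable_atLeastAtMost'[OF continuous_on_subset[OF fc]], of 0 t]
      by (simp add: set_lebesgue_integral_def)
    finally show ?thesis .
  qed
  then show ?thesis using prob unfolding is_empirical_measure_def borel_probabilities_def
    by (intro exI[of _ "distr M borel (\<lambda>s. \<Phi> s x)"]) auto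
qed

lemma continuous_map_weak_star:
  assumes "continuous_on UNIV f"
  shows "continuous_map weak_star_topology euclideanreal (\<lambda>\<mu>. \<integral>x. f x \<partial>\<mu>)"
proof -
  let ?C = "{f :: torus \<Rightarrow> real. continuous_on UNIV f}"
  have "continuous_map (product_topology (\<lambda>f. euclideanreal) ?C) euclideanreal (\<lambda>g. g f)"
    using assms by (intro continuous_map_product_projection) simp
  then have "continuous_map weak_star_topology euclideanreal ((\<lambda>g. g f) \<circ> (\<lambda>\<mu>. \<lambda>f\<in>?C. \<integral>x. f x \<partial>\<mu>))"
    unfolding weak_star_topology_def Let_def by (rule continuous_map_pullback)
  moreover have "(\<lambda>g. g f) \<circ> (\<lambda>\<mu>. \<lambda>f\<in>?C. \<integral>x. f x \<partial>\<mu>) = (\<lambda>\<mu>. \<integral>x. f x \<partial>\<mu>)"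
    using assms by auto
  ultimately show ?thesis by simp
qed

text \<open>A basic neighbourhood restricts only finitely many integrals, so convergence of each
  integral along one sequence is enough.\<close>

lemma in_weak_star_closureI:
  assumes \<mu>: "\<mu> \<in> borel_probabilities"
    and S: "\<And>n::nat. \<nu> n \<in> S" "\<And>n. \<nu> n \<in> borel_probabilities"
    and lim: "\<And>f::torus \<Rightarrow> real. continuous_on UNIV f \<Longrightarrow> (\<lambda>n. \<integral>x. f x \<partial>\<nu> n) \<longlonglongrightarrow> (\<integral>x. f x \<partial>\<mu>)"
  shows "\<mu> \<in> weak_star_topology closure_of S"
proof -
  let ?C = "{f :: torus \<Rightarrow> real. continuous_on UNIV f}"
  let ?F = "\<lambda>\<mu>. \<lambda>f\<in>?C. \<integral>x. f x \<partial>\<mu>"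
  have top: "topspace weak_star_topology = borel_probabilities"
    unfolding weak_star_topology_def Let_def topspace_pullback_topology by auto
  show ?thesis
    unfolding in_closure_of top
  proof (intro conjI allI impI \<mu>)
    fix W assume W: "\<mu> \<in> W \<and> openin weak_star_topology W"
    then obtain U where U: "openin (product_topology (\<lambda>f. euclideanreal) ?C) U" "W = ?F -` U \<inter> borel_probabilities"
      unfolding weak_star_topology_def Let_def openin_pullback_topology by blast
    have "?F \<mu> \<in> U" using W U by blast
    then obtain X where X: "finite {f \<in> ?C. X f \<noteq> topspace euclideanreal}" "\<And>f. f \<in> ?C \<Longrightarrow> openin euclideanreal (X f)"
      "?F \<mu> \<in> Pi\<^sub>E ?C X" "Pi\<^sub>E ?C X \<subseteq> U"
      using U(1) unfolding openin_product_topology_alt by meson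
    have "\<forall>f\<in>{f \<in> ?C. X f \<noteq> topspace euclideanreal}. \<forall>\<^sub>F n in sequentially. (\<integral>x. f x \<partial>\<nu> n) \<in> X f"
    proof
      fix f assume f: "f \<in> {f \<in> ?C. X f \<noteq> topspace euclideanreal}"
      have "open (X f)" using X(2)[of f] f by simp
      moreover have "(\<integral>x. f x \<partial>\<mu>) \<in> X f" using X(3) f by (auto simp: PiE_iff)
      ultimately show "\<forall>\<^sub>F n in sequentially. (\<integral>x. f x \<partial>\<nu> n) \<in> X f"
        using lim[of f] f by (auto intro: topological_tendstoD)
    qed
    then have "\<forall>\<^sub>F n in sequentially. \<forall>f\<in>{f \<in> ?C. X f \<noteq> topspace euclideanreal}. (\<integral>x. f x \<partial>\<nu> n) \<in> X f"
      by (rule eventually_ball_finite[OF X(1)])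
    then obtain n where n: "\<forall>f\<in>{f \<in> ?C. X f \<noteq> topspace euclideanreal}. (\<integral>x. f x \<partial>\<nu> n) \<in> X f"
      unfolding eventually_sequentially by blast
    have "?F (\<nu> n) \<in> Pi\<^sub>E ?C X" using n by (auto simp: PiE_iff)
    then have "\<nu> n \<in> W" using X(4) S(2) U(2) by blast
    then show "\<exists>y. y \<in> S \<and> y \<in> W" using S(1) by blast
  qed
qed

section \<open>Limit measures carried by the two zeros\<close>

locale two_zeros =
  fixes \<phi> h :: "torus \<Rightarrow> real" and p q :: torus
  assumes \<phi>_cont: "continuous_on UNIV \<phi>" and \<phi>_nonneg: "0 \<le> \<phi> x" and \<phi>_zero: "\<phi> x = 0 \<longleftrightarrow> x = p \<or> x = q"
    and h_cont: "continuous_on UNIV h" and h_p: "h p = 1" and h_q: "h q = 0"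
begin

lemma p_neq_q: "p \<noteq> q" using h_p h_q by auto

lemma \<phi>_meas [measurable]: "\<phi> \<in> borel_measurable borel"
  by (rule borel_measurable_continuous_onI[OF \<phi>_cont])

lemma h_meas [measurable]: "h \<in> borel_measurable borel"
  by (rule borel_measurable_continuous_onI[OF h_cont])

text \<open>The points are cut out by the continuous functions \<open>\<phi>\<close> and
  \<open>h\<close>, which avoids proving a separation axiom for the quotient topology.\<close>

lemma sets_p [measurable, simp]: "{p} \<in> sets borel" and sets_q [measurable, simp]: "{q} \<in> sets borel"
proof -
  have eq: "{p} = {x\<in>space borel. \<phi> x = 0 \<and> h x = 1}" "{q} = {x\<in>space borel. \<phi> x = 0 \<and> h x = 0}"
    using \<phi>_zero h_p h_q by auto
  show "{p} \<in> sets borel" "{q} \<in> sets borel" unfolding eq by measurable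
qed

definition mix :: "real \<Rightarrow> torus measure" where
  "mix s = lincomb_measure s (dirac p) (1 - s) (dirac q)"

lemma sets_mix [simp, measurable_cong]: "sets (mix s) = sets borel"
  unfolding mix_def lincomb_measure_def by (metis sets.sigma_sets_eq sets_measure_of space_borel sets.space_closed)

lemma space_mix [simp]: "space (mix s) = UNIV"
  using sets_eq_imp_space_eq[OF sets_mix] by simp

lemma emeasure_mix:
  assumes "A \<in> sets borel"
  shows "emeasure (mix s) A = ennreal s * indicator A p + ennreal (1 - s) * indicator A q"
  unfolding mix_def using assms by (subst emeasure_lincomb_measure) (auto simp: dirac_def)

lemma mix_prob:
  assumes "0 \<le> s" "s \<le> 1"
  shows "mix s \<in> borel_probabilities"
proof -
  have "emeasure (mix s) (space (mix s)) = 1"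
    using assms by (simp add: emeasure_mix ennreal_plus[symmetric] del: ennreal_plus)
  then show ?thesis unfolding borel_probabilities_def by (auto intro: prob_spaceI)
qed

lemma integral_concentrated:
  fixes f :: "torus \<Rightarrow> real"
  assumes "finite_measure M" "sets M = sets borel" "AE x in M. x = p \<or> x = q" "f \<in> borel_measurable borel"
  shows "(\<integral>x. f x \<partial>M) = f p * measure M {p} + f q * measure M {q}"
proof -
  interpret finite_measure M by (rule assms(1))
  have [measurable_cong]: "sets M = sets borel" by (rule assms(2))
  have "(\<integral>x. f x \<partial>M) = (\<integral>x. f p * indicator {p} x + f q * indicator {q} x \<partial>M)"
    using assms(3,4) p_neq_q by (intro integral_cong_AE) (auto elim!: eventually_mono)
  also have "\<dots> = (\<integral>x. f p * indicator {p} x \<partial>M) + (\<integral>x. f q * indicator {q} x \<partial>M)"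
    using assms(2) by (intro Bochner_Integration.integral_add integrable_mult_right integrable_real_indicator)
      (auto simp: less_top[symmetric])
  also have "\<dots> = f p * measure M {p} + f q * measure M {q}"
    using assms(2) sets_eq_imp_space_eq[OF assms(2)] by simp
  finally show ?thesis .
qed

lemma integral_mix:
  fixes f :: "torus \<Rightarrow> real"
  assumes "0 \<le> s" "s \<le> 1" "f \<in> borel_measurable borel"
  shows "(\<integral>x. f x \<partial>mix s) = s * f p + (1 - s) * f q"
proof -
  have "prob_space (mix s)" using mix_prob[OF assms(1,2)] by (simp add: borel_probabilities_def)
  then interpret prob_space "mix s" .
  have "- {p, q} = {x\<in>space borel. \<not> (x = p \<or> x = q)}" by auto
  have cs: "{x. x \<noteq> p \<and> x \<noteq> q} \<in> sets borel"
  proof -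
    have "UNIV - ({p} \<union> {q}) \<in> sets (borel :: torus measure)" by (intro sets.Diff sets.Un) auto
    moreover have "UNIV - ({p} \<union> {q}) = {x. x \<noteq> p \<and> x \<noteq> q}" by auto
    ultimately show ?thesis by simp
  qed
  have "emeasure (mix s) {x. x \<noteq> p \<and> x \<noteq> q} = 0" using cs by (simp add: emeasure_mix)
  then have "AE x in mix s. x = p \<or> x = q"
    using cs by (intro AE_I[of _ _ "{x. x \<noteq> p \<and> x \<noteq> q}"]) auto
  moreover have "measure (mix s) {p} = s" "measure (mix s) {q} = 1 - s"
    using assms p_neq_q by (simp_all add: measure_def emeasure_mix)
  ultimately show ?thesis
    using integral_concentrated[OF finite_measure_axioms sets_mix _ assms(3)] by simp
qed

lemma mix_inject:
  assumes "0 \<le> s" "s \<le> 1" "0 \<le> t" "t \<le> 1" "mix s = mix t" shows "s = t"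
proof -
  have "(\<integral>x. h x \<partial>mix s) = s" "(\<integral>x. h x \<partial>mix t) = t"
    using integral_mix[OF assms(1,2) h_meas] integral_mix[OF assms(3,4) h_meas] h_p h_q by simp_all
  then show ?thesis unfolding assms(5) by (rule trans[OF sym])
qed

text \<open>A nonnegative function with integral 0 vanishes almost everywhere, so the measure lives
  on \<open>p\<close> and \<open>q\<close>. Since \<open>h\<close> is 1 at \<open>p\<close> and 0 at
  \<open>q\<close>, its integral is the weight of \<open>p\<close>.\<close>

lemma eq_mix:
  assumes \<mu>: "\<mu> \<in> borel_probabilities" and zero: "(\<integral>x. \<phi> x \<partial>\<mu>) = 0"
  shows "\<mu> = mix (\<integral>x. h x \<partial>\<mu>) \<and> 0 \<le> (\<integral>x. h x \<partial>\<mu>) \<and> (\<integral>x. h x \<partial>\<mu>) \<le> 1"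
proof -
  have s: "sets \<mu> = sets borel" and "prob_space \<mu>" using \<mu> by (auto simp: borel_probabilities_def)
  then interpret prob_space \<mu> by simp
  have [measurable_cong]: "sets \<mu> = sets borel" by (rule s)
  have sp: "space \<mu> = UNIV" using sets_eq_imp_space_eq[OF s] by simp
  have "bounded (range \<phi>)"
    using compact_imp_bounded[OF compact_continuous_image[OF \<phi>_cont compact_torus]] .
  then obtain B where B: "\<And>x. norm (\<phi> x) \<le> B" unfolding bounded_iff by blast
  have "integrable \<mu> \<phi>" by (rule integrable_const_bound[of _ B]) (use B in auto)
  then have "AE x in \<mu>. \<phi> x = 0"
    using integral_nonneg_eq_0_iff_AE[of \<mu> \<phi>] zero \<phi>_nonneg by simp
  then have ae: "AE x in \<mu>. x = p \<or> x = q" by (simp add: \<phi>_zero)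
  have i: "(\<integral>x. h x \<partial>\<mu>) = measure \<mu> {p}"
    using integral_concentrated[OF finite_measure_axioms s ae h_meas] h_p h_q by simp
  have one: "measure \<mu> {p} + measure \<mu> {q} = 1"
    using integral_concentrated[OF finite_measure_axioms s ae, of "\<lambda>_. 1"] prob_space by simp
  have "\<mu> = mix (measure \<mu> {p})"
  proof (rule measure_eqI)
    show "sets \<mu> = sets (mix (measure \<mu> {p}))" by (simp add: s)
    fix A assume A: "A \<in> sets \<mu>"
    then have A': "A \<in> sets borel" by (simp add: s)
    have "measure \<mu> A = (\<integral>x. indicator A x \<partial>\<mu>)" using A by simp
    also have "\<dots> = indicator A p * measure \<mu> {p} + indicator A q * measure \<mu> {q}"
      using A' by (intro integral_concentrated[OF finite_measure_axioms s ae]) auto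
    finally have "emeasure \<mu> A = ennreal (indicator A p * measure \<mu> {p} + indicator A q * measure \<mu> {q})"
      by (simp add: emeasure_eq_measure)
    also have "\<dots> = emeasure (mix (measure \<mu> {p})) A"
    proof -
      have "measure \<mu> {q} = 1 - measure \<mu> {p}" using one by simp
      then show ?thesis using A' by (auto simp: emeasure_mix indicator_def ennreal_plus[symmetric] simp del: ennreal_plus)
    qed
    finally show "emeasure \<mu> A = emeasure (mix (measure \<mu> {p})) A" .
  qed
  then show ?thesis using i by simp
qed

context
  fixes \<Phi> :: "real \<Rightarrow> torus \<Rightarrow> torus" and x :: torus
  assumes orbit_cont: "continuous_on UNIV (\<lambda>s. \<Phi> s x)"
    and slow: "(time_average \<Phi> x \<phi> \<longlongrightarrow> 0) at_top"
begin

lemma integral_empirical: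
  "is_empirical_measure \<Phi> x t \<mu> \<Longrightarrow> continuous_on UNIV f \<Longrightarrow> (\<integral>y. f y \<partial>\<mu>) = time_average \<Phi> x f t"
  by (simp add: is_empirical_measure_def time_average_def)

lemma integrable_along_orbit:
  "continuous_on UNIV f \<Longrightarrow> (\<lambda>s. f (\<Phi> s x)) integrable_on {0..t}" for f :: "torus \<Rightarrow> real"
  by (rule integrable_continuous_real, rule continuous_on_compose2[OF _ continuous_on_subset[OF orbit_cont]]) auto

text \<open>Along a sequence of times for which the averages of \<open>h\<close> converge, the
  averages of every continuous function converge as well, because the orbit spends almost all of its
  time near the zeros of \<open>\<phi>\<close>.\<close>

lemma in_p_omega:
  assumes s: "0 \<le> s" "s \<le> 1" and freq: "\<And>\<epsilon> B. \<epsilon> > 0 \<Longrightarrow> \<exists>t\<ge>B. \<bar>time_average \<Phi> x h t - s\<bar> < \<epsilon>"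
  shows "mix s \<in> p_omega \<Phi> x"
proof -
  have "\<forall>n. \<exists>t\<ge>real n + 1. \<bar>time_average \<Phi> x h t - s\<bar> < inverse (real (Suc n))"
    by (intro allI freq) simp
  then obtain t where t: "\<And>n. t n \<ge> real n + 1" "\<And>n. \<bar>time_average \<Phi> x h (t n) - s\<bar> < inverse (real (Suc n))"
    by metis
  have t_top: "filterlim t at_top sequentially"
    by (rule filterlim_at_top_mono[OF filterlim_real_sequentially], rule always_eventually)
       (metis t(1) add_increasing2 order_trans order_refl zero_le_one)
  have t0: "t n > 0" for n using t(1)[of n] by linarith
  have h_lim: "(\<lambda>n. time_average \<Phi> x h (t n)) \<longlonglongrightarrow> s"
  proof (rule LIM_zero_cancel, rule Lim_null_comparison[OF _ LIMSEQ_inverse_real_of_nat])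
    show "\<forall>\<^sub>F n in sequentially. norm (time_average \<Phi> x h (t n) - s) \<le> inverse (real (Suc n))"
      using t(2) by (intro always_eventually) (auto simp: less_imp_le)
  qed
  have \<phi>_lim: "(\<lambda>n. time_average \<Phi> x \<phi> (t n)) \<longlonglongrightarrow> 0"
    by (rule filterlim_compose[OF slow t_top])
  have f_lim: "(\<lambda>n. time_average \<Phi> x f (t n)) \<longlonglongrightarrow> s * f p + (1 - s) * f q"
    if f: "continuous_on UNIV f" for f :: "torus \<Rightarrow> real"
  proof -
    \<comment> \<open>Subtracting the combination of 1 and \<open>h\<close> that agrees with
      \<open>f\<close> at both zeros leaves a function to which
      \<open>dominated_by_zero_function\<close> applies.\<close>
    define g where "g y = f y - f q - (f p - f q) * h y" for y
    have g_cont: "continuous_on UNIV g" unfolding g_def by (intro continuous_intros f h_cont)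
    have g_zero: "g y = 0" if "\<phi> y = 0" for y using that h_p h_q by (auto simp: \<phi>_zero g_def)
    have avg: "time_average \<Phi> x f (t n) = f q + (f p - f q) * time_average \<Phi> x h (t n) + time_average \<Phi> x g (t n)" for n
    proof -
      note i = integrable_integral[OF integrable_along_orbit]
      have "((\<lambda>s. f q + (f p - f q) * h (\<Phi> s x) + g (\<Phi> s x)) has_integral
          (t n - 0) * f q + (f p - f q) * integral {0..t n} (\<lambda>s. h (\<Phi> s x)) + integral {0..t n} (\<lambda>s. g (\<Phi> s x))) {0..t n}"
        using has_integral_const_real[of "f q" 0 "t n"] t0[of n]
        by (intro has_integral_add has_integral_mult_right i h_cont g_cont) auto
      then have "integral {0..t n} (\<lambda>s. f (\<Phi> s x)) =
          (t n - 0) * f q + (f p - f q) * integral {0..t n} (\<lambda>s. h (\<Phi> s x)) + integral {0..t n} (\<lambda>s. g (\<Phi> s x))"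
        by (simp add: g_def integral_unique)
      then show ?thesis using t0[of n] by (simp add: time_average_def field_simps)
    qed
    have "(\<lambda>n. time_average \<Phi> x g (t n)) \<longlonglongrightarrow> 0"
    proof (rule tendstoI)
      fix e :: real assume e: "e > 0"
      obtain K where K: "K \<ge> 0" "\<And>y. \<bar>g y\<bar> \<le> e / 2 + K * \<phi> y"
        using dominated_by_zero_function[OF \<phi>_cont \<phi>_nonneg g_cont g_zero, of "e / 2"] e by auto
      have "\<bar>time_average \<Phi> x g (t n)\<bar> \<le> e / 2 + K * time_average \<Phi> x \<phi> (t n)" for n
      proof -
        have "((\<lambda>s. e / 2 + K * \<phi> (\<Phi> s x)) has_integral (t n - 0) * (e / 2) + K * integral {0..t n} (\<lambda>s. \<phi> (\<Phi> s x))) {0..t n}"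
          using has_integral_const_real[of "e / 2" 0 "t n"] t0[of n]
          by (intro has_integral_add has_integral_mult_right integrable_integral integrable_along_orbit \<phi>_cont) auto
        then have "norm (integral {0..t n} (\<lambda>s. g (\<Phi> s x))) \<le> (t n - 0) * (e / 2) + K * integral {0..t n} (\<lambda>s. \<phi> (\<Phi> s x))"
          using K(2) integral_norm_bound_integral[OF integrable_along_orbit[OF g_cont], of "\<lambda>s. e / 2 + K * \<phi> (\<Phi> s x)" "t n"]
          by (auto simp: integral_unique has_integral_integrable)
        then show ?thesis using t0[of n] by (simp add: time_average_def abs_mult field_simps)
      qed
      moreover have "(\<lambda>n. e / 2 + K * time_average \<Phi> x \<phi> (t n)) \<longlonglongrightarrow> e / 2 + K * 0"
        by (intro tendsto_intros \<phi>_lim)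
      then have "\<forall>\<^sub>F n in sequentially. e / 2 + K * time_average \<Phi> x \<phi> (t n) < e"
        using e by (auto dest: order_tendstoD(2)[where a = e])
      ultimately show "\<forall>\<^sub>F n in sequentially. dist (time_average \<Phi> x g (t n)) 0 < e"
        by (auto elim!: eventually_mono simp: dist_real_def intro: order_le_less_trans)
    qed
    then have "(\<lambda>n. f q + (f p - f q) * time_average \<Phi> x h (t n) + time_average \<Phi> x g (t n)) \<longlonglongrightarrow> f q + (f p - f q) * s + 0"
      by (intro tendsto_intros h_lim)
    moreover have "f q + (f p - f q) * s + 0 = s * f p + (1 - s) * f q" by (simp add: algebra_simps)
    ultimately show ?thesis unfolding avg by simp
  qed
  show ?thesis
    unfolding p_omega_def
  proof (intro INT_I)
    fix T :: real assume "T \<in> {0<..}"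
    obtain n0 where n0: "\<And>n. n \<ge> n0 \<Longrightarrow> t n \<ge> T"
      using t_top unfolding filterlim_at_top eventually_sequentially by blast
    have "\<forall>n. \<exists>\<nu>. is_empirical_measure \<Phi> x (t (n + n0)) \<nu>"
      by (intro allI empirical_measure_exists[of \<Phi> x] orbit_cont t0)
    then obtain \<nu> where \<nu>: "\<And>n. is_empirical_measure \<Phi> x (t (n + n0)) (\<nu> n)" by metis
    show "mix s \<in> weak_star_topology closure_of {\<mu>. \<exists>t\<ge>T. is_empirical_measure \<Phi> x t \<mu>}"
    proof (rule in_weak_star_closureI[OF mix_prob[OF s]])
      show "\<nu> n \<in> {\<mu>. \<exists>t\<ge>T. is_empirical_measure \<Phi> x t \<mu>}" for n using \<nu> n0[of "n + n0"] by auto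
      show "\<nu> n \<in> borel_probabilities" for n using \<nu> by (auto simp: is_empirical_measure_def)
      fix f :: "torus \<Rightarrow> real" assume f: "continuous_on UNIV f"
      have fm: "f \<in> borel_measurable borel" using f by (rule borel_measurable_continuous_onI)
      show "(\<lambda>n. \<integral>x. f x \<partial>\<nu> n) \<longlonglongrightarrow> (\<integral>x. f x \<partial>mix s)"
        unfolding integral_empirical[OF \<nu> f] integral_mix[OF s fm]
        by (rule LIMSEQ_ignore_initial_segment[OF f_lim[OF f]])
    qed
  qed
qed

text \<open>Integration of a fixed continuous function is weak-* continuous, so the integral against
  a limit measure is a cluster value of time averages. For \<open>\<phi>\<close> this value is 0,
  which forces the form \<open>mix s\<close>; for \<open>h\<close> it is \<open>s\<close>.\<close>

lemma p_omegaD: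
  assumes "\<mu> \<in> p_omega \<Phi> x"
  obtains s where "0 \<le> s" "s \<le> 1" "\<mu> = mix s" "\<And>\<epsilon> B. \<epsilon> > 0 \<Longrightarrow> \<exists>t\<ge>B. \<bar>time_average \<Phi> x h t - s\<bar> < \<epsilon>"
proof -
  have freq: "\<exists>t\<ge>B. \<bar>time_average \<Phi> x f t - (\<integral>y. f y \<partial>\<mu>)\<bar> < \<epsilon>"
    if f: "continuous_on UNIV f" and "\<epsilon> > 0" for f \<epsilon> B
  proof -
    define T where "T = max B 1"
    have "\<mu> \<in> weak_star_topology closure_of {\<mu>. \<exists>t\<ge>T. is_empirical_measure \<Phi> x t \<mu>}"
      using assms unfolding p_omega_def by (rule INT_D) (simp add: T_def)
    then have "(\<integral>y. f y \<partial>\<mu>) \<in> euclideanreal closure_of ((\<lambda>\<mu>. \<integral>y. f y \<partial>\<mu>) ` {\<mu>. \<exists>t\<ge>T. is_empirical_measure \<Phi> x t \<mu>})"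
      using continuous_map_image_closure_subset[OF continuous_map_weak_star[OF f]] by blast
    then obtain y where "y \<in> (\<lambda>\<mu>. \<integral>y. f y \<partial>\<mu>) ` {\<mu>. \<exists>t\<ge>T. is_empirical_measure \<Phi> x t \<mu>}" "dist y (\<integral>y. f y \<partial>\<mu>) < \<epsilon>"
      using \<open>\<epsilon> > 0\<close> unfolding euclidean_closure_of closure_approachable by blast
    then show ?thesis using integral_empirical[OF _ f] by (auto simp: dist_real_def T_def)
  qed
  have prob: "\<mu> \<in> borel_probabilities"
  proof -
    have "\<mu> \<in> topspace weak_star_topology"
      using INT_D[OF assms[unfolded p_omega_def], of 1] by (auto simp: in_closure_of)
    then show ?thesis unfolding weak_star_topology_def Let_def topspace_pullback_topology by auto
  qed
  have "(\<integral>y. \<phi> y \<partial>\<mu>) = 0"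
  proof (rule ccontr)
    assume n: "(\<integral>y. \<phi> y \<partial>\<mu>) \<noteq> 0"
    let ?e = "\<bar>\<integral>y. \<phi> y \<partial>\<mu>\<bar> / 2"
    have "\<forall>\<^sub>F t in at_top. dist (time_average \<Phi> x \<phi> t) 0 < ?e" using slow n by (intro tendstoD) auto
    then obtain B where B: "\<And>t. t \<ge> B \<Longrightarrow> \<bar>time_average \<Phi> x \<phi> t\<bar> < ?e"
      unfolding eventually_at_top_linorder by (auto simp: dist_real_def)
    obtain t where "t \<ge> B" "\<bar>time_average \<Phi> x \<phi> t - (\<integral>y. \<phi> y \<partial>\<mu>)\<bar> < ?e"
      using freq[OF \<phi>_cont, of ?e B] n by auto
    then show False using B[of t] by linarith
  qed
  from eq_mix[OF prob this] show thesis using that freq[OF h_cont] by blast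
qed

end

end

section \<open>Time change\<close>

lemma direction_nth [simp]: "direction \<alpha> $ 1 = 1" "direction \<alpha> $ 2 = \<alpha>"
  by (simp_all add: direction_def)

text \<open>The integral curve moves along the line, and its position \<open>L t\<close> solves
  \<open>L' = \<phi> (z L)\<close>. Hence \<open>\<tau>\<close> is the inverse of \<open>L\<close>,
  and substitution turns time integrals into line integrals with density
  \<open>1 / \<phi>\<close>.\<close>

lemma flow_time_change:
  fixes \<phi> :: "torus \<Rightarrow> real" and v :: "real^2"
  assumes gen: "generates_flow (\<lambda>x. \<phi> x *\<^sub>R direction \<alpha>) \<Phi>"
    and \<phi>: "continuous_on UNIV \<phi>" "\<And>x. 0 \<le> \<phi> x"
    and pos: "\<And>l. 0 < \<phi> (to_torus (v + l *\<^sub>R direction \<alpha>))"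
  defines "\<tau> \<equiv> \<lambda>R. integral {0..R} (\<lambda>l. 1 / \<phi> (to_torus (v + l *\<^sub>R direction \<alpha>)))"
  shows "continuous_on UNIV (\<lambda>s. \<Phi> s (to_torus v))"
    and "\<And>R. 0 \<le> R \<Longrightarrow> R = 0 \<or> 0 < \<tau> R"
    and "\<And>t. 0 \<le> t \<Longrightarrow> \<exists>R\<ge>0. \<tau> R = t"
    and "\<And>R f. 0 \<le> R \<Longrightarrow> continuous_on UNIV f \<Longrightarrow> integral {0..\<tau> R} (\<lambda>s. f (\<Phi> s (to_torus v)))
      = integral {0..R} (\<lambda>l. f (to_torus (v + l *\<^sub>R direction \<alpha>)) / \<phi> (to_torus (v + l *\<^sub>R direction \<alpha>)))"
proof -
  let ?u = "direction \<alpha>"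
  define z where "z l = to_torus (v + l *\<^sub>R ?u)" for l
  have z_cont: "continuous_on S z" for S
    unfolding z_def by (rule continuous_on_compose2[OF continuous_to_torus[of UNIV]]) (auto intro!: continuous_intros)
  have \<phi>z_cont: "continuous_on S (\<lambda>l. \<phi> (z l))" for S
    by (rule continuous_on_compose2[OF \<phi>(1) z_cont]) simp
  have posz: "0 < \<phi> (z l)" for l using pos by (simp add: z_def)
  obtain c where c: "to_torus (c 0) = to_torus v" "\<And>t. \<Phi> t (to_torus v) = to_torus (c t)"
    "\<And>t. (c has_vector_derivative \<phi> (to_torus (c t)) *\<^sub>R ?u) (at t)"
    using gen unfolding generates_flow_def by metis
  define L where "L t = c t $ 1 - c 0 $ 1" for t
  have nth: "((\<lambda>t. c t $ i) has_real_derivative \<phi> (to_torus (c t)) * ?u $ i) (at t)" for t i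
    using bounded_linear.has_vector_derivative[OF bounded_linear_vec_nth c(3), of i t]
    by (simp add: has_real_derivative_iff_has_vector_derivative)
  have L_deriv': "(L has_real_derivative \<phi> (to_torus (c t))) (at t)" for t
    unfolding L_def using nth[of 1 t] by (auto intro!: derivative_eq_intros)
  \<comment> \<open>Both components of the velocity are multiples of the same scalar, so this
    difference is constant and the curve stays on a line. Its start \<open>c 0\<close> may differ
    from \<open>v\<close> by an integer vector.\<close>
  have "c t $ 2 - \<alpha> * L t = c 0 $ 2 - \<alpha> * L 0" for t
  proof (rule DERIV_isconst_all[of "\<lambda>t. c t $ 2 - \<alpha> * L t"], rule allI)
    fix t
    show "((\<lambda>t. c t $ 2 - \<alpha> * L t) has_real_derivative 0) (at t)"
      using nth[of 2 t] L_deriv'[of t] by (auto intro!: derivative_eq_intros)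
  qed
  then have c_eq: "c t = c 0 + L t *\<^sub>R ?u" for t
    by (simp add: vec_eq_iff forall_2 L_def algebra_simps)
  have flow: "\<Phi> t (to_torus v) = z (L t)" for t
    unfolding c(2) z_def using c_eq[of t] c(1) by (simp add: to_torus_add)
  then have L_deriv: "(L has_real_derivative \<phi> (z (L t))) (at t)" for t
    using L_deriv'[of t] c(2) by simp
  have L0: "L 0 = 0" by (simp add: L_def)
  have L_mono: "L s \<le> L t" if "s \<le> t" for s t
    by (rule DERIV_nonneg_imp_nondecreasing[OF that]) (use L_deriv posz less_imp_le in blast)
  have L_cont: "continuous_on S L" for S
    by (rule DERIV_continuous_on[of _ L "\<lambda>t. \<phi> (z (L t))"]) (auto intro: has_field_derivative_at_within L_deriv)
  show "continuous_on UNIV (\<lambda>s. \<Phi> s (to_torus v))"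
    unfolding flow by (rule continuous_on_compose2[OF z_cont[of UNIV] L_cont]) simp
  have subst: "integral {0..t} (\<lambda>s. f (\<Phi> s (to_torus v))) = integral {0..L t} (\<lambda>l. f (z l) / \<phi> (z l))"
    if t: "0 \<le> t" and f: "continuous_on UNIV f" for f :: "torus \<Rightarrow> real" and t
  proof -
    have "((\<lambda>s. \<phi> (z (L s)) *\<^sub>R (f (z (L s)) / \<phi> (z (L s)))) has_integral integral {L 0..L t} (\<lambda>l. f (z l) / \<phi> (z l))) {0..t}"
    proof (rule has_integral_substitution[of 0 t L 0 "L t" "\<lambda>l. f (z l) / \<phi> (z l)" "\<lambda>s. \<phi> (z (L s))"])
      show "L ` {0..t} \<subseteq> {0..L t}" using L_mono L0 by (metis atLeastAtMost_iff image_subsetI)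
      show "continuous_on {0..L t} (\<lambda>l. f (z l) / \<phi> (z l))"
        using posz by (intro continuous_on_divide \<phi>z_cont continuous_on_compose2[OF f z_cont]) (auto simp: less_imp_neq[symmetric])
      show "(L has_real_derivative \<phi> (z (L s))) (at s within {0..t})" for s
        by (rule has_field_derivative_at_within[OF L_deriv])
    qed (use t L_mono in auto)
    moreover have "\<phi> (z (L s)) *\<^sub>R (f (z (L s)) / \<phi> (z (L s))) = f (\<Phi> s (to_torus v))" for s
      using posz[of "L s"] by (simp add: flow)
    ultimately show ?thesis by (simp add: L0 integral_unique)
  qed
  have \<tau>: "\<tau> R = integral {0..R} (\<lambda>l. 1 / \<phi> (z l))" for R by (simp add: \<tau>_def z_def)
  have inv_cont: "continuous_on S (\<lambda>l. 1 / \<phi> (z l))" for S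
    using posz by (intro continuous_on_divide \<phi>z_cont continuous_on_const) (auto simp: less_imp_neq[symmetric])
  have int: "(\<lambda>l. 1 / \<phi> (z l)) integrable_on {a..b}" for a b
    by (rule integrable_continuous_real[OF inv_cont])
  have \<tau>_strict: "\<tau> a < \<tau> b" if "0 \<le> a" "a < b" for a b
  proof -
    have "\<tau> a + integral {a..b} (\<lambda>l. 1 / \<phi> (z l)) = \<tau> b"
      unfolding \<tau> using that by (intro Henstock_Kurzweil_Integration.integral_combine int) auto
    moreover have "0 < integral {a..b} (\<lambda>l. 1 / \<phi> (z l))"
    proof -
      have ne: "{a..b} \<noteq> {}" using that by simp
      obtain m where m: "m \<in> {a..b}" "\<And>l. l \<in> {a..b} \<Longrightarrow> 1 / \<phi> (z m) \<le> 1 / \<phi> (z l)"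
        using continuous_attains_inf[OF compact_Icc ne inv_cont] by blast
      have "((\<lambda>l. 1 / \<phi> (z m)) has_integral (b - a) * (1 / \<phi> (z m))) {a..b}"
        using has_integral_const_real[of "1 / \<phi> (z m)" a b] that by simp
      from has_integral_le[OF this integrable_integral[OF int] m(2)]
      have "(b - a) * (1 / \<phi> (z m)) \<le> integral {a..b} (\<lambda>l. 1 / \<phi> (z l))" .
      moreover have "0 < (b - a) * (1 / \<phi> (z m))" using that posz[of m] by simp
      ultimately show ?thesis by linarith
    qed
    ultimately show ?thesis by linarith
  qed
  have \<tau>L: "\<tau> (L t) = t" if "0 \<le> t" for t
    using subst[OF that, of "\<lambda>_. 1"] that by (simp add: \<tau>)
  have Lpos: "0 \<le> L t" if "0 \<le> t" for t using L_mono[OF that] L0 by simp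
  have \<tau>0: "\<tau> 0 = 0" by (simp add: \<tau>)
  show "R = 0 \<or> 0 < \<tau> R" if "0 \<le> R" for R using \<tau>_strict[of 0 R] \<tau>0 that by (cases "R = 0") auto
  have \<tau>_nonneg: "0 \<le> \<tau> R" if "0 \<le> R" for R using \<tau>_strict[of 0 R] \<tau>0 that by (cases "R = 0") auto
  show "\<exists>R\<ge>0. \<tau> R = t" if "0 \<le> t" for t using \<tau>L[OF that] Lpos[OF that] by blast
  \<comment> \<open>Only \<open>\<tau> (L t) = t\<close> comes from the substitution; strict
    monotonicity of \<open>\<tau>\<close> yields the inverse in the other order.\<close>
  have L\<tau>: "L (\<tau> R) = R" if R: "0 \<le> R" for R
  proof (rule ccontr)
    assume "L (\<tau> R) \<noteq> R"
    moreover have "\<tau> (L (\<tau> R)) = \<tau> R" by (rule \<tau>L[OF \<tau>_nonneg[OF R]])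
    ultimately show False
      using \<tau>_strict[of R "L (\<tau> R)"] \<tau>_strict[of "L (\<tau> R)" R] R Lpos[OF \<tau>_nonneg[OF R]] by (cases "R < L (\<tau> R)") auto
  qed
  show "integral {0..\<tau> R} (\<lambda>s. f (\<Phi> s (to_torus v)))
      = integral {0..R} (\<lambda>l. f (to_torus (v + l *\<^sub>R direction \<alpha>)) / \<phi> (to_torus (v + l *\<^sub>R direction \<alpha>)))"
    if "0 \<le> R" "continuous_on UNIV f" for R f
    using subst[OF \<tau>_nonneg[OF that(1)] that(2)] L\<tau>[OF that(1)] by (simp add: z_def)
qed

section \<open>Second-order expansion at a stopping point\<close>

lemma deriv_along_line:
  fixes f :: "'a::real_normed_vector \<Rightarrow> real"
  assumes "\<And>x. (f has_derivative D x) (at x)"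
  shows "((\<lambda>t. f (P + t *\<^sub>R a + b)) has_real_derivative D (P + t *\<^sub>R a + b) a) (at t)"
proof -
  have "((\<lambda>t. P + t *\<^sub>R a + b) has_derivative (\<lambda>t. t *\<^sub>R a)) (at t)"
    by (auto intro!: derivative_eq_intros)
  from has_derivative_compose[OF this assms]
  have "((\<lambda>t. f (P + t *\<^sub>R a + b)) has_derivative (\<lambda>t'. D (P + t *\<^sub>R a + b) (t' *\<^sub>R a))) (at t)" by simp
  moreover have "D (P + t *\<^sub>R a + b) (t' *\<^sub>R a) = D (P + t *\<^sub>R a + b) a * t'" for t'
    using linear_scale[OF has_derivative_linear[OF assms[of "P + t *\<^sub>R a + b"]]] by simp
  ultimately show ?thesis by (simp add: has_field_derivative_def)
qed

text \<open>The mean value theorem for \<open>f (P + t a + h b) - f (P + t a)\<close> as a function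
  of \<open>t\<close> leaves a difference of first derivatives in direction \<open>a\<close>. Only
  its differentiability at the single point \<open>P\<close> is used to evaluate it.\<close>

lemma second_difference:
  fixes f :: "'a::real_normed_vector \<Rightarrow> real"
  assumes D: "\<And>x. (f has_derivative D x) (at x)" and B: "((\<lambda>x. D x a) has_derivative B) (at P)" and e: "e > 0"
  shows "\<exists>d>0. \<forall>h. 0 < h \<longrightarrow> h < d \<longrightarrow>
    \<bar>f (P + h *\<^sub>R a + h *\<^sub>R b) - f (P + h *\<^sub>R a) - f (P + h *\<^sub>R b) + f P - h\<^sup>2 * B b\<bar> \<le> e * (2 * norm a + norm b) * h\<^sup>2"
proof -
  obtain d where d: "d > 0" "\<And>y. norm (y - P) < d \<Longrightarrow> \<bar>D y a - D P a - B (y - P)\<bar> \<le> e * norm (y - P)"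
    using B e unfolding has_derivative_at_alt by (metis real_norm_def)
  have lin: "linear B" using B by (rule has_derivative_linear)
  define d' where "d' = d / (norm a + norm b + 1)"
  have d': "d' > 0" using d(1) by (simp add: d'_def add_nonneg_pos)
  have "\<bar>f (P + h *\<^sub>R a + h *\<^sub>R b) - f (P + h *\<^sub>R a) - f (P + h *\<^sub>R b) + f P - h\<^sup>2 * B b\<bar> \<le> e * (2 * norm a + norm b) * h\<^sup>2"
    if h: "0 < h" "h < d'" for h
  proof -
    let ?k = "\<lambda>t. f (P + t *\<^sub>R a + h *\<^sub>R b) - f (P + t *\<^sub>R a + 0)"
    have "(?k has_real_derivative D (P + t *\<^sub>R a + h *\<^sub>R b) a - D (P + t *\<^sub>R a + 0) a) (at t)" for t
      by (intro DERIV_diff deriv_along_line D)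
    then obtain t where t: "0 < t" "t < h" "?k h - ?k 0 = (h - 0) * (D (P + t *\<^sub>R a + h *\<^sub>R b) a - D (P + t *\<^sub>R a + 0) a)"
      using MVT2[OF h(1), of ?k "\<lambda>t. D (P + t *\<^sub>R a + h *\<^sub>R b) a - D (P + t *\<^sub>R a + 0) a"] by blast
    have "h * (norm a + norm b + 1) < d" using h(2) unfolding d'_def by (subst (asm) pos_less_divide_eq) (auto simp: add_nonneg_pos)
    moreover have "h * norm a + h * norm b \<le> h * (norm a + norm b + 1)" using h by (simp add: algebra_simps)
    ultimately have hd: "h * norm a + h * norm b < d" by linarith
    have ta: "norm (t *\<^sub>R a) \<le> h * norm a" using t by (simp add: mult_right_mono)
    have n1: "norm (t *\<^sub>R a + h *\<^sub>R b) \<le> h * norm a + h * norm b"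
      using norm_triangle_ineq[of "t *\<^sub>R a" "h *\<^sub>R b"] ta h by simp
    have "\<bar>D (P + t *\<^sub>R a + h *\<^sub>R b) a - D P a - B (t *\<^sub>R a + h *\<^sub>R b)\<bar> \<le> e * norm (t *\<^sub>R a + h *\<^sub>R b)"
      using d(2)[of "P + t *\<^sub>R a + h *\<^sub>R b"] n1 hd by (simp add: add.assoc)
    also have "\<dots> \<le> e * (h * norm a + h * norm b)" using n1 e by (intro mult_left_mono) auto
    finally have 1: "\<bar>D (P + t *\<^sub>R a + h *\<^sub>R b) a - D P a - B (t *\<^sub>R a + h *\<^sub>R b)\<bar> \<le> e * (h * norm a + h * norm b)" .
    have "0 \<le> h * norm b" using h by simp
    then have tad: "norm (t *\<^sub>R a) < d" using ta hd by linarith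
    have "\<bar>D (P + t *\<^sub>R a) a - D P a - B (t *\<^sub>R a)\<bar> \<le> e * norm (t *\<^sub>R a)"
      using d(2)[of "P + t *\<^sub>R a"] tad by simp
    also have "\<dots> \<le> e * (h * norm a)" using ta e by (intro mult_left_mono) auto
    finally have 2: "\<bar>D (P + t *\<^sub>R a) a - D P a - B (t *\<^sub>R a)\<bar> \<le> e * (h * norm a)" .
    have "B (t *\<^sub>R a + h *\<^sub>R b) = B (t *\<^sub>R a) + h * B b" using lin by (simp add: linear_add linear_scale)
    with 1 2 have "\<bar>(D (P + t *\<^sub>R a + h *\<^sub>R b) a - D (P + t *\<^sub>R a) a) - h * B b\<bar> \<le> e * (h * norm a + h * norm b) + e * (h * norm a)"
      by linarith
    then have "h * \<bar>(D (P + t *\<^sub>R a + h *\<^sub>R b) a - D (P + t *\<^sub>R a) a) - h * B b\<bar> \<le> h * (e * (h * norm a + h * norm b) + e * (h * norm a))"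
      using h by (intro mult_left_mono) auto
    also have "h * \<bar>(D (P + t *\<^sub>R a + h *\<^sub>R b) a - D (P + t *\<^sub>R a) a) - h * B b\<bar>
        = \<bar>h * ((D (P + t *\<^sub>R a + h *\<^sub>R b) a - D (P + t *\<^sub>R a) a) - h * B b)\<bar>" using h by (simp add: abs_mult)
    finally show ?thesis using t(3) by (simp add: algebra_simps power2_eq_square)
  qed
  with d' show ?thesis by blast
qed

text \<open>The second difference does not change when \<open>a\<close> and \<open>b\<close> are
  exchanged, so both mixed derivatives are the same limit.\<close>

lemma second_derivative_symmetric:
  fixes f :: "'a::real_normed_vector \<Rightarrow> real"
  assumes D: "\<And>x. (f has_derivative D x) (at x)"
    and Ba: "((\<lambda>x. D x a) has_derivative Ba) (at P)" and Bb: "((\<lambda>x. D x b) has_derivative Bb) (at P)"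
  shows "Ba b = Bb a"
proof -
  have "\<bar>Ba b - Bb a\<bar> \<le> e * (3 * (norm a + norm b))" if e: "e > 0" for e
  proof -
    obtain d1 where d1: "d1 > 0" "\<And>h. 0 < h \<Longrightarrow> h < d1 \<Longrightarrow>
      \<bar>f (P + h *\<^sub>R a + h *\<^sub>R b) - f (P + h *\<^sub>R a) - f (P + h *\<^sub>R b) + f P - h\<^sup>2 * Ba b\<bar> \<le> e * (2 * norm a + norm b) * h\<^sup>2"
      using second_difference[OF D Ba e, of b] by blast
    obtain d2 where d2: "d2 > 0" "\<And>h. 0 < h \<Longrightarrow> h < d2 \<Longrightarrow>
      \<bar>f (P + h *\<^sub>R b + h *\<^sub>R a) - f (P + h *\<^sub>R b) - f (P + h *\<^sub>R a) + f P - h\<^sup>2 * Bb a\<bar> \<le> e * (2 * norm b + norm a) * h\<^sup>2"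
      using second_difference[OF D Bb e, of a] by blast
    define h where "h = min d1 d2 / 2"
    have h: "0 < h" "h < d1" "h < d2" using d1(1) d2(1) by (auto simp: h_def min_def)
    have sw: "P + h *\<^sub>R b + h *\<^sub>R a = P + h *\<^sub>R a + h *\<^sub>R b" by simp
    have "\<bar>h\<^sup>2 * Ba b - h\<^sup>2 * Bb a\<bar> \<le> e * (2 * norm a + norm b) * h\<^sup>2 + e * (2 * norm b + norm a) * h\<^sup>2"
      using d1(2)[OF h(1,2)] d2(2)[OF h(1,3)] unfolding sw by linarith
    also have "\<dots> = h\<^sup>2 * (e * (3 * (norm a + norm b)))" by (simp add: algebra_simps)
    also have "\<bar>h\<^sup>2 * Ba b - h\<^sup>2 * Bb a\<bar> = h\<^sup>2 * \<bar>Ba b - Bb a\<bar>"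
      by (simp add: right_diff_distrib[symmetric] abs_mult)
    finally show ?thesis using h(1) by simp
  qed
  note * = this
  have "\<bar>Ba b - Bb a\<bar> \<le> 0 + e" if "e > 0" for e
  proof -
    have n: "3 * (norm a + norm b) + 1 > 0" by (simp add: add_nonneg_pos)
    have "\<bar>Ba b - Bb a\<bar> \<le> e / (3 * (norm a + norm b) + 1) * (3 * (norm a + norm b))"
      using that n by (intro *) simp
    also have "\<dots> \<le> e" using that n by (simp add: field_simps)
    finally show ?thesis by simp
  qed
  then have "\<bar>Ba b - Bb a\<bar> \<le> 0" by (rule field_le_epsilon)
  then show ?thesis by simp
qed

text \<open>The mean value theorem along the segment from \<open>P\<close>, applied to
  \<open>f\<close> minus half the quadratic form: the derivative of this difference is controlled by
  the expansion of the partial derivatives at \<open>P\<close>.\<close>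

lemma taylor_at_critical_point:
  fixes f :: "real^2 \<Rightarrow> real"
  assumes D: "\<And>x. (f has_derivative D x) (at x)" and zero: "f P = 0" "\<And>v. D P v = 0"
    and B: "\<And>i. ((\<lambda>x. D x (axis i 1)) has_derivative B i) (at P)" and e: "e > 0"
  shows "\<exists>d>0. \<forall>v. norm v < d \<longrightarrow> \<bar>f (P + v) - (\<Sum>i\<in>UNIV. v $ i * B i v) / 2\<bar> \<le> e * (norm v)\<^sup>2"
proof -
  have "\<exists>d>0. \<forall>y. norm (y - P) < d \<longrightarrow> \<bar>D y (axis i 1) - B i (y - P)\<bar> \<le> e / 2 * norm (y - P)" for i
  proof -
    have "\<forall>e>0. \<exists>d>0. \<forall>y. norm (y - P) < d \<longrightarrow> norm (D y (axis i 1) - D P (axis i 1) - B i (y - P)) \<le> e * norm (y - P)"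
      using B[of i] unfolding has_derivative_at_alt by blast
    from this[rule_format, of "e / 2"] e show ?thesis by (simp add: zero(2))
  qed
  then obtain d where d: "\<And>i. d i > 0" "\<And>i y. norm (y - P) < d i \<Longrightarrow> \<bar>D y (axis i 1) - B i (y - P)\<bar> \<le> e / 2 * norm (y - P)"
    by metis
  have lin: "linear (B i)" for i using B by (rule has_derivative_linear)
  define d0 where "d0 = min (d 1) (d 2)"
  have d0: "d0 > 0" "d0 \<le> d i" for i :: 2
    using d(1) exhaust_2[of i] by (auto simp: d0_def)
  have "\<bar>f (P + v) - (\<Sum>i\<in>UNIV. v $ i * B i v) / 2\<bar> \<le> e * (norm v)\<^sup>2" if v: "norm v < d0" for v
  proof -
    let ?q = "\<Sum>i\<in>UNIV. v $ i * B i v"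
    let ?k = "\<lambda>t. f (P + t *\<^sub>R v + 0) - t\<^sup>2 * ?q / 2"
    have "(?k has_real_derivative D (P + t *\<^sub>R v + 0) v - t * ?q) (at t)" for t
      by (intro DERIV_diff deriv_along_line D) (auto intro!: derivative_eq_intros)
    then obtain t where t: "0 < t" "t < 1" "?k 1 - ?k 0 = (1 - 0) * (D (P + t *\<^sub>R v + 0) v - t * ?q)"
      using MVT2[OF zero_less_one, of ?k "\<lambda>t. D (P + t *\<^sub>R v + 0) v - t * ?q"] by blast
    have tv: "norm (t *\<^sub>R v) \<le> norm v" using t by (simp add: mult_left_le_one_le)
    have v_sum: "v = (\<Sum>i\<in>UNIV. (v $ i) *\<^sub>R axis i 1)"
      by (simp add: vec_eq_iff axis_def if_distrib sum.delta cong: if_cong)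
    have "D (P + t *\<^sub>R v) v = D (P + t *\<^sub>R v) (\<Sum>i\<in>UNIV. (v $ i) *\<^sub>R axis i 1)"
      using v_sum by simp
    also have "\<dots> = (\<Sum>i\<in>UNIV. v $ i * D (P + t *\<^sub>R v) (axis i 1))"
      using has_derivative_linear[OF D[of "P + t *\<^sub>R v"]] by (simp add: linear_sum linear_scale)
    finally have "D (P + t *\<^sub>R v) v - t * ?q = (\<Sum>i\<in>UNIV. v $ i * (D (P + t *\<^sub>R v) (axis i 1) - B i (t *\<^sub>R v)))"
      using lin by (simp add: linear_scale sum_distrib_left right_diff_distrib sum_subtractf mult_ac)
    also have "\<bar>\<dots>\<bar> \<le> (\<Sum>i\<in>UNIV. \<bar>v $ i * (D (P + t *\<^sub>R v) (axis i 1) - B i (t *\<^sub>R v))\<bar>)" by (rule sum_abs)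
    also have "\<dots> \<le> (\<Sum>i\<in>(UNIV::2 set). norm v * (e / 2 * norm v))"
    proof (rule sum_mono)
      fix i :: 2
      have "\<bar>D (P + t *\<^sub>R v) (axis i 1) - B i (t *\<^sub>R v)\<bar> \<le> e / 2 * norm (t *\<^sub>R v)"
        using d(2)[of "P + t *\<^sub>R v" i] tv v d0(2)[of i] by simp
      also have "\<dots> \<le> e / 2 * norm v" using tv e by (intro mult_left_mono) auto
      finally show "\<bar>v $ i * (D (P + t *\<^sub>R v) (axis i 1) - B i (t *\<^sub>R v))\<bar> \<le> norm v * (e / 2 * norm v)"
        unfolding abs_mult by (intro mult_mono component_le_norm_cart) auto
    qed
    also have "\<dots> = e * (norm v)\<^sup>2" by (simp add: power2_eq_square)
    finally show ?thesis using t(3) zero(1) by simp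
  qed
  with d0(1) show ?thesis by blast
qed

lemma C3_derivatives:
  assumes "C_times_differentiable 3 f"
  shows "(f has_derivative frechet_derivative f (at x)) (at x)"
    and "((\<lambda>x. frechet_derivative f (at x) v) has_derivative frechet_derivative (\<lambda>x. frechet_derivative f (at x) v) (at x)) (at x)"
    and "continuous_on UNIV f"
proof -
  have *: "(\<forall>x. f differentiable (at x)) \<and> (\<forall>v. C_times_differentiable 2 (\<lambda>x. frechet_derivative f (at x) v))"
    using assms by (simp add: numeral_3_eq_3 numeral_2_eq_2)
  then show "(f has_derivative frechet_derivative f (at x)) (at x)"
    by (simp add: frechet_derivative_works[symmetric])
  have "(\<lambda>x. frechet_derivative f (at x) v) differentiable (at x)"
    using * by (auto simp: numeral_2_eq_2)
  then show "((\<lambda>x. frechet_derivative f (at x) v) has_derivative frechet_derivative (\<lambda>x. frechet_derivative f (at x) v) (at x)) (at x)"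
    by (simp add: frechet_derivative_works[symmetric])
  show "continuous_on UNIV f"
    using * by (intro continuous_at_imp_continuous_on ballI differentiable_imp_continuous_within) auto
qed

lemma vector2_eq: "(vector [a, b] :: real^2) = a *\<^sub>R axis 1 1 + b *\<^sub>R axis 2 1"
  by (simp add: vec_eq_iff forall_2 axis_def)

lemma continuous_on_vector2: "continuous_on S (\<lambda>z. vector [fst z, snd z] :: real^2)"
  unfolding vector2_eq by (intro continuous_intros)

lemma to_torus_vector_add_int:
  "to_torus (vector [a + of_int m, b + of_int n]) = to_torus (vector [a, b])"
  by (simp add: to_torus_eq_iff forall_2)

lemma positive_definite_coercive:
  assumes "positive_definite H"
  shows "\<exists>m>0. \<forall>v. m * (norm v)\<^sup>2 \<le> v \<bullet> (H *v v)"
proof -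
  have cont: "continuous_on (sphere 0 1) (\<lambda>v::real^2. v \<bullet> (H *v v))"
    by (intro continuous_intros matrix_vector_mult_linear_continuous_on)
  have "axis 1 1 \<in> sphere (0::real^2) 1" by (simp add: dist_norm)
  then have ne: "sphere (0::real^2) 1 \<noteq> {}" by blast
  obtain w where w: "w \<in> sphere 0 1" "\<And>v. v \<in> sphere 0 1 \<Longrightarrow> w \<bullet> (H *v w) \<le> v \<bullet> (H *v v)"
    using continuous_attains_inf[OF compact_sphere ne cont] by blast
  have "w \<noteq> 0" using w(1) by auto
  then have pos: "w \<bullet> (H *v w) > 0" using assms by (simp add: positive_definite_def)
  have "w \<bullet> (H *v w) * (norm v)\<^sup>2 \<le> v \<bullet> (H *v v)" for v
  proof (cases "v = 0")
    case False
    let ?u = "(1 / norm v) *\<^sub>R v"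
    have "?u \<in> sphere 0 1" using False by simp
    from w(2)[OF this] have "w \<bullet> (H *v w) \<le> (1 / norm v) * ((1 / norm v) * (v \<bullet> (H *v v)))"
      by (simp add: scaleR_matrix_vector_assoc[symmetric] matrix_vector_mult_scaleR)
    then show ?thesis using False by (simp add: field_simps power2_eq_square)
  qed simp
  with pos show ?thesis by blast
qed

lemma matrix_vector_2: "v \<bullet> (H *v v) = H $ 1 $ 1 * (v $ 1)\<^sup>2 + (H $ 1 $ 2 + H $ 2 $ 1) * (v $ 1 * v $ 2) + H $ 2 $ 2 * (v $ 2)\<^sup>2"
  for H :: "real^2^2"
  by (simp add: inner_vec_def matrix_vector_mult_def sum_2 power2_eq_square algebra_simps)

text \<open>Near \<open>p\<close> the function \<open>\<phi>\<close> is half its Hessian form up to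
  a small relative error; definiteness of the form turns the error of order
  \<open>norm v ^ 2\<close> into a relative one. The factor \<open>h\<close> removes the other pole
  at \<open>q\<close>. Changing to the coordinates \<open>(s, w)\<close> is a shear, so the
  determinant survives.\<close>

lemma singularity_at_stopping_point:
  fixes \<phi> h :: "torus \<Rightarrow> real" and p q :: torus
  assumes C3: "C_times_differentiable 3 (\<lambda>v. \<phi> (to_torus v))"
    and nonneg: "\<And>x. 0 \<le> \<phi> x" and zeros: "\<And>x. \<phi> x = 0 \<longleftrightarrow> x = p \<or> x = q"
    and pd: "positive_definite (hessian_torus \<phi> p)"
    and h: "continuous_on UNIV h" "\<And>x. 0 \<le> h x"
    and \<epsilon>: "\<epsilon> > 0"
    and h1: "\<And>v. (\<forall>i. dist_int (v $ i - torus_rep p $ i) < \<epsilon>) \<Longrightarrow> h (to_torus v) = 1"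
    and h0: "\<And>v. (\<forall>i. dist_int (v $ i - torus_rep q $ i) < \<epsilon>) \<Longrightarrow> h (to_torus v) = 0"
  obtains A B C where "singularity \<alpha> (torus_rep p $ 1) (torus_rep p $ 2) A B C
      (\<lambda>a b. h (to_torus (vector [a, b])) / \<phi> (to_torus (vector [a, b])))"
    and "A * C - B\<^sup>2 = det (hessian_torus \<phi> p)"
proof -
  define \<psi> where "\<psi> v = \<phi> (to_torus v)" for v
  define P where "P = torus_rep p"
  define D where "D x = frechet_derivative \<psi> (at x)" for x
  define Bd where "Bd i = frechet_derivative (\<lambda>x. D x (axis i 1)) (at P)" for i :: 2
  define H where "H = hessian_torus \<phi> p"
  have C3': "C_times_differentiable 3 \<psi>" using C3 unfolding \<psi>_def[abs_def] .
  have deriv: "(\<psi> has_derivative D x) (at x)" for x unfolding D_def by (rule C3_derivatives(1)[OF C3'])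
  have deriv2: "((\<lambda>x. D x (axis i 1)) has_derivative Bd i) (at P)" for i
    unfolding Bd_def D_def by (rule C3_derivatives(2)[OF C3'])
  have \<psi>_cont: "continuous_on UNIV \<psi>" by (rule C3_derivatives(3)[OF C3'])
  have \<phi>_cont: "continuous_on UNIV \<phi>" using \<psi>_cont by (simp add: continuous_on_torus_iff \<psi>_def)
  have tP: "to_torus P = p" by (simp add: P_def)
  have \<psi>P: "\<psi> P = 0" using zeros tP by (simp add: \<psi>_def)
  have "D P = (\<lambda>v. 0)"
    \<comment> \<open>The stopping point is a minimum of the nonnegative function
      \<open>\<psi>\<close>.\<close>
    by (rule differential_zero_maxmin[of P UNIV \<psi>]) (use deriv \<psi>P nonneg in \<open>auto simp: \<psi>_def\<close>)
  then have DP: "D P v = 0" for v by simp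
  have H: "H $ i $ j = Bd j (axis i 1)" for i j
  proof -
    have "(\<lambda>v. \<phi> (to_torus v)) = \<psi>" by (simp add: \<psi>_def fun_eq_iff)
    then have "H $ i $ j = partial_deriv i (partial_deriv j \<psi>) P" by (simp add: H_def hessian_torus_def P_def)
    also have "partial_deriv j \<psi> = (\<lambda>x. D x (axis j 1))" by (simp add: fun_eq_iff partial_deriv_def D_def)
    finally show ?thesis by (simp add: partial_deriv_def Bd_def)
  qed
  have sym: "H $ 1 $ 2 = H $ 2 $ 1"
    unfolding H by (rule second_derivative_symmetric[OF deriv deriv2 deriv2])
  define a11 a12 a22 where a_defs: "a11 = H $ 1 $ 1" "a12 = H $ 1 $ 2" "a22 = H $ 2 $ 2"
  define Qf where "Qf v = v \<bullet> (H *v v)" for v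
  have Qf: "Qf v = a11 * (v $ 1)\<^sup>2 + 2 * a12 * (v $ 1 * v $ 2) + a22 * (v $ 2)\<^sup>2" for v
    unfolding Qf_def matrix_vector_2 using sym by (simp add: a_defs)
  have Bd_sum: "(\<Sum>i\<in>UNIV. v $ i * Bd i v) = Qf v" for v
  proof -
    have "Bd i v = (\<Sum>j\<in>UNIV. v $ j * H $ j $ i)" for i
    proof -
      have lin: "linear (Bd i)" using deriv2 by (rule has_derivative_linear)
      have "v = (\<Sum>j\<in>UNIV. (v $ j) *\<^sub>R axis j 1)"
        by (simp add: vec_eq_iff axis_def if_distrib sum.delta cong: if_cong)
      then have "Bd i v = Bd i (\<Sum>j\<in>UNIV. (v $ j) *\<^sub>R axis j 1)" by simp
      also have "\<dots> = (\<Sum>j\<in>UNIV. v $ j * H $ j $ i)" using lin by (simp add: linear_sum linear_scale H)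
      finally show ?thesis .
    qed
    then show ?thesis using sym by (simp add: sum_2 Qf a_defs power2_eq_square algebra_simps)
  qed
  have Qf_pos: "Qf v > 0" if "v \<noteq> 0" for v using pd that by (simp add: positive_definite_def Qf_def H_def)
  obtain m where m: "m > 0" "\<And>v. m * (norm v)\<^sup>2 \<le> Qf v"
    using positive_definite_coercive[OF pd] unfolding Qf_def H_def by blast
  \<comment> \<open>The coefficients of the Hessian form in the sheared coordinates, from
    substituting \<open>v = (s, w + \<alpha> * s)\<close>.\<close>
  define A where "A = a11 + 2 * a12 * \<alpha> + a22 * \<alpha>\<^sup>2"
  define B where "B = a12 + a22 * \<alpha>"
  define C where "C = a22"
  have Qf_coord: "Qf (vector [s, w + \<alpha> * s]) = A * s\<^sup>2 + 2 * B * s * w + C * w\<^sup>2" for s w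
    by (simp add: Qf A_def B_def C_def power2_eq_square algebra_simps)
  have nz: "(vector [a, b] :: real^2) \<noteq> 0 \<longleftrightarrow> a \<noteq> 0 \<or> b \<noteq> 0" for a b
    by (simp add: vec_eq_iff forall_2)
  have A_pos: "A > 0" using Qf_pos[of "vector [1, \<alpha>]"] Qf_coord[of 1 0] by (simp add: nz)
  have disc: "A * C - B\<^sup>2 = det H"
    unfolding det_2 using sym by (simp add: A_def B_def C_def a_defs power2_eq_square algebra_simps)
  have C_pos: "C > 0" using Qf_pos[of "vector [0, 1]"] Qf_coord[of 0 1] by (simp add: nz)
  have disc_pos: "A * C - B\<^sup>2 > 0"
  proof -
    \<comment> \<open>The vector with \<open>s = C\<close> and \<open>w = - B\<close>, at which the
      form takes the value \<open>C * (A * C - B\<^sup>2)\<close>.\<close>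
    have "Qf (vector [C, - B + \<alpha> * C]) > 0" using C_pos by (intro Qf_pos) (simp add: nz)
    then have "C * (A * C - B\<^sup>2) > 0" unfolding Qf_coord by (simp add: power2_eq_square algebra_simps)
    then show ?thesis using C_pos by (simp add: zero_less_mult_iff)
  qed
  let ?G = "\<lambda>a b. h (to_torus (vector [a, b])) / \<phi> (to_torus (vector [a, b]))"
  have "singularity \<alpha> (P $ 1) (P $ 2) A B C ?G"
  proof
    show "?G (a + of_int k) (b + of_int n) = ?G a b" for a b k n by (simp add: to_torus_vector_add_int)
    show "0 \<le> ?G a b" for a b using h(2) nonneg by simp
    show "A > 0" "A * C - B\<^sup>2 > 0" by (rule A_pos disc_pos)+
    show "isCont (\<lambda>(a, b). ?G a b) (a, b)" if ab: "\<not> (a - P $ 1 \<in> \<int> \<and> b - P $ 2 \<in> \<int>)" for a b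
    proof -
      let ?g = "\<lambda>v. h (to_torus v) / \<phi> (to_torus v)"
      let ?v0 = "vector [a, b] :: real^2"
      have "isCont ?g ?v0"
      proof (cases "\<phi> (to_torus ?v0) = 0")
        case False
        have "isCont (\<lambda>v. h (to_torus v)) ?v0" "isCont (\<lambda>v. \<phi> (to_torus v)) ?v0"
          using h(1) \<phi>_cont by (auto simp: continuous_on_torus_iff continuous_on_eq_continuous_at)
        then show ?thesis using False by (intro continuous_intros)
      next
        case True
        have "to_torus ?v0 \<noteq> p"
        proof
          assume "to_torus ?v0 = p"
          then have "to_torus ?v0 = to_torus P" by (simp add: tP)
          then show False using ab by (simp add: to_torus_eq_iff forall_2)
        qed
        then have "to_torus ?v0 = to_torus (torus_rep q)" using True zeros by simp
        then have q: "\<forall>i. dist_int (?v0 $ i - torus_rep q $ i) = 0" unfolding to_torus_eq_iff dist_int_eq_0_iff .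
        define U where "U = {v :: real^2. \<forall>i. dist_int (v $ i - torus_rep q $ i) < \<epsilon>}"
        have "open U" unfolding U_def forall_2
          by (intro open_Collect_conj open_Collect_less continuous_on_compose2[OF continuous_on_dist_int[of UNIV]] continuous_intros) auto
        moreover have "?v0 \<in> U" using q \<epsilon> by (simp add: U_def)
        moreover have "continuous_on U ?g"
        proof -
          \<comment> \<open>Near \<open>q\<close> the quotient is identically 0, and at
            \<open>q\<close> itself the convention \<open>0 / 0 = 0\<close> gives the same value, so
            no singularity remains.\<close>
          have zero: "?g v = 0" if "v \<in> U" for v using that h0[of v] by (simp add: U_def)
          have "continuous_on U ?g \<longleftrightarrow> continuous_on U (\<lambda>v. 0::real)"
            by (rule continuous_on_cong[OF refl zero])
          then show ?thesis by simp
        qed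
        ultimately show ?thesis by (simp add: continuous_on_eq_continuous_at)
      qed
      moreover have "isCont (\<lambda>z. vector [fst z, snd z] :: real^2) (a, b)"
        using continuous_on_vector2[of UNIV] by (simp add: continuous_on_eq_continuous_at)
      ultimately have "isCont (\<lambda>z. ?g (vector [fst z, snd z])) (a, b)"
        by (intro isCont_o2[where f = "\<lambda>z. vector [fst z, snd z] :: real^2" and g = ?g]) auto
      then show ?thesis by (simp add: case_prod_unfold)
    qed
    show "\<exists>\<rho>>0. \<forall>s w. \<bar>s\<bar> \<le> \<rho> \<longrightarrow> \<bar>w\<bar> \<le> \<rho> \<longrightarrow> w \<noteq> 0 \<longrightarrow>
        (1 - \<eta>) * (2 / (A * s\<^sup>2 + 2 * B * s * w + C * w\<^sup>2)) \<le> ?G (P $ 1 + s) (P $ 2 + w + \<alpha> * s) \<and>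
        ?G (P $ 1 + s) (P $ 2 + w + \<alpha> * s) \<le> (1 + \<eta>) * (2 / (A * s\<^sup>2 + 2 * B * s * w + C * w\<^sup>2))"
      if \<eta>: "\<eta> > 0" for \<eta>
    proof -
      \<comment> \<open>Relative error of \<open>\<phi>\<close> that becomes relative error
        \<open>\<eta>\<close> of \<open>1 / \<phi>\<close>:
        \<open>1 / (1 - \<theta>) = 1 + \<eta>\<close> on one side and
        \<open>(1 - \<eta>) * (1 + \<theta>) \<le> 1\<close> on the other.\<close>
      define \<theta> where "\<theta> = \<eta> / (1 + \<eta>)"
      have \<theta>: "0 < \<theta>" "\<theta> < 1" "(1 + \<eta>) * (1 - \<theta>) = 1" "(1 - \<eta>) * (1 + \<theta>) \<le> 1"
        using \<eta> by (auto simp: \<theta>_def field_simps)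
      have "m * \<theta> / 2 > 0" using m \<theta> by simp
      from taylor_at_critical_point[OF deriv \<psi>P DP deriv2 this]
      obtain d where d: "d > 0" "\<And>v. norm v < d \<Longrightarrow> \<bar>\<psi> (P + v) - Qf v / 2\<bar> \<le> m * \<theta> / 2 * (norm v)\<^sup>2"
        unfolding Bd_sum by blast
      \<comment> \<open>The vector \<open>v\<close> has norm at most
        \<open>\<rho> * (2 + \<bar>\<alpha>\<bar>)\<close>; the 3 makes the bounds by
        \<open>d\<close> and \<open>\<epsilon>\<close> strict.\<close>
      define \<rho> where "\<rho> = min d \<epsilon> / (3 + \<bar>\<alpha>\<bar>)"
      have \<rho>: "\<rho> > 0" "\<rho> * (3 + \<bar>\<alpha>\<bar>) = min d \<epsilon>" using d(1) \<epsilon> by (auto simp: \<rho>_def)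
      have "(1 - \<eta>) * (2 / (A * s\<^sup>2 + 2 * B * s * w + C * w\<^sup>2)) \<le> ?G (P $ 1 + s) (P $ 2 + w + \<alpha> * s) \<and>
        ?G (P $ 1 + s) (P $ 2 + w + \<alpha> * s) \<le> (1 + \<eta>) * (2 / (A * s\<^sup>2 + 2 * B * s * w + C * w\<^sup>2))"
        if sw: "\<bar>s\<bar> \<le> \<rho>" "\<bar>w\<bar> \<le> \<rho>" "w \<noteq> 0" for s w
      proof -
        define v where "v = (vector [s, w + \<alpha> * s] :: real^2)"
        have v: "v $ 1 = s" "v $ 2 = w + \<alpha> * s" by (simp_all add: v_def)
        have "norm v \<le> \<bar>s\<bar> + \<bar>w + \<alpha> * s\<bar>"
          using norm_le_l1_cart[of v] by (simp add: sum_2 v)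
        also have "\<dots> \<le> \<bar>s\<bar> + (\<bar>w\<bar> + \<bar>\<alpha>\<bar> * \<bar>s\<bar>)" by (simp add: abs_mult[symmetric] abs_triangle_ineq)
        also have "\<dots> \<le> \<rho> + (\<rho> + \<bar>\<alpha>\<bar> * \<rho>)" using sw by (intro add_mono mult_left_mono) auto
        also have "\<dots> < \<rho> * (3 + \<bar>\<alpha>\<bar>)" using \<rho>(1) by (simp add: algebra_simps)
        finally have nv: "norm v < d" "norm v < \<epsilon>" unfolding \<rho>(2) by auto
        have pt: "vector [P $ 1 + s, P $ 2 + w + \<alpha> * s] = P + v" by (simp add: vec_eq_iff forall_2 v)
        have "dist_int ((P + v) $ i - torus_rep p $ i) < \<epsilon>" for i
          using dist_int_le_abs[of "v $ i"] component_le_norm_cart[of v i] nv by (simp add: P_def)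
        then have h_one: "h (to_torus (P + v)) = 1" by (intro h1) blast
        have Qeq: "A * s\<^sup>2 + 2 * B * s * w + C * w\<^sup>2 = Qf v" unfolding v_def Qf_coord ..
        have Qp: "Qf v > 0" using sw(3) by (intro Qf_pos) (auto simp: vec_eq_iff forall_2 v)
        have "m * \<theta> / 2 * (norm v)\<^sup>2 = \<theta> / 2 * (m * (norm v)\<^sup>2)" by simp
        also have "\<dots> \<le> \<theta> / 2 * Qf v" using m(2) \<theta> by (intro mult_left_mono) auto
        finally have "\<psi> (P + v) \<le> Qf v / 2 + \<theta> / 2 * Qf v" "Qf v / 2 - \<theta> / 2 * Qf v \<le> \<psi> (P + v)"
          using d(2)[OF nv(1)] by linarith+
        then have b: "(1 - \<theta>) * Qf v \<le> 2 * \<psi> (P + v)" "2 * \<psi> (P + v) \<le> (1 + \<theta>) * Qf v"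
          by (simp_all add: algebra_simps)
        have "0 < (1 - \<theta>) * Qf v" using Qp \<theta> by simp
        then have \<psi>p: "\<psi> (P + v) > 0" using b(1) by linarith
        have "(1 - \<eta>) * (2 * \<psi> (P + v)) \<le> Qf v"
        proof (cases "\<eta> \<le> 1")
          case True
          have "(1 - \<eta>) * (2 * \<psi> (P + v)) \<le> (1 - \<eta>) * ((1 + \<theta>) * Qf v)" using b(2) True by (intro mult_left_mono) auto
          also have "\<dots> = (1 - \<eta>) * (1 + \<theta>) * Qf v" by simp
          also have "\<dots> \<le> 1 * Qf v" using \<theta>(4) Qp by (intro mult_right_mono) auto
          finally show ?thesis by simp
        next
          case False
          then have "(1 - \<eta>) * (2 * \<psi> (P + v)) \<le> 0" using \<psi>p by (intro mult_nonpos_nonneg) auto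
          then show ?thesis using Qp by linarith
        qed
        then have 1: "(1 - \<eta>) * (2 / Qf v) \<le> 1 / \<psi> (P + v)" using Qp \<psi>p by (simp add: field_simps)
        have "(1 + \<eta>) * ((1 - \<theta>) * Qf v) \<le> (1 + \<eta>) * (2 * \<psi> (P + v))" using b(1) \<eta> by (intro mult_left_mono) auto
        moreover have "(1 + \<eta>) * ((1 - \<theta>) * Qf v) = Qf v" unfolding mult.assoc[symmetric] \<theta>(3) by simp
        ultimately have "Qf v \<le> (1 + \<eta>) * (2 * \<psi> (P + v))" by simp
        then have 2: "1 / \<psi> (P + v) \<le> (1 + \<eta>) * (2 / Qf v)" using Qp \<psi>p by (simp add: field_simps)
        show ?thesis unfolding pt h_one Qeq using 1 2 by (simp add: \<psi>_def)
      qed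
      with \<rho>(1) show ?thesis by blast
    qed
  qed
  with disc show thesis using that by (simp add: P_def H_def)
qed

text \<open>A piecewise linear function of the distance \<open>D\<close> to \<open>p\<close> on the
  torus, with \<open>d\<close> the distance from \<open>p\<close> to \<open>q\<close>: it is 1 up to
  \<open>d / 3\<close> and 0 from \<open>2 * d / 3\<close> on. Two coordinates below
  \<open>d / 6\<close> change \<open>D\<close> by less than \<open>d / 3\<close>, hence the
  radius.\<close>

lemma exists_cutoff:
  assumes "p \<noteq> q"
  obtains h :: "torus \<Rightarrow> real" and \<epsilon> where "continuous_on UNIV h" "\<And>x. 0 \<le> h x" "\<And>x. h x \<le> 1" "\<epsilon> > 0"
    "\<And>v. (\<forall>i. dist_int (v $ i - torus_rep p $ i) < \<epsilon>) \<Longrightarrow> h (to_torus v) = 1"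
    "\<And>v. (\<forall>i. dist_int (v $ i - torus_rep q $ i) < \<epsilon>) \<Longrightarrow> h (to_torus v) = 0"
proof -
  define D where "D v = dist_int (v $ 1 - torus_rep p $ 1) + dist_int (v $ 2 - torus_rep p $ 2)" for v :: "real^2"
  have D_cong: "D v = D w" if "to_torus v = to_torus w" for v w
  proof -
    have "dist_int (v $ i - c) = dist_int (w $ i - c)" for i c
    proof -
      obtain n where n: "v $ i - w $ i = of_int n" using \<open>to_torus v = to_torus w\<close> by (auto simp: to_torus_eq_iff elim!: Ints_cases)
      then have "v $ i - c = w $ i - c + of_int n" by simp
      then show ?thesis by (simp only: dist_int_add_int)
    qed
    then show ?thesis by (simp add: D_def)
  qed
  define d where "d = D (torus_rep q)"
  have "d \<noteq> 0"
  proof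
    assume "d = 0"
    then have "dist_int (torus_rep q $ 1 - torus_rep p $ 1) = 0" "dist_int (torus_rep q $ 2 - torus_rep p $ 2) = 0"
      unfolding d_def D_def by (smt (verit) dist_int_nonneg)+
    then have "to_torus (torus_rep q) = to_torus (torus_rep p)"
      unfolding to_torus_eq_iff forall_2 dist_int_eq_0_iff by blast
    then show False using assms by simp
  qed
  then have d: "d > 0" by (simp add: d_def D_def less_le)
  define k where "k v = max 0 (min 1 (2 - 3 * D v / d))" for v
  define h where "h x = k (torus_rep x)" for x
  have hk: "h (to_torus v) = k v" for v
    using D_cong[of "torus_rep (to_torus v)" v] by (simp add: h_def k_def)
  show thesis
  proof (rule that[of h "d / 6"])
    have "continuous_on UNIV k"
      unfolding k_def D_def using d
      by (intro continuous_intros continuous_on_compose2[OF continuous_on_dist_int[of UNIV]]) auto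
    then show "continuous_on UNIV h" by (simp add: continuous_on_torus_iff hk)
    show "0 \<le> h x" "h x \<le> 1" for x by (simp_all add: h_def k_def)
    show "d / 6 > 0" using d by simp
    fix v :: "real^2"
    show "h (to_torus v) = 1" if v: "\<forall>i. dist_int (v $ i - torus_rep p $ i) < d / 6"
    proof -
      have "D v \<le> d / 3" using v[rule_format, of 1] v[rule_format, of 2] by (simp add: D_def)
      then have "3 * D v / d \<le> 1" using d by (simp add: field_simps)
      then show ?thesis by (simp add: hk k_def)
    qed
    show "h (to_torus v) = 0" if v: "\<forall>i. dist_int (v $ i - torus_rep q $ i) < d / 6"
    proof -
      have "dist_int (torus_rep q $ i - torus_rep p $ i) \<le> dist_int (v $ i - torus_rep p $ i) + dist_int (v $ i - torus_rep q $ i)" for i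
        using dist_int_triangle_diff[of "v $ i - torus_rep p $ i" "v $ i - torus_rep q $ i"] by simp
      from add_mono[OF this[of 1] this[of 2]] have "d \<le> D v + (dist_int (v $ 1 - torus_rep q $ 1) + dist_int (v $ 2 - torus_rep q $ 2))"
        unfolding d_def D_def by (simp add: add_ac)
      then have "D v \<ge> 2 / 3 * d"
        using v[rule_format, of 1] v[rule_format, of 2] by linarith
      then have "3 * D v / d \<ge> 2" using d by (simp add: field_simps)
      then show ?thesis by (simp add: hk k_def)
    qed
  qed
qed

section \<open>Null sets of the torus\<close>

text \<open>The function \<open>frac\<close> jumps at the integers, but its sublevel sets are closed
  arcs with centre and radius \<open>a / 2\<close>. In terms of the continuous
  \<open>dist_int\<close> they are visibly closed.\<close>

lemma frac_le_iff_dist_int: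
  assumes "0 \<le> a" "a < 1"
  shows "frac t \<le> a \<longleftrightarrow> dist_int (t - a / 2) \<le> a / 2"
proof
  assume "frac t \<le> a"
  moreover have "\<bar>t - a / 2 - of_int \<lfloor>t\<rfloor>\<bar> = \<bar>frac t - a / 2\<bar>" by (simp add: frac_def)
  ultimately show "dist_int (t - a / 2) \<le> a / 2"
    using dist_int_le[of "t - a / 2" "\<lfloor>t\<rfloor>"] frac_ge_0[of t] by linarith
next
  assume d: "dist_int (t - a / 2) \<le> a / 2"
  obtain n where "dist_int (t - a / 2) = \<bar>t - a / 2 - of_int n\<bar>" by (rule dist_int_obtain)
  with d have n: "of_int n \<le> t" "t \<le> of_int n + a" by linarith+
  then have "\<lfloor>t\<rfloor> = n" using assms by (simp add: floor_eq_iff)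
  then show "frac t \<le> a" using n by (simp add: frac_def)
qed

lemma frac_torus_rep_measurable [measurable]: "(\<lambda>x. frac (torus_rep x $ i)) \<in> borel_measurable borel"
proof (rule borel_measurableI_le)
  fix a :: real
  have eq: "frac (torus_rep (to_torus v) $ i) = frac (v $ i)" for v
  proof -
    have "to_torus (torus_rep (to_torus v)) = to_torus v" by simp
    then have "torus_rep (to_torus v) $ i - v $ i \<in> \<int>" unfolding to_torus_eq_iff by blast
    then obtain n where "torus_rep (to_torus v) $ i - v $ i = of_int n" by (auto elim!: Ints_cases)
    then have "torus_rep (to_torus v) $ i = v $ i + of_int n" by simp
    then show ?thesis by simp
  qed
  consider "a < 0" | "a \<ge> 1" | "0 \<le> a" "a < 1" by linarith
  then have "closed {x. frac (torus_rep x $ i) \<le> a}"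
  proof cases
    case 1
    then have "{x. frac (torus_rep x $ i) \<le> a} = {}" using frac_ge_0 by (auto simp: not_le intro: less_le_trans)
    then show ?thesis by simp
  next
    case 2
    have "frac (torus_rep x $ i) \<le> a" for x using frac_lt_1[of "torus_rep x $ i"] 2 by linarith
    then have "{x. frac (torus_rep x $ i) \<le> a} = UNIV" by blast
    then show ?thesis by simp
  next
    case 3
    have "to_torus -` (- {x. frac (torus_rep x $ i) \<le> a}) = - {v. frac (v $ i) \<le> a}"
      by (simp add: set_eq_iff eq)
    also have "\<dots> = - {v. dist_int (v $ i - a / 2) \<le> a / 2}" unfolding frac_le_iff_dist_int[OF 3] ..
    finally have "to_torus -` (- {x. frac (torus_rep x $ i) \<le> a}) = - {v. dist_int (v $ i - a / 2) \<le> a / 2}" .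
    moreover have "closed {v :: real^2. dist_int (v $ i - a / 2) \<le> a / 2}"
      by (intro closed_Collect_le continuous_on_compose2[OF continuous_on_dist_int[of UNIV]] continuous_intros) auto
    ultimately show ?thesis by (simp add: closed_def open_torus_def)
  qed
  then show "{x \<in> space borel. frac (torus_rep x $ i) \<le> a} \<in> sets borel" by simp
qed

lemma vector2_measurable [measurable]:
  "(\<lambda>(a, b). vector [a, b] :: real^2) \<in> borel_measurable (lborel \<Otimes>\<^sub>M lborel)"
proof -
  have "(\<lambda>z. vector [fst z, snd z] :: real^2) \<in> borel_measurable borel"
    by (rule borel_measurable_continuous_onI[OF continuous_on_vector2])
  then show ?thesis by (simp add: case_prod_unfold lborel_prod)
qed

lemma lborel_real2_eq: "(lborel :: (real^2) measure) = distr (lborel \<Otimes>\<^sub>M lborel) borel (\<lambda>(a, b). vector [a, b])"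
proof (rule lborel_eqI)
  fix l u :: "real^2" assume le: "\<And>b. b \<in> Basis \<Longrightarrow> l \<bullet> b \<le> u \<bullet> b"
  have le': "l $ i \<le> u $ i" for i using le[of "axis i 1"] by (auto simp: cart_eq_inner_axis)
  have "emeasure (distr (lborel \<Otimes>\<^sub>M lborel) borel (\<lambda>(a, b). vector [a, b])) (box l u)
      = emeasure (lborel \<Otimes>\<^sub>M lborel) ((\<lambda>(a, b). vector [a, b]) -` box l u \<inter> space (lborel \<Otimes>\<^sub>M lborel))"
    by (rule emeasure_distr) auto
  also have "(\<lambda>(a, b). vector [a, b] :: real^2) -` box l u \<inter> space (lborel \<Otimes>\<^sub>M lborel)
      = {l $ 1<..<u $ 1} \<times> {l $ 2<..<u $ 2}"
    by (auto simp: mem_box_cart forall_2 space_pair_measure)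
  also have "emeasure (lborel \<Otimes>\<^sub>M lborel) \<dots> = ennreal (u $ 1 - l $ 1) * ennreal (u $ 2 - l $ 2)"
    using le' by (subst lborel.emeasure_pair_measure_Times) auto
  also have "\<dots> = ennreal (\<Prod>b\<in>Basis. (u - l) \<bullet> b)"
  proof -
    have B: "(Basis :: (real^2) set) = {axis 1 1, axis 2 1}"
      by (auto simp: Basis_vec_def UNIV_2)
    have "axis 1 (1::real) \<noteq> (axis 2 1 :: real^2)" by (simp add: axis_eq_axis)
    then have "(\<Prod>b\<in>Basis. (u - l) \<bullet> b) = (u $ 1 - l $ 1) * (u $ 2 - l $ 2)"
      unfolding B by (simp add: cart_eq_inner_axis[symmetric])
    then show ?thesis using le' by (simp add: ennreal_mult)
  qed
  finally show "emeasure (distr (lborel \<Otimes>\<^sub>M lborel) borel (\<lambda>(a, b). vector [a, b])) (box l u) = ennreal (\<Prod>b\<in>Basis. (u - l) \<bullet> b)" .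
qed simp

text \<open>Fubini over vertical lines. The auxiliary \<open>Good\<close> carries the measurability,
  so nothing has to be known about that of \<open>P\<close>, which will be a statement about sets of
  limit measures.\<close>

lemma AE_haar_torusI:
  assumes meas: "Measurable.pred (borel \<Otimes>\<^sub>M borel) (\<lambda>(a, b). Good a b)"
    and ae: "\<And>a. 0 \<le> a \<Longrightarrow> a < 1 \<Longrightarrow> AE b in lborel. Good a b"
    and imp: "\<And>a b. 0 \<le> a \<Longrightarrow> a < 1 \<Longrightarrow> 0 \<le> b \<Longrightarrow> b < 1 \<Longrightarrow> Good a b \<Longrightarrow> P (to_torus (vector [a, b]))"
  shows "AE x in haar_torus. P x"
proof -
  define Q where "Q x = Good (frac (torus_rep x $ 1)) (frac (torus_rep x $ 2))" for x
  define Box where "Box = {v :: real^2. \<forall>i. 0 \<le> v $ i \<and> v $ i < 1}"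
  have Box_sets: "Box \<in> sets lborel" unfolding Box_def forall_2 by measurable
  have nth_meas: "(\<lambda>v :: real^2. v $ i) \<in> borel_measurable borel" for i
    by (intro borel_measurable_continuous_onI continuous_intros)
  have Q_meas: "Measurable.pred borel Q"
  proof -
    have "(\<lambda>x. (frac (torus_rep x $ 1), frac (torus_rep x $ 2))) \<in> measurable borel (borel \<Otimes>\<^sub>M borel)" by measurable
    from measurable_compose[OF this meas] show ?thesis by (simp add: Q_def[abs_def])
  qed
  have Q_box: "Q (to_torus v) = Good (v $ 1) (v $ 2)" if "v \<in> Box" for v
  proof -
    have "frac (torus_rep (to_torus v) $ i) = v $ i" for i
    proof -
      have "to_torus (torus_rep (to_torus v)) = to_torus v" by simp
      then have "v $ i - torus_rep (to_torus v) $ i \<in> \<int>" unfolding to_torus_eq_iff by (metis Ints_minus minus_diff_eq)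
      then have "torus_rep (to_torus v) $ i - v $ i \<in> \<int>" by (metis Ints_minus minus_diff_eq)
      then show ?thesis using that by (simp add: frac_unique_iff Box_def)
    qed
    then show ?thesis by (simp add: Q_def)
  qed
  have "AE z in lborel \<Otimes>\<^sub>M lborel. case z of (a, b) \<Rightarrow> vector [a, b] \<in> Box \<longrightarrow> Good a b"
  proof (rule lborel_pair.AE_pair_measure)
    have m1: "{z \<in> space (lborel \<Otimes>\<^sub>M lborel). case z of (a, b) \<Rightarrow> Good a b} \<in> sets (lborel \<Otimes>\<^sub>M lborel)"
    proof -
      have "Measurable.pred (lborel \<Otimes>\<^sub>M lborel) (\<lambda>(a, b). Good a b)"
        using meas by (simp cong: measurable_cong_sets)
      then show ?thesis by (rule predE)
    qed
    have m2: "{z \<in> space (lborel \<Otimes>\<^sub>M lborel). case z of (a, b) \<Rightarrow> vector [a, b] \<in> Box} \<in> sets (lborel \<Otimes>\<^sub>M lborel)"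
      using measurable_sets[OF vector2_measurable, of Box] Box_sets
      by (simp add: vimage_def case_prod_unfold Int_def conj_commute)
    have "{z \<in> space (lborel \<Otimes>\<^sub>M lborel). case z of (a, b) \<Rightarrow> vector [a, b] \<in> Box \<longrightarrow> Good a b}
        = (space (lborel \<Otimes>\<^sub>M lborel) - {z \<in> space (lborel \<Otimes>\<^sub>M lborel). case z of (a, b) \<Rightarrow> vector [a, b] \<in> Box})
          \<union> {z \<in> space (lborel \<Otimes>\<^sub>M lborel). case z of (a, b) \<Rightarrow> Good a b}"
      by (auto simp: case_prod_unfold)
    also have "\<dots> \<in> sets (lborel \<Otimes>\<^sub>M lborel)" using m1 m2 by (intro sets.Un sets.Diff sets.top)
    finally show "{z \<in> space (lborel \<Otimes>\<^sub>M lborel). case z of (a, b) \<Rightarrow> vector [a, b] \<in> Box \<longrightarrow> Good a b}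
        \<in> sets (lborel \<Otimes>\<^sub>M lborel)" .
    have "AE b in lborel. vector [a, b] \<in> Box \<longrightarrow> Good a b" for a
    proof (cases "0 \<le> a \<and> a < 1")
      case True
      from ae[of a] True show ?thesis by (auto elim: eventually_mono)
    qed (auto simp: Box_def forall_2)
    then show "AE a in lborel. AE b in lborel. case (a, b) of (a, b) \<Rightarrow> vector [a, b] \<in> Box \<longrightarrow> Good a b" by simp
  qed
  define g where "g = (\<lambda>(a, b). vector [a, b] :: real^2)"
  from \<open>AE z in lborel \<Otimes>\<^sub>M lborel. case z of (a, b) \<Rightarrow> vector [a, b] \<in> Box \<longrightarrow> Good a b\<close>
  have pair: "AE z in lborel \<Otimes>\<^sub>M lborel. g z \<in> Box \<longrightarrow> Good (g z $ 1) (g z $ 2)"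
    by (auto elim!: eventually_mono simp: g_def case_prod_unfold)
  have "AE v in lborel. v \<in> Box \<longrightarrow> Good (v $ 1) (v $ 2)"
    unfolding lborel_real2_eq g_def[symmetric]
  proof (subst AE_distr_iff)
    have "(\<lambda>v :: real^2. (v $ 1, v $ 2)) \<in> measurable borel (borel \<Otimes>\<^sub>M borel)"
      using nth_meas by measurable
    from measurable_compose[OF this meas]
    have "{v \<in> space (borel :: (real^2) measure). Good (v $ 1) (v $ 2)} \<in> sets borel" by (intro predE) simp
    moreover have "{v \<in> space borel. v \<in> Box \<longrightarrow> Good (v $ 1) (v $ 2)} = (- Box) \<union> {v \<in> space borel. Good (v $ 1) (v $ 2)}" by auto
    ultimately show "{v \<in> space borel. v \<in> Box \<longrightarrow> Good (v $ 1) (v $ 2)} \<in> sets borel" using Box_sets by auto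
    show "g \<in> measurable (lborel \<Otimes>\<^sub>M lborel) borel" unfolding g_def by (rule vector2_measurable)
  qed (rule pair)
  then have "AE v in restrict_space lborel Box. Good (v $ 1) (v $ 2)"
    using Box_sets by (subst AE_restrict_space_iff) auto
  then have "AE v in restrict_space lborel Box. Q (to_torus v)"
  proof (rule AE_mp, intro AE_I2 impI)
    fix v assume "v \<in> space (restrict_space lborel Box)" "Good (v $ 1) (v $ 2)"
    then show "Q (to_torus v)" using Q_box by (simp add: space_restrict_space)
  qed
  moreover have "to_torus \<in> measurable (restrict_space lborel Box) borel"
    by (rule measurable_restrict_space1) (simp add: borel_measurable_continuous_onI continuous_to_torus)
  ultimately have "AE x in haar_torus. Q x"
    unfolding haar_torus_def Box_def[symmetric] using Q_meas by (subst AE_distr_iff) (auto intro: predE)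
  then show ?thesis
  proof (rule AE_mp, intro AE_I2 impI)
    fix x assume "Q x"
    then have "P (to_torus (vector [frac (torus_rep x $ 1), frac (torus_rep x $ 2)]))"
      unfolding Q_def by (intro imp) (auto simp: frac_lt_1)
    moreover have "vector [frac (torus_rep x $ 1), frac (torus_rep x $ 2)] = frac_vec (torus_rep x)"
      by (simp add: vec_eq_iff forall_2 frac_vec_def)
    ultimately show "P x" by simp
  qed
qed

section \<open>Orbits of the stopped flow\<close>

lemma singularity_frac:
  assumes "singularity \<alpha> p1 p2 A B C G"
  shows "singularity \<alpha> (frac p1) (frac p2) A B C G"
proof -
  interpret singularity \<alpha> p1 p2 A B C G by (rule assms)
  have int: "x - frac y \<in> \<int> \<longleftrightarrow> x - y \<in> \<int>" for x y :: real
  proof -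
    have "x - frac y = (x - y) + of_int \<lfloor>y\<rfloor>" by (simp add: frac_def)
    then show ?thesis by (metis Ints_add Ints_diff Ints_of_int add_diff_cancel_right')
  qed
  have shift: "G (frac p1 + s) (frac p2 + w + z) = G (p1 + s) (p2 + w + z)" for s w z
    using periodic[of "frac p1 + s" "\<lfloor>p1\<rfloor>" "frac p2 + w + z" "\<lfloor>p2\<rfloor>"] by (simp add: frac_def algebra_simps)
  show ?thesis
    by unfold_locales (use periodic nonneg cont A_pos disc_pos asymptotic in \<open>auto simp: int shift\<close>)
qed

locale stopped_flow =
  fixes \<alpha> :: real and p q :: torus and \<phi> :: "torus \<Rightarrow> real" and \<Phi> :: "real \<Rightarrow> torus \<Rightarrow> torus"
    and h :: "torus \<Rightarrow> real" and \<epsilon> :: real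
  assumes flow: "reparametrized_linear_flow \<alpha> p q \<phi> \<Phi>"
    and h: "continuous_on UNIV h" "\<And>x. 0 \<le> h x" "\<And>x. h x \<le> 1" "\<epsilon> > 0"
    and h1: "\<And>v. (\<forall>i. dist_int (v $ i - torus_rep p $ i) < \<epsilon>) \<Longrightarrow> h (to_torus v) = 1"
    and h0: "\<And>v. (\<forall>i. dist_int (v $ i - torus_rep q $ i) < \<epsilon>) \<Longrightarrow> h (to_torus v) = 0"
begin

lemma C3: "C_times_differentiable 3 (\<lambda>v. \<phi> (to_torus v))"
  and pq: "p \<noteq> q" and gen: "generates_flow (\<lambda>x. \<phi> x *\<^sub>R direction \<alpha>) \<Phi>"
  and hess: "positive_definite (hessian_torus \<phi> p)" "positive_definite (hessian_torus \<phi> q)"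
  using flow by (simp_all add: reparametrized_linear_flow_def)

lemma \<phi>_zero_iff: "\<phi> x = 0 \<longleftrightarrow> x = p \<or> x = q"
  using flow unfolding reparametrized_linear_flow_def by (metis less_irrefl)

lemma \<phi>_ge_0: "0 \<le> \<phi> x"
  using flow unfolding reparametrized_linear_flow_def by (metis less_imp_le order_refl)

lemma \<phi>_continuous: "continuous_on UNIV \<phi>"
  using C3_derivatives(3)[OF C3] by (simp add: continuous_on_torus_iff)

sublocale two_zeros \<phi> h p q
proof
  have "dist_int (v $ i - v $ i) < \<epsilon>" for v :: "real^2" and i using h(4) by (simp add: dist_int_def)
  then have "h (to_torus (torus_rep p)) = 1" "h (to_torus (torus_rep q)) = 0" by (blast intro: h1 h0)+
  then show "h p = 1" "h q = 0" by simp_all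
qed (use \<phi>_continuous \<phi>_ge_0 \<phi>_zero_iff h in auto)

text \<open>\<^const>\<open>torus_rep\<close> picks an arbitrary representative, hence the fractional parts.\<close>

abbreviation "p1 \<equiv> frac (torus_rep p $ 1)"
abbreviation "p2 \<equiv> frac (torus_rep p $ 2)"
abbreviation "q1 \<equiv> frac (torus_rep q $ 1)"
abbreviation "q2 \<equiv> frac (torus_rep q $ 2)"
abbreviation "Gp \<equiv> \<lambda>a b. h (to_torus (vector [a, b])) / \<phi> (to_torus (vector [a, b]))"
abbreviation "Gq \<equiv> \<lambda>a b. (1 - h (to_torus (vector [a, b]))) / \<phi> (to_torus (vector [a, b]))"

lemma singularity_p:
  obtains A B C where "singularity \<alpha> p1 p2 A B C Gp" "A * C - B\<^sup>2 = det (hessian_torus \<phi> p)"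
proof -
  obtain A B C where s: "singularity \<alpha> (torus_rep p $ 1) (torus_rep p $ 2) A B C Gp"
    and d: "A * C - B\<^sup>2 = det (hessian_torus \<phi> p)"
    by (rule singularity_at_stopping_point[OF C3 \<phi>_ge_0 \<phi>_zero_iff hess(1) h(1,2,4)]) (erule h1, erule h0, blast)
  from that[OF singularity_frac[OF s] d] show thesis .
qed

lemma singularity_q:
  obtains A B C where "singularity \<alpha> q1 q2 A B C Gq" "A * C - B\<^sup>2 = det (hessian_torus \<phi> q)"
proof -
  have c: "continuous_on UNIV (\<lambda>x. 1 - h x)" by (intro continuous_intros h(1))
  have n: "0 \<le> 1 - h x" for x using h(3)[of x] by simp
  have z: "\<phi> x = 0 \<longleftrightarrow> x = q \<or> x = p" for x using \<phi>_zero_iff by auto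
  have one: "1 - h (to_torus v) = 1" if "\<forall>i. dist_int (v $ i - torus_rep q $ i) < \<epsilon>" for v using h0[OF that] by simp
  have zero: "1 - h (to_torus v) = 0" if "\<forall>i. dist_int (v $ i - torus_rep p $ i) < \<epsilon>" for v using h1[OF that] by simp
  obtain A B C where s: "singularity \<alpha> (torus_rep q $ 1) (torus_rep q $ 2) A B C Gq"
    and d: "A * C - B\<^sup>2 = det (hessian_torus \<phi> q)"
    by (rule singularity_at_stopping_point[OF C3 \<phi>_ge_0 z hess(2) c n h(4)]) (erule one, erule zero, blast)
  from that[OF singularity_frac[OF s] d] show thesis .
qed

end

section \<open>From passage times to time averages along an orbit\<close>

locale stopped_line =
  stopped_flow \<alpha> p q \<phi> \<Phi> h \<epsilon> +
  two_lines \<alpha> "frac (torus_rep p $ 1)" "frac (torus_rep p $ 2)" Ap Bp Cp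
    "\<lambda>a b. h (to_torus (vector [a, b])) / \<phi> (to_torus (vector [a, b]))"
    "frac (torus_rep q $ 1)" "frac (torus_rep q $ 2)" Aq Bq Cq
    "\<lambda>a b. (1 - h (to_torus (vector [a, b]))) / \<phi> (to_torus (vector [a, b]))" Q x1 x2
  for \<alpha> p q \<phi> \<Phi> h \<epsilon> Ap Bp Cp Aq Bq Cq Q x1 x2
begin

abbreviation "v \<equiv> vector [x1, x2] :: real^2"
abbreviation "x \<equiv> to_torus v"

lemma on_line: "v + l *\<^sub>R direction \<alpha> = vector [x1 + l, x2 + \<alpha> * l]"
  by (simp add: vec_eq_iff forall_2 mult.commute)

lemma positive_on_line: "0 < \<phi> (to_torus (v + l *\<^sub>R direction \<alpha>))"
proof -
  have "to_torus (v + l *\<^sub>R direction \<alpha>) \<noteq> p"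
  proof
    assume "to_torus (v + l *\<^sub>R direction \<alpha>) = p"
    then have "to_torus (vector [x1 + l, x2 + \<alpha> * l]) = to_torus (frac_vec (torus_rep p))" by (simp add: on_line)
    then have *: "x1 + l - p1 \<in> \<int>" "x2 + \<alpha> * l - p2 \<in> \<int>"
      by (simp_all add: to_torus_eq_iff forall_2 frac_vec_def)
    then obtain k n where k: "x1 + l - p1 = of_int k" and n: "x2 + \<alpha> * l - p2 = of_int n" by (auto elim!: Ints_cases)
    have l: "l = of_int k - x1 + p1" using k by simp
    have "sp.y + of_int k * \<alpha> = of_int n" using n unfolding l sp.offset_def by (simp add: algebra_simps)
    then show False using sp.off unfolding sp.off_orbit_def by (metis Ints_of_int)
  qed
  moreover have "to_torus (v + l *\<^sub>R direction \<alpha>) \<noteq> q"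
  proof
    assume "to_torus (v + l *\<^sub>R direction \<alpha>) = q"
    then have "to_torus (vector [x1 + l, x2 + \<alpha> * l]) = to_torus (frac_vec (torus_rep q))" by (simp add: on_line)
    then have *: "x1 + l - q1 \<in> \<int>" "x2 + \<alpha> * l - q2 \<in> \<int>"
      by (simp_all add: to_torus_eq_iff forall_2 frac_vec_def)
    then obtain k n where k: "x1 + l - q1 = of_int k" and n: "x2 + \<alpha> * l - q2 = of_int n" by (auto elim!: Ints_cases)
    have l: "l = of_int k - x1 + q1" using k by simp
    have "sq.y + of_int k * \<alpha> = of_int n" using n unfolding l sq.offset_def by (simp add: algebra_simps)
    then show False using sq.off unfolding sq.off_orbit_def by (metis Ints_of_int)
  qed
  ultimately have "\<phi> (to_torus (v + l *\<^sub>R direction \<alpha>)) \<noteq> 0" by (simp add: \<phi>_zero_iff)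
  then show ?thesis using \<phi>_ge_0[of "to_torus (v + l *\<^sub>R direction \<alpha>)"] by linarith
qed

text \<open>The two densities have numerators \<open>h\<close> and \<open>1 - h\<close> and add up
  to \<open>1 / \<phi>\<close>, so the sum of the two passage times is the actual travel
  time.\<close>

lemma T_eq: "T R = integral {0..R} (\<lambda>l. 1 / \<phi> (to_torus (v + l *\<^sub>R direction \<alpha>)))"
proof -
  have "T R = integral {0..R} (\<lambda>l. sp.along x1 x2 l + sq.along x1 x2 l)"
    unfolding T_def sp.time_def sq.time_def
    by (rule Henstock_Kurzweil_Integration.integral_add[symmetric])
       (intro sp.integrable_along sq.integrable_along sp.off sq.off)+
  then show ?thesis by (simp add: on_line add_divide_distrib[symmetric])
qed

lemmas time_change = flow_time_change[OF gen \<phi>_continuous \<phi>_ge_0 positive_on_line, folded T_eq]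

lemma orbit_cont: "continuous_on UNIV (\<lambda>s. \<Phi> s x)"
  by (rule time_change(1))

lemma time_average_h: "time_average \<Phi> x h (T R) = sp.time R / T R" if "0 \<le> R"
  using time_change(4)[OF that h(1)] by (simp add: time_average_def sp.time_def on_line)

lemma time_average_\<phi>: "time_average \<Phi> x \<phi> (T R) = R / T R" if "0 \<le> R"
proof -
  have "\<phi> (to_torus (v + l *\<^sub>R direction \<alpha>)) / \<phi> (to_torus (v + l *\<^sub>R direction \<alpha>)) = 1" for l
    using positive_on_line[of l] by simp
  then show ?thesis using time_change(4)[OF that \<phi>_continuous] that by (simp add: time_average_def)
qed

text \<open>At travel time \<open>T R\<close> the average of \<open>\<phi>\<close> is
  \<open>R / T R\<close>, the mean speed, and the travel time is superlinear in
  \<open>R\<close>.\<close>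

lemma slow: "(time_average \<Phi> x \<phi> \<longlongrightarrow> 0) at_top"
proof (rule tendstoI)
  fix e :: real assume e: "e > 0"
  obtain R0 where R0: "R0 > 0" "\<And>R. R \<ge> R0 \<Longrightarrow> R + 1 \<le> e * sp.time R"
    using sp.time_superlinear[OF e] by blast
  have "\<forall>\<^sub>F t in at_top. t > max 1 (R0 / e)" by (rule eventually_gt_at_top)
  then show "\<forall>\<^sub>F t in at_top. dist (time_average \<Phi> x \<phi> t) 0 < e"
  proof eventually_elim
    case (elim t)
    then have t: "t > 1" "R0 < e * t" using e by (auto simp: field_simps)
    then obtain R where R: "R \<ge> 0" "T R = t" using time_change(3)[of t] by auto
    have "R < e * t"
    proof (cases "R \<ge> R0")
      case True
      have "e * sp.time R \<le> e * T R" using T_ge(1)[of R] e by (intro mult_left_mono) auto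
      then show ?thesis using R0(2)[OF True] R by simp
    qed (use t in simp)
    then have "R / t < e" using t by (simp add: field_simps)
    then show ?case using time_average_\<phi>[OF R(1)] R t by (simp add: dist_real_def)
  qed
qed

definition accumulates :: "real \<Rightarrow> bool" where
  "accumulates s \<longleftrightarrow> (\<forall>\<epsilon>>0. \<forall>B. \<exists>t\<ge>B. \<bar>time_average \<Phi> x h t - s\<bar> < \<epsilon>)"

lemma mix_in_p_omega_iff:
  assumes "0 \<le> s" "s \<le> 1"
  shows "mix s \<in> p_omega \<Phi> x \<longleftrightarrow> accumulates s"
proof
  assume "mix s \<in> p_omega \<Phi> x"
  then obtain s' where s': "0 \<le> s'" "s' \<le> 1" "mix s = mix s'"
    "\<And>\<epsilon> B. \<epsilon> > 0 \<Longrightarrow> \<exists>t\<ge>B. \<bar>time_average \<Phi> x h t - s'\<bar> < \<epsilon>"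
    by (rule p_omegaD[OF orbit_cont slow]) blast
  have "s = s'" by (rule mix_inject[OF assms s'(1,2,3)])
  then show "accumulates s" using s'(4) by (simp add: accumulates_def)
next
  assume "accumulates s"
  then show "mix s \<in> p_omega \<Phi> x"
    by (intro in_p_omega[OF orbit_cont slow assms]) (auto simp: accumulates_def)
qed

lemma p_omega_eq: "p_omega \<Phi> x = {mix s | s. 0 \<le> s \<and> s \<le> 1 \<and> accumulates s}"
proof (intro set_eqI iffI)
  fix \<mu> assume \<mu>: "\<mu> \<in> p_omega \<Phi> x"
  then obtain s where "0 \<le> s" "s \<le> 1" "\<mu> = mix s" by (rule p_omegaD[OF orbit_cont slow]) blast
  then show "\<mu> \<in> {mix s | s. 0 \<le> s \<and> s \<le> 1 \<and> accumulates s}" using \<mu> mix_in_p_omega_iff by blast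
qed (use mix_in_p_omega_iff in blast)

lemma accumulatesI:
  assumes "\<And>\<epsilon> B. \<epsilon> > 0 \<Longrightarrow> B \<ge> 1 \<Longrightarrow> \<exists>R\<ge>0. B \<le> T R \<and> \<bar>sp.time R - s * T R\<bar> \<le> \<epsilon> * T R"
  shows "accumulates s"
  unfolding accumulates_def
proof (intro allI impI)
  fix \<epsilon> B :: real assume "\<epsilon> > 0"
  then obtain R where R: "R \<ge> 0" "max B 1 \<le> T R" "\<bar>sp.time R - s * T R\<bar> \<le> \<epsilon> / 2 * T R"
    using assms[of "\<epsilon> / 2" "max B 1"] by auto
  have "sp.time R / T R - s = (sp.time R - s * T R) / T R" using R(2) by (simp add: field_simps)
  then have "\<bar>sp.time R / T R - s\<bar> = \<bar>sp.time R - s * T R\<bar> / T R" using R(2) by (simp add: abs_divide)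
  also have "\<dots> \<le> \<epsilon> / 2" using R(2,3) by (subst pos_divide_le_eq) auto
  finally have "\<bar>time_average \<Phi> x h (T R) - s\<bar> < \<epsilon>" using \<open>\<epsilon> > 0\<close> by (simp add: time_average_h[OF R(1)])
  then show "\<exists>t\<ge>B. \<bar>time_average \<Phi> x h t - s\<bar> < \<epsilon>" using R(2) by (intro exI[of _ "T R"]) auto
qed

lemma accumulates_1I:
  assumes "\<And>\<epsilon> B. \<epsilon> > 0 \<Longrightarrow> \<exists>R\<ge>0. B \<le> T R \<and> sq.time R \<le> \<epsilon> * T R"
  shows "accumulates 1"
proof (rule accumulatesI)
  fix \<epsilon> B :: real assume "\<epsilon> > 0"
  then obtain R where R: "R \<ge> 0" "B \<le> T R" "sq.time R \<le> \<epsilon> * T R" using assms by blast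
  have "\<bar>sp.time R - 1 * T R\<bar> = sq.time R" using sq.time_nonneg[of R] by (simp add: T_def)
  with R show "\<exists>R\<ge>0. B \<le> T R \<and> \<bar>sp.time R - 1 * T R\<bar> \<le> \<epsilon> * T R" by auto
qed

lemma accumulates_0I:
  assumes "\<And>\<epsilon> B. \<epsilon> > 0 \<Longrightarrow> \<exists>R\<ge>0. B \<le> T R \<and> sp.time R \<le> \<epsilon> * T R"
  shows "accumulates 0"
  using assms sp.time_nonneg by (intro accumulatesI) (auto simp: abs_of_nonneg)

text \<open>At the times of \<open>mixed_share\<close> the average of \<open>h\<close> stays in the
  compact interval \<open>{c..1 - c}\<close>, so it has a cluster value there.\<close>

lemma accumulates_interior:
  assumes far: "\<And>i0. \<exists>i\<ge>i0. sp.far sp.y i \<and> sp.far sq.y i"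
  obtains s where "0 < s" "s < 1" "accumulates s"
proof -
  obtain c where c: "c > 0" "\<And>B. \<exists>R\<ge>0. B \<le> T R \<and> c * T R \<le> sp.time R \<and> c * T R \<le> sq.time R"
    using mixed_share[OF far] by blast
  have "\<forall>n. \<exists>t\<ge>real n. time_average \<Phi> x h t \<in> {c..1 - c}"
  proof
    fix n
    obtain R where R: "R \<ge> 0" "real n + 1 \<le> T R" "c * T R \<le> sp.time R" "c * T R \<le> sq.time R" using c(2) by blast
    have "T R > 0" using R(2) by linarith
    moreover have "sp.time R \<le> (1 - c) * T R" using R(4) by (simp add: T_def algebra_simps)
    ultimately have "sp.time R / T R \<in> {c..1 - c}" using R(3) by (simp add: field_simps)
    then show "\<exists>t\<ge>real n. time_average \<Phi> x h t \<in> {c..1 - c}"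
      using R(2) time_average_h[OF R(1)] by (intro exI[of _ "T R"]) auto
  qed
  then obtain t where t: "\<And>n. t n \<ge> real n" "\<And>n. time_average \<Phi> x h (t n) \<in> {c..1 - c}" by metis
  obtain s r where s: "s \<in> {c..1 - c}" and r: "strict_mono r" "((\<lambda>n. time_average \<Phi> x h (t n)) \<circ> r) \<longlonglongrightarrow> s"
    using compactE[OF compact_imp_seq_compact[OF compact_Icc, unfolded seq_compact_def, rule_format, of "\<lambda>n. time_average \<Phi> x h (t n)" c "1 - c", THEN bexE]] t(2)
    by (metis (no_types, lifting) compact_Icc compact_def)
  have "accumulates s"
    unfolding accumulates_def
  proof (intro allI impI)
    fix e B :: real assume "e > 0"
    then have "\<forall>\<^sub>F n in sequentially. dist (((\<lambda>n. time_average \<Phi> x h (t n)) \<circ> r) n) s < e"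
      using r(2) by (intro tendstoD)
    moreover have "\<forall>\<^sub>F n in sequentially. B \<le> real n"
      using filterlim_real_sequentially unfolding filterlim_at_top by blast
    ultimately have "\<forall>\<^sub>F n in sequentially. dist (time_average \<Phi> x h (t (r n))) s < e \<and> B \<le> real n"
      by eventually_elim simp
    then obtain n where n: "dist (time_average \<Phi> x h (t (r n))) s < e" "B \<le> real n"
      unfolding eventually_sequentially by blast
    have "real n \<le> real (r n)" using seq_suble[OF r(1)] by simp
    then have "t (r n) \<ge> B" using t(1)[of "r n"] n(2) by linarith
    with n(1) show "\<exists>t\<ge>B. \<bar>time_average \<Phi> x h t - s\<bar> < e" by (auto simp: dist_real_def)
  qed
  moreover have "0 < s" "s < 1" using s c(1) by auto
  ultimately show thesis using that by blast
qed

text \<open>The average of \<open>h\<close> is continuous in time, so between visits near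
  \<open>a\<close> and near \<open>b\<close> it passes every intermediate value.\<close>

lemma accumulates_between:
  assumes "accumulates a" "accumulates b" "a \<le> s" "s \<le> b"
  shows "accumulates s"
  unfolding accumulates_def
proof (intro allI impI)
  fix e B :: real assume e: "e > 0"
  obtain t1 where t1: "t1 \<ge> max B 1" "\<bar>time_average \<Phi> x h t1 - a\<bar> < e / 2"
    using assms(1) e unfolding accumulates_def by (meson half_gt_zero)
  obtain t2 where t2: "t2 \<ge> max B 1" "\<bar>time_average \<Phi> x h t2 - b\<bar> < e / 2"
    using assms(2) e unfolding accumulates_def by (meson half_gt_zero)
  let ?m = "max t1 t2"
  have "continuous_on {max B 1..?m} (time_average \<Phi> x h)"
    unfolding time_average_def
  proof (intro continuous_intros)
    have "(\<lambda>s. h (\<Phi> s x)) integrable_on {0..?m}" by (rule integrable_along_orbit[OF orbit_cont slow h(1)])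
    then have "continuous_on {0..?m} (\<lambda>t. integral {0..t} (\<lambda>s. h (\<Phi> s x)))" by (rule indefinite_integral_continuous_1)
    then show "continuous_on {max B 1..?m} (\<lambda>t. integral {0..t} (\<lambda>s. h (\<Phi> s x)))"
      by (rule continuous_on_subset) auto
  qed auto
  then have conn: "connected (time_average \<Phi> x h ` {max B 1..?m})"
    by (rule connected_continuous_image) simp
  have mem: "time_average \<Phi> x h t1 \<in> time_average \<Phi> x h ` {max B 1..?m}" "time_average \<Phi> x h t2 \<in> time_average \<Phi> x h ` {max B 1..?m}"
    using t1(1) t2(1) by auto
  show "\<exists>t\<ge>B. \<bar>time_average \<Phi> x h t - s\<bar> < e"
  proof (cases "\<bar>time_average \<Phi> x h t1 - s\<bar> < e \<or> \<bar>time_average \<Phi> x h t2 - s\<bar> < e")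
    case True
    then show ?thesis using t1(1) t2(1) by auto
  next
    case False
    then have "time_average \<Phi> x h t1 \<le> s" "s \<le> time_average \<Phi> x h t2"
      using t1(2) t2(2) assms(3,4) e by linarith+
    then have "s \<in> time_average \<Phi> x h ` {max B 1..?m}"
      using connectedD_interval[OF conn mem] by blast
    then show ?thesis using e by auto
  qed
qed

lemma accumulates_ge:
  assumes "\<And>\<epsilon>. \<epsilon> > 0 \<Longrightarrow> \<exists>R0. \<forall>R\<ge>R0. (w - \<epsilon>) * T R \<le> sp.time R" and "accumulates s"
  shows "w \<le> s"
proof (rule field_le_epsilon)
  fix e :: real assume e: "e > 0"
  obtain R0 where R0: "\<And>R. R \<ge> R0 \<Longrightarrow> (w - e / 2) * T R \<le> sp.time R" using assms(1)[of "e / 2"] e by auto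
  obtain t where t: "t \<ge> max 1 (T (max R0 0) + 1)" "\<bar>time_average \<Phi> x h t - s\<bar> < e / 2"
    using assms(2) e unfolding accumulates_def by (meson half_gt_zero)
  then obtain R where R: "R \<ge> 0" "T R = t" using time_change(3)[of t] by auto
  have "\<not> R \<le> max R0 0"
  proof
    assume "R \<le> max R0 0"
    then have "T R \<le> T (max R0 0)" unfolding T_def by (intro add_mono sp.time_mono sq.time_mono)
    then show False using t(1) R(2) by simp
  qed
  then have "(w - e / 2) * T R \<le> sp.time R" by (intro R0) auto
  then have "w - e / 2 \<le> sp.time R / T R" using t(1) R(2) by (subst pos_le_divide_eq) auto
  moreover have "time_average \<Phi> x h t = sp.time R / T R" using time_average_h[OF R(1)] by (simp add: R(2))
  ultimately show "w \<le> s + e" using t(2) by linarith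
qed

end

section \<open>Choice of the scales\<close>

lemma approx_subsequence:
  assumes "approx_sequence \<alpha> Q" "infinite I"
  shows "approx_sequence \<alpha> (\<lambda>i. Q (enumerate I i))"
proof -
  interpret approx_sequence \<alpha> Q by (rule assms(1))
  show ?thesis
  proof
    fix i
    show "good_approx \<alpha> (Q (enumerate I i))" by (rule good)
    show "3 \<le> Q (enumerate I i)" by (rule Q_ge)
    have "2 * Q (enumerate I i) \<le> Q (Suc (enumerate I i))" by (rule doubling)
    also have "\<dots> \<le> Q (enumerate I (Suc i))"
      using enumerate_step[OF assms(2), of i] by (intro Q_mono) simp
    finally show "2 * Q (enumerate I i) \<le> Q (enumerate I (Suc i))" .
  qed
qed

text \<open>If the series restricted to each alternative converged, so would their union. The scales
  of one alternative therefore keep a divergent series, and \<open>AE_infinitely_many_hits\<close>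
  applies along them.\<close>

lemma select_subsequence:
  assumes Q: "approx_sequence \<alpha> Q" and div: "\<not> summable (\<lambda>i. 1 / ln (real (Q i)))"
    and ev: "\<forall>\<^sub>F i in sequentially. A (Q i) \<or> B (Q i)"
  obtains Q' where "approx_sequence \<alpha> Q'" "\<not> summable (\<lambda>i. 1 / ln (real (Q' i)))"
    "(\<forall>i. A (Q' i)) \<or> (\<forall>i. B (Q' i))"
proof -
  interpret approx_sequence \<alpha> Q by (rule Q)
  note conclude = that
  define f where "f i = 1 / ln (real (Q i))" for i
  have f0: "0 \<le> f i" for i unfolding f_def using ln_Q_ge[of i] by (intro divide_nonneg_nonneg) linarith+
  have notS: "\<not> f summable_on UNIV" using div f0 by (subst summable_on_UNIV_nonneg_real_iff) (auto simp: f_def[abs_def])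
  obtain n0 where n0: "\<And>i. i \<ge> n0 \<Longrightarrow> A (Q i) \<or> B (Q i)" using ev unfolding eventually_sequentially by blast
  have "UNIV = {..<n0} \<union> ({i. A (Q i)} \<union> {i. B (Q i)})" using n0 not_less by blast
  then have "\<not> f summable_on {i. A (Q i)} \<or> \<not> f summable_on {i. B (Q i)}"
    using notS by (metis finite_lessThan summable_on_finite summable_on_union)
  moreover have thesis if I: "\<not> f summable_on I" and P: "(\<forall>i\<in>I. A (Q i)) \<or> (\<forall>i\<in>I. B (Q i))" for I
  proof -
    have inf: "infinite I" using I summable_on_finite by blast
    have "\<not> summable (\<lambda>i. f (enumerate I i))" by (rule not_summable_enumerate[OF inf I f0])
    then have "\<not> summable (\<lambda>i. 1 / ln (real (Q (enumerate I i))))" by (simp add: f_def)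
    moreover have "(\<forall>i. A (Q (enumerate I i))) \<or> (\<forall>i. B (Q (enumerate I i)))"
      using P enumerate_in_set[OF inf] by blast
    ultimately show thesis using conclude[OF approx_subsequence[OF Q inf]] by blast
  qed
  ultimately show thesis by blast
qed

text \<open>The condition \<open>well_separated\<close> stripped of the starting point and written
  for the difference \<open>(d1, d2)\<close> of the stopping points, so that scales can be selected
  before an orbit is chosen.\<close>

definition separated_at :: "real \<Rightarrow> real \<Rightarrow> real \<Rightarrow> real \<Rightarrow> nat \<Rightarrow> bool" where
  "separated_at \<alpha> \<rho> d1 d2 Q \<longleftrightarrow> (\<forall>m::int. d1 - 2 * \<rho> \<le> of_int m \<longrightarrow> of_int m \<le> real Q / 4 + 3 \<longrightarrow>
      2 / (real Q * ln (real Q)) \<le> dist_int (d2 - \<alpha> * d1 + of_int m * \<alpha>))"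

text \<open>If both alternatives failed, the two differences would add up to a multiple of \<open>\<alpha>\<close> contradicting
  the separation of the orbit of the rotation.\<close>

lemma separated_either_way:
  assumes ga: "good_approx \<alpha> Q" and ln: "ln (real Q) \<ge> 16" and Q: "Q \<ge> 40" and \<rho>: "0 < \<rho>" "\<rho> \<le> 1 / 8"
    and far: "2 * \<rho> * (1 + \<bar>\<alpha>\<bar>) + 2 / (real Q * ln (real Q)) < dist_int d1 + dist_int d2"
  shows "separated_at \<alpha> \<rho> d1 d2 Q \<or> separated_at \<alpha> \<rho> (- d1) (- d2) Q"
proof (rule ccontr)
  define L where "L = real Q * ln (real Q)"
  assume "\<not> ?thesis"
  then obtain m m' :: int where m: "d1 - 2 * \<rho> \<le> of_int m" "of_int m \<le> real Q / 4 + 3" "dist_int (d2 - \<alpha> * d1 + of_int m * \<alpha>) < 2 / L"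
    and m': "- d1 - 2 * \<rho> \<le> of_int m'" "of_int m' \<le> real Q / 4 + 3" "dist_int (- d2 - \<alpha> * - d1 + of_int m' * \<alpha>) < 2 / L"
    unfolding separated_at_def L_def by (auto simp: not_le)
  have "real Q * 16 \<le> L" using ln unfolding L_def by (intro mult_left_mono) auto
  then have L: "4 / L \<le> 1 / (2 * real Q)" "L > 0" using Q by (auto simp: field_simps)
  have e: "of_int (m + m') * \<alpha> = (d2 - \<alpha> * d1 + of_int m * \<alpha>) + (- d2 - \<alpha> * - d1 + of_int m' * \<alpha>)"
    by (simp add: algebra_simps)
  have "dist_int (of_int (m + m') * \<alpha>) < 2 / L + 2 / L"
    unfolding e using dist_int_triangle m(3) m'(3) by (meson add_strict_mono order_le_less_trans)
  then have small: "dist_int (of_int (m + m') * \<alpha>) < 1 / (2 * real Q)" using L by simp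
  have "real_of_int (m + m') > - 1" using m(1) m'(1) \<rho> by simp
  moreover have "real_of_int (m + m') < real Q" using m(2) m'(2) Q by simp
  ultimately have "\<bar>m + m'\<bar> < int Q" by linarith
  \<comment> \<open>The sum lies strictly between -1 and \<open>Q\<close>, so separation leaves only
    0. Then \<open>m\<close> is within \<open>2 * \<rho>\<close> of \<open>d1\<close>, and
    consequently \<open>d2\<close> is close to an integer too: the stopping points would nearly
    coincide.\<close>
  with small good_approx_separated[OF ga, of "m + m'"] have "m + m' = 0" by fastforce
  then have "real_of_int m' = - of_int m" by linarith
  then have md: "\<bar>of_int m - d1\<bar> \<le> 2 * \<rho>" using m(1) m'(1) by linarith
  have "dist_int d1 \<le> 2 * \<rho>" using dist_int_le[of d1 m] md by linarith
  moreover have "dist_int d2 < 2 / L + 2 * \<rho> * \<bar>\<alpha>\<bar>"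
  proof -
    have "d2 = (d2 - \<alpha> * d1 + of_int m * \<alpha>) - (\<alpha> * (of_int m - d1))" by (simp add: algebra_simps)
    then have "dist_int d2 \<le> dist_int (d2 - \<alpha> * d1 + of_int m * \<alpha>) + dist_int (\<alpha> * (of_int m - d1))"
      by (metis dist_int_triangle_diff)
    moreover have "dist_int (\<alpha> * (of_int m - d1)) \<le> \<bar>\<alpha>\<bar> * (2 * \<rho>)"
      using dist_int_le_abs[of "\<alpha> * (of_int m - d1)"] mult_left_mono[OF md, of "\<bar>\<alpha>\<bar>"] by (simp add: abs_mult)
    ultimately show ?thesis using m(3) by (simp add: algebra_simps)
  qed
  ultimately show False using far by (simp add: L_def algebra_simps)
qed

text \<open>For points on one orbit the parameter \<open>r\<close> cancels, and the height
  difference is \<open>(m - m1) * \<alpha>\<close> modulo 1. The condition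
  \<open>2 * \<rho> < r\<close> makes \<open>m - m1\<close> positive, hence nonzero, and separation
  of the rotation applies.\<close>

lemma separated_same_orbit:
  assumes ga: "good_approx \<alpha> Q" and ln: "ln (real Q) \<ge> 4" and Q: "4 + 2 * \<bar>real_of_int m1\<bar> < real Q / 2"
    and \<rho>: "2 * \<rho> < r"
  shows "separated_at \<alpha> \<rho> (r + of_int m1) (r * \<alpha> + of_int m2) Q"
  unfolding separated_at_def
proof (intro allI impI)
  fix m :: int assume m: "r + of_int m1 - 2 * \<rho> \<le> of_int m" "of_int m \<le> real Q / 4 + 3"
  have Q1: "Q \<ge> 1" using ga by (simp add: good_approx_def)
  have "real_of_int m1 < of_int m" using m(1) \<rho> by linarith
  then have "m - m1 \<noteq> 0" "0 < m - m1" by simp_all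
  moreover have "real_of_int (m - m1) < real Q" using m(2) Q by simp
  then have "m - m1 < int Q" by linarith
  ultimately have "1 / (2 * real Q) \<le> dist_int (of_int (m - m1) * \<alpha>)"
    by (intro good_approx_separated[OF ga]) auto
  moreover have "dist_int (r * \<alpha> + of_int m2 - \<alpha> * (r + of_int m1) + of_int m * \<alpha>) = dist_int (of_int (m - m1) * \<alpha>)"
  proof -
    have "r * \<alpha> + of_int m2 - \<alpha> * (r + of_int m1) + of_int m * \<alpha> = of_int (m - m1) * \<alpha> + of_int m2"
      by (simp add: algebra_simps)
    then show ?thesis by (simp only: dist_int_add_int)
  qed
  moreover have "2 / (real Q * ln (real Q)) \<le> 2 / (real Q * 4)"
    by (intro divide_left_mono mult_left_mono mult_pos_pos ln less_le_trans[OF _ ln]) (use Q1 in auto)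
  ultimately show "2 / (real Q * ln (real Q)) \<le> dist_int (r * \<alpha> + of_int m2 - \<alpha> * (r + of_int m1) + of_int m * \<alpha>)"
    by simp
qed

lemma AE_dist_int_nonzero: "AE b in lborel. \<forall>k::int. dist_int (b + c + of_int k * \<alpha>) \<noteq> 0"
proof (subst AE_all_countable, rule allI)
  fix k :: int
  have "{b. dist_int (b + c + of_int k * \<alpha>) = 0} \<subseteq> range (\<lambda>n::int. of_int n - c - of_int k * \<alpha>)"
  proof
    fix b assume "b \<in> {b. dist_int (b + c + of_int k * \<alpha>) = 0}"
    then obtain n where "b + c + of_int k * \<alpha> = of_int n" by (auto simp: dist_int_eq_0_iff elim!: Ints_cases)
    then have "b = of_int n - c - of_int k * \<alpha>" by simp
    then show "b \<in> range (\<lambda>n::int. of_int n - c - of_int k * \<alpha>)" by blast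
  qed
  then have "countable {b. dist_int (b + c + of_int k * \<alpha>) = 0}" by (rule countable_subset) simp
  then have "{b. dist_int (b + c + of_int k * \<alpha>) = 0} \<in> null_sets lborel" by (rule countable_imp_null_set_lborel)
  from AE_not_in[OF this] show "AE b in lborel. dist_int (b + c + of_int k * \<alpha>) \<noteq> 0" by simp
qed

section \<open>Assembly over almost every starting point\<close>

context stopped_flow
begin

text \<open>The properties of a generic starting point are collected on each vertical line, where
  they concern a single offset. The point \<open>(c1, c2)\<close> is the stopping point whose close
  visits are wanted; being far is required for both at the same scale.\<close>

lemma AE_stopped_lines:
  assumes Q: "approx_sequence \<alpha> Q" and div: "\<not> summable (\<lambda>i. 1 / ln (real (Q i)))"
    and sing: "singularity \<alpha> p1 p2 Ap Bp Cp Gp" "singularity \<alpha> q1 q2 Aq Bq Cq Gq"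
    and imp: "\<And>x1 x2. stopped_line \<alpha> p q \<phi> \<Phi> h \<epsilon> Ap Bp Cp Aq Bq Cq Q x1 x2 \<Longrightarrow>
       (\<And>e i0. e > 0 \<Longrightarrow> \<exists>i\<ge>i0. x2 - c2 - \<alpha> * (x1 - c1) \<in> hits \<alpha> (Q i) (e / (real (Q i) * ln (real (Q i))))) \<Longrightarrow>
       (\<And>i0. \<exists>i\<ge>i0. approx_sequence.far \<alpha> Q (x2 - p2 - \<alpha> * (x1 - p1)) i \<and> approx_sequence.far \<alpha> Q (x2 - q2 - \<alpha> * (x1 - q1)) i) \<Longrightarrow>
       Pr (to_torus (vector [x1, x2]))"
  shows "AE x in haar_torus. Pr x"
proof -
  interpret A: approx_sequence \<alpha> Q by (rule Q)
  interpret sp: singularity \<alpha> p1 p2 Ap Bp Cp Gp by (rule sing(1))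
  interpret sq: singularity \<alpha> q1 q2 Aq Bq Cq Gq by (rule sing(2))
  \<comment> \<open>Only countable quantifiers occur, with \<open>1 / Suc m\<close> in place of a
    real radius, so that joint measurability is automatic.\<close>
  define Good where "Good a b \<longleftrightarrow>
      (\<forall>k::int. dist_int (b - p2 - \<alpha> * (a - p1) + of_int k * \<alpha>) \<noteq> 0) \<and>
      (\<forall>k::int. dist_int (b - q2 - \<alpha> * (a - q1) + of_int k * \<alpha>) \<noteq> 0) \<and>
      (\<forall>m i0. \<exists>i\<ge>i0. \<exists>k::nat. 4 * k < Q i \<and> dist_int (b - c2 - \<alpha> * (a - c1) + real k * \<alpha>) < 1 / real (Suc m) / (real (Q i) * ln (real (Q i)))) \<and>
      (\<forall>i0. \<exists>i\<ge>i0. A.far (b - p2 - \<alpha> * (a - p1)) i \<and> A.far (b - q2 - \<alpha> * (a - q1)) i)" for a b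
  show ?thesis
  proof (rule AE_haar_torusI[of Good])
    show "Measurable.pred (borel \<Otimes>\<^sub>M borel) (\<lambda>(a, b). Good a b)"
      unfolding Good_def A.far_def case_prod_unfold by measurable
    fix a :: real
    have hit: "AE b in lborel. \<forall>m i0. \<exists>i\<ge>i0. \<exists>k::nat. 4 * k < Q i \<and> dist_int (b - c2 - \<alpha> * (a - c1) + real k * \<alpha>) < 1 / real (Suc m) / (real (Q i) * ln (real (Q i)))"
    proof -
      define P where "P z \<longleftrightarrow> (\<forall>m i0. \<exists>i\<ge>i0. \<exists>k::nat. 4 * k < Q i \<and> dist_int (z + real k * \<alpha>) < 1 / real (Suc m) / (real (Q i) * ln (real (Q i))))" for z
      have "AE z in lborel. P z"
        using A.AE_infinitely_many_hits[OF div]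
      proof (rule AE_mp, intro AE_I2 impI)
        fix z assume *: "\<forall>e>0. \<forall>i0. \<exists>i\<ge>i0. z \<in> hits \<alpha> (Q i) (A.\<delta> e i)"
        have "\<exists>i\<ge>i0. z \<in> hits \<alpha> (Q i) (A.\<delta> (1 / real (Suc m)) i)" for i0 m
          by (rule *[rule_format]) simp
        then show "P z" unfolding P_def hits_def mem_Collect_eq by blast
      qed
      moreover have "Measurable.pred borel P" unfolding P_def by measurable
      ultimately have "AE b in lborel. P (- c2 - \<alpha> * (a - c1) + 1 * b)"
        by (intro AE_borel_affine) auto
      moreover have "- c2 - \<alpha> * (a - c1) + 1 * b = b - c2 - \<alpha> * (a - c1)" for b by simp
      ultimately have "AE b in lborel. P (b - c2 - \<alpha> * (a - c1))" by (simp only:)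
      then show ?thesis unfolding P_def .
    qed
    have far: "AE b in lborel. \<forall>i0. \<exists>i\<ge>i0. A.far (b - p2 - \<alpha> * (a - p1)) i \<and> A.far (b - q2 - \<alpha> * (a - q1)) i"
      using A.AE_infinitely_many_far[of "- p2 - \<alpha> * (a - p1)" "- q2 - \<alpha> * (a - q1)"] by (simp add: algebra_simps)
    have np: "AE b in lborel. \<forall>k::int. dist_int (b - p2 - \<alpha> * (a - p1) + of_int k * \<alpha>) \<noteq> 0"
      using AE_dist_int_nonzero[of "- p2 - \<alpha> * (a - p1)" \<alpha>] by (simp add: algebra_simps)
    have nq: "AE b in lborel. \<forall>k::int. dist_int (b - q2 - \<alpha> * (a - q1) + of_int k * \<alpha>) \<noteq> 0"
      using AE_dist_int_nonzero[of "- q2 - \<alpha> * (a - q1)" \<alpha>] by (simp add: algebra_simps)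
    show "AE b in lborel. Good a b"
      using hit far np nq unfolding Good_def by eventually_elim blast
  next
    fix a b :: real assume ab: "0 \<le> a" "a < 1" "0 \<le> b" "b < 1" and good: "Good a b"
    have line: "stopped_line \<alpha> p q \<phi> \<Phi> h \<epsilon> Ap Bp Cp Aq Bq Cq Q a b"
    proof unfold_locales
      show "sp.off_orbit a b"
        using good unfolding Good_def sp.off_orbit_def sp.offset_def dist_int_eq_0_iff by blast
      show "sq.off_orbit a b"
        using good unfolding Good_def sq.off_orbit_def sq.offset_def dist_int_eq_0_iff by blast
      show "\<bar>p1 - a\<bar> \<le> 1" "\<bar>q1 - a\<bar> \<le> 1"
        using ab frac_ge_0 frac_lt_1 by (smt (verit))+
    qed
    show "Pr (to_torus (vector [a, b]))"
    proof (rule imp[OF line])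
      fix e :: real and i0 assume "e > 0"
      obtain m where m: "inverse (real (Suc m)) < e" using reals_Archimedean[OF \<open>e > 0\<close>] by blast
      obtain i k where i: "i \<ge> i0" "4 * k < Q i" "dist_int (b - c2 - \<alpha> * (a - c1) + real k * \<alpha>) < 1 / real (Suc m) / (real (Q i) * ln (real (Q i)))"
        using good unfolding Good_def by blast
      have "1 / real (Suc m) / (real (Q i) * ln (real (Q i))) \<le> e / (real (Q i) * ln (real (Q i)))"
        using m A.ln_Q_ge[of i] by (intro divide_right_mono mult_nonneg_nonneg) (auto simp: inverse_eq_divide)
      with i show "\<exists>i\<ge>i0. b - c2 - \<alpha> * (a - c1) \<in> hits \<alpha> (Q i) (e / (real (Q i) * ln (real (Q i))))"
        unfolding hits_def by (blast intro: less_le_trans)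
    qed (use good in \<open>auto simp: Good_def\<close>)
  qed
qed

end

lemma separation_eventually:
  assumes "approx_sequence \<alpha> Q" and "0 < d"
  shows "\<forall>\<^sub>F i in sequentially. ln (real (Q i)) \<ge> 16 \<and> Q i \<ge> 40 \<and> K \<le> real (Q i) \<and> 2 / (real (Q i) * ln (real (Q i))) < d"
proof -
  interpret approx_sequence \<alpha> Q by (rule assms(1))
  have "\<forall>\<^sub>F i in sequentially. ln (real (Q i)) \<ge> max (max 16 K) (max 40 (2 / d))"
    using ln_Q_at_top unfolding filterlim_at_top by blast
  then show ?thesis
  proof eventually_elim
    case (elim i)
    have "ln (real (Q i)) \<le> real (Q i) - 1" using Q_ge[of i] by (intro ln_le_minus_one) simp
    then have Q: "real (Q i) > max (max 16 K) (max 40 (2 / d))" using elim by linarith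
    have "2 / d * 1 < real (Q i) * ln (real (Q i))"
      using Q elim assms(2) by (intro mult_strict_mono') auto
    then have "2 / (real (Q i) * ln (real (Q i))) < d" using assms(2) Q elim by (simp add: field_simps)
    then show ?case using Q elim by simp
  qed
qed

context stopped_flow
begin

text \<open>Along the selected scales one stopping point is approached without prior equally close
  visits to the other, so the share of \<open>p\<close> accumulates at 1 or at 0. It also
  accumulates at an interior value, and different values give different limit measures.\<close>

lemma historic_of_approx_sequence:
  assumes Q0: "approx_sequence \<alpha> Q0" "\<not> summable (\<lambda>i. 1 / ln (real (Q0 i)))"
  shows "historic_behaviour \<Phi>"
proof -
  obtain Ap Bp Cp where sp: "singularity \<alpha> p1 p2 Ap Bp Cp Gp" by (rule singularity_p)
  obtain Aq Bq Cq where sq: "singularity \<alpha> q1 q2 Aq Bq Cq Gq" by (rule singularity_q)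
  define d where "d = dist_int (q1 - p1) + dist_int (q2 - p2)"
  have "d \<noteq> 0"
  proof
    assume "d = 0"
    then have "dist_int (q1 - p1) = 0" "dist_int (q2 - p2) = 0" unfolding d_def by (smt (verit) dist_int_nonneg)+
    then have "to_torus (frac_vec (torus_rep q)) = to_torus (frac_vec (torus_rep p))"
      unfolding to_torus_eq_iff forall_2 dist_int_eq_0_iff by (simp add: frac_vec_def)
    then show False using pq by simp
  qed
  then have d: "d > 0" by (simp add: d_def less_le)
  \<comment> \<open>Half of the distance \<open>d\<close> is reserved for the displacement
    \<open>2 * \<rho> * (1 + \<bar>\<alpha>\<bar>)\<close>, the other half for
    \<open>2 / (Q ln Q)\<close> at large scales.\<close>
  define \<rho> where "\<rho> = min (1 / 8) (d / (4 * (1 + \<bar>\<alpha>\<bar>)))"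
  have \<rho>: "\<rho> \<le> 1 / 8" "\<rho> \<le> d / (4 * (1 + \<bar>\<alpha>\<bar>))"
    unfolding \<rho>_def by (rule min.cobounded1, rule min.cobounded2)
  have \<rho>0: "0 < \<rho>" using d by (simp add: \<rho>_def add_pos_nonneg)
  have "2 * \<rho> * (1 + \<bar>\<alpha>\<bar>) \<le> 2 * (d / (4 * (1 + \<bar>\<alpha>\<bar>))) * (1 + \<bar>\<alpha>\<bar>)"
    by (intro mult_right_mono mult_left_mono \<rho>(2)) auto
  also have "\<dots> = d / 2"
  proof -
    have "1 + \<bar>\<alpha>\<bar> \<noteq> 0" by linarith
    then show ?thesis by (simp add: field_simps)
  qed
  finally have \<rho>d: "2 * \<rho> * (1 + \<bar>\<alpha>\<bar>) \<le> d / 2" .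
  have "\<forall>\<^sub>F i in sequentially. separated_at \<alpha> \<rho> (q1 - p1) (q2 - p2) (Q0 i) \<or> separated_at \<alpha> \<rho> (p1 - q1) (p2 - q2) (Q0 i)"
    using separation_eventually[OF Q0(1) half_gt_zero[OF d], of 0]
  proof eventually_elim
    case (elim i)
    then have "separated_at \<alpha> \<rho> (q1 - p1) (q2 - p2) (Q0 i) \<or> separated_at \<alpha> \<rho> (- (q1 - p1)) (- (q2 - p2)) (Q0 i)"
      using \<rho>d \<rho>0 \<rho>(1) approx_sequence.good[OF Q0(1)] by (intro separated_either_way) (auto simp: d_def)
    then show ?case by simp
  qed
  then obtain Q where Q: "approx_sequence \<alpha> Q" "\<not> summable (\<lambda>i. 1 / ln (real (Q i)))"
    and sep: "(\<forall>i. separated_at \<alpha> \<rho> (q1 - p1) (q2 - p2) (Q i)) \<or> (\<forall>i. separated_at \<alpha> \<rho> (p1 - q1) (p2 - q2) (Q i))"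
    by (rule select_subsequence[OF Q0, of "separated_at \<alpha> \<rho> (q1 - p1) (q2 - p2)" "separated_at \<alpha> \<rho> (p1 - q1) (p2 - q2)"])
  from sep show ?thesis
  proof
    assume sep: "\<forall>i. separated_at \<alpha> \<rho> (q1 - p1) (q2 - p2) (Q i)"
    show ?thesis
      unfolding historic_behaviour_def
    proof (rule AE_stopped_lines[OF Q sp sq, of p2 p1])
      fix x1 x2
      assume "stopped_line \<alpha> p q \<phi> \<Phi> h \<epsilon> Ap Bp Cp Aq Bq Cq Q x1 x2"
      then interpret stopped_line \<alpha> p q \<phi> \<Phi> h \<epsilon> Ap Bp Cp Aq Bq Cq Q x1 x2 .
      assume hits: "\<And>e i0. e > 0 \<Longrightarrow> \<exists>i\<ge>i0. x2 - p2 - \<alpha> * (x1 - p1) \<in> hits \<alpha> (Q i) (e / (real (Q i) * ln (real (Q i))))"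
        and far: "\<And>i0. \<exists>i\<ge>i0. sp.far (x2 - p2 - \<alpha> * (x1 - p1)) i \<and> sp.far (x2 - q2 - \<alpha> * (x1 - q1)) i"
      have "accumulates 1"
      proof (rule accumulates_1I, rule share_near_one[OF _ \<rho>0])
        show "\<exists>i\<ge>i0. sp.y \<in> hits \<alpha> (Q i) (sp.\<delta> e i)" if "e > 0" for e i0
          unfolding sp.offset_def by (rule hits[OF that])
        show "\<forall>\<^sub>F i in sequentially. well_separated \<rho> i"
          using sep by (intro always_eventually) (simp add: well_separated_def separated_at_def)
      qed
      moreover obtain s where s: "0 < s" "s < 1" "accumulates s"
        by (rule accumulates_interior) (use far in \<open>simp add: sp.offset_def sq.offset_def\<close>)
      moreover have "mix 1 \<noteq> mix s" using mix_inject[of 1 s] s by auto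
      ultimately show "\<exists>\<mu>\<in>p_omega \<Phi> (to_torus (vector [x1, x2])). \<exists>\<nu>\<in>p_omega \<Phi> (to_torus (vector [x1, x2])). \<mu> \<noteq> \<nu>"
        using mix_in_p_omega_iff[of 1] mix_in_p_omega_iff[of s] by (intro bexI[of _ "mix 1"] bexI[of _ "mix s"]) auto
    qed
  next
    assume sep: "\<forall>i. separated_at \<alpha> \<rho> (p1 - q1) (p2 - q2) (Q i)"
    show ?thesis
      unfolding historic_behaviour_def
    proof (rule AE_stopped_lines[OF Q sp sq, of q2 q1])
      fix x1 x2
      assume "stopped_line \<alpha> p q \<phi> \<Phi> h \<epsilon> Ap Bp Cp Aq Bq Cq Q x1 x2"
      then interpret stopped_line \<alpha> p q \<phi> \<Phi> h \<epsilon> Ap Bp Cp Aq Bq Cq Q x1 x2 .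
      \<comment> \<open>The same line with the roles of the stopping points exchanged; a share of
        \<open>q\<close> near 1 is a share of \<open>p\<close> near 0.\<close>
      interpret sw: two_lines \<alpha> q1 q2 Aq Bq Cq Gq p1 p2 Ap Bp Cp Gp Q x1 x2 by unfold_locales
      assume hits: "\<And>e i0. e > 0 \<Longrightarrow> \<exists>i\<ge>i0. x2 - q2 - \<alpha> * (x1 - q1) \<in> hits \<alpha> (Q i) (e / (real (Q i) * ln (real (Q i))))"
        and far: "\<And>i0. \<exists>i\<ge>i0. sp.far (x2 - p2 - \<alpha> * (x1 - p1)) i \<and> sp.far (x2 - q2 - \<alpha> * (x1 - q1)) i"
      have T: "sw.T R = T R" for R by (simp add: sw.T_def T_def)
      have "accumulates 0"
      proof (rule accumulates_0I, unfold T[symmetric], rule sw.share_near_one[OF _ \<rho>0])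
        show "\<exists>i\<ge>i0. sq.y \<in> hits \<alpha> (Q i) (sp.\<delta> e i)" if "e > 0" for e i0
          unfolding sq.offset_def by (rule hits[OF that])
        show "\<forall>\<^sub>F i in sequentially. sw.well_separated \<rho> i"
          using sep by (intro always_eventually) (simp add: sw.well_separated_def separated_at_def)
      qed
      moreover obtain s where s: "0 < s" "s < 1" "accumulates s"
        by (rule accumulates_interior) (use far in \<open>simp add: sp.offset_def sq.offset_def\<close>)
      moreover have "mix 0 \<noteq> mix s" using mix_inject[of 0 s] s by auto
      ultimately show "\<exists>\<mu>\<in>p_omega \<Phi> (to_torus (vector [x1, x2])). \<exists>\<nu>\<in>p_omega \<Phi> (to_torus (vector [x1, x2])). \<mu> \<noteq> \<nu>"
        using mix_in_p_omega_iff[of 0] mix_in_p_omega_iff[of s] by (intro bexI[of _ "mix 0"] bexI[of _ "mix s"]) auto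
    qed
  qed
qed

text \<open>A combination with weight \<open>t\<close> on \<open>mix w\<close> puts mass
  \<open>t * (1 - w)\<close> on \<open>q\<close>, so the segment is parametrised by the mass at
  \<open>p\<close>, which runs from \<open>w\<close> to 1.\<close>

lemma measure_segment_mix:
  assumes w: "0 \<le> w" "w \<le> 1"
  shows "measure_segment (mix w) (dirac p) = {mix s | s. w \<le> s \<and> s \<le> 1}"
proof -
  have eq: "lincomb_measure t (mix w) (1 - t) (dirac p) = mix (1 - t * (1 - w))" if t: "0 \<le> t" "t \<le> 1" for t
  proof (rule measure_eqI)
    show sets: "sets (lincomb_measure t (mix w) (1 - t) (dirac p)) = sets (mix (1 - t * (1 - w)))"
      unfolding sets_mix lincomb_measure_def by (metis sets.sigma_sets_eq sets_measure_of space_borel sets.space_closed)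
    fix A assume "A \<in> sets (lincomb_measure t (mix w) (1 - t) (dirac p))"
    then have A: "A \<in> sets borel" unfolding sets by simp
    have "emeasure (lincomb_measure t (mix w) (1 - t) (dirac p)) A
        = ennreal t * (ennreal w * indicator A p + ennreal (1 - w) * indicator A q) + ennreal (1 - t) * indicator A p"
      using A by (subst emeasure_lincomb_measure) (auto simp: emeasure_mix dirac_def)
    also have "\<dots> = (ennreal (t * w) + ennreal (1 - t)) * indicator A p + ennreal (t * (1 - w)) * indicator A q"
    proof -
      have "ennreal (t * w) = ennreal t * ennreal w" "ennreal (t * (1 - w)) = ennreal t * ennreal (1 - w)"
        using t w by (intro ennreal_mult; simp)+
      then show ?thesis by (simp add: distrib_left distrib_right mult_ac add_ac)
    qed
    also have "ennreal (t * w) + ennreal (1 - t) = ennreal (1 - t * (1 - w))"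
      using t w by (simp add: ennreal_plus[symmetric] algebra_simps del: ennreal_plus)
    also have "t * (1 - w) = 1 - (1 - t * (1 - w))" by simp
    finally show "emeasure (lincomb_measure t (mix w) (1 - t) (dirac p)) A = emeasure (mix (1 - t * (1 - w))) A"
      using A by (simp add: emeasure_mix)
  qed
  show ?thesis
  proof (intro set_eqI iffI)
    fix \<mu> assume "\<mu> \<in> measure_segment (mix w) (dirac p)"
    then obtain t where t: "0 \<le> t" "t \<le> 1" "\<mu> = lincomb_measure t (mix w) (1 - t) (dirac p)"
      unfolding measure_segment_def by blast
    have "t * (1 - w) \<le> 1 * (1 - w)" using t w by (intro mult_right_mono) auto
    moreover have "0 \<le> t * (1 - w)" using t w by simp
    ultimately show "\<mu> \<in> {mix s | s. w \<le> s \<and> s \<le> 1}" using t eq[OF t(1,2)] by auto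
  next
    fix \<mu> assume "\<mu> \<in> {mix s | s. w \<le> s \<and> s \<le> 1}"
    then obtain s where s: "w \<le> s" "s \<le> 1" "\<mu> = mix s" by blast
    obtain t where t: "0 \<le> t" "t \<le> 1" "1 - t * (1 - w) = s"
    \<comment> \<open>In this case the segment degenerates to one point and the division below would
      be meaningless.\<close>
    proof (cases "w = 1")
      case True
      then show thesis using s that[of 0] by simp
    next
      case False
      then have "1 - w > 0" using w by simp
      then show thesis using s by (intro that[of "(1 - s) / (1 - w)"]) (auto simp: field_simps)
    qed
    then have "\<mu> = lincomb_measure t (mix w) (1 - t) (dirac p)" using eq[OF t(1,2)] s(3) by simp
    then show "\<mu> \<in> measure_segment (mix w) (dirac p)" using t(1,2) unfolding measure_segment_def by blast
  qed
qed

text \<open>The cluster values of the share of \<open>p\<close> are exactly those from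
  \<open>w\<close> to 1: nothing lies below \<open>w\<close> because \<open>q\<close> only repeats
  passages of \<open>p\<close>, the value \<open>w\<close> is attained by
  \<open>share_limsup_le\<close>, the value 1 by close visits to \<open>p\<close>, and the rest by
  continuity.\<close>

lemma p_omega_same_orbit:
  assumes Q: "approx_sequence \<alpha> Q" "\<not> summable (\<lambda>i. 1 / ln (real (Q i)))"
    and r: "r > 0" "q = p + to_torus (r *\<^sub>R direction \<alpha>)"
  shows "AE x in haar_torus. p_omega \<Phi> x = measure_segment (mu_infinity \<phi> p q) (dirac p)"
proof -
  obtain Ap Bp Cp where sp: "singularity \<alpha> p1 p2 Ap Bp Cp Gp" and dp: "Ap * Cp - Bp\<^sup>2 = det (hessian_torus \<phi> p)"
    by (rule singularity_p)
  obtain Aq Bq Cq where sq: "singularity \<alpha> q1 q2 Aq Bq Cq Gq" and dq: "Aq * Cq - Bq\<^sup>2 = det (hessian_torus \<phi> q)"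
    by (rule singularity_q)
  have "to_torus (frac_vec (torus_rep q)) = to_torus (frac_vec (torus_rep p) + r *\<^sub>R direction \<alpha>)"
    using r(2) by (simp add: to_torus_add)
  then have "q1 - (p1 + r) \<in> \<int>" "q2 - (p2 + r * \<alpha>) \<in> \<int>"
    unfolding to_torus_eq_iff forall_2 by (simp_all add: frac_vec_def)
  then obtain m1 m2 :: int where "q1 - (p1 + r) = of_int m1" "q2 - (p2 + r * \<alpha>) = of_int m2" by (auto elim!: Ints_cases)
  then have m: "q1 = p1 + r + of_int m1" "q2 = p2 + r * \<alpha> + of_int m2" by simp_all
  define w where "w = sqrt (det (hessian_torus \<phi> q)) / (sqrt (det (hessian_torus \<phi> p)) + sqrt (det (hessian_torus \<phi> q)))"
  have det: "det (hessian_torus \<phi> p) > 0" "det (hessian_torus \<phi> q) > 0"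
    using singularity.disc_pos[OF sp] singularity.disc_pos[OF sq] dp dq by simp_all
  define sdp sdq where "sdp = sqrt (det (hessian_torus \<phi> p))" and "sdq = sqrt (det (hessian_torus \<phi> q))"
  have sd: "sdp > 0" "sdq > 0" using det by (simp_all add: sdp_def sdq_def)
  have w: "w = sdq / (sdp + sdq)" "0 \<le> w" "w \<le> 1" "1 - w = sdp / (sdp + sdq)"
    using sd by (auto simp: w_def sdp_def[symmetric] sdq_def[symmetric] field_simps)
  have mu: "mu_infinity \<phi> p q = mix w"
    unfolding mix_def w(4) unfolding mu_infinity_def Let_def w_def sdp_def sdq_def ..
  have sep: "\<forall>\<^sub>F i in sequentially. separated_at \<alpha> (r / 4) (q1 - p1) (q2 - p2) (Q i)"
    using separation_eventually[OF Q(1) zero_less_one, of "2 * (5 + 2 * \<bar>real_of_int m1\<bar>)"]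
  proof eventually_elim
    case (elim i)
    then have "separated_at \<alpha> (r / 4) (r + of_int m1) (r * \<alpha> + of_int m2) (Q i)"
      using r approx_sequence.good[OF Q(1)] by (intro separated_same_orbit) auto
    moreover have "q1 - p1 = r + of_int m1" "q2 - p2 = r * \<alpha> + of_int m2" using m by simp_all
    ultimately show ?case by simp
  qed
  show ?thesis
  proof (rule AE_stopped_lines[OF Q sp sq, of p2 p1])
    fix x1 x2
    assume "stopped_line \<alpha> p q \<phi> \<Phi> h \<epsilon> Ap Bp Cp Aq Bq Cq Q x1 x2"
    then interpret stopped_line \<alpha> p q \<phi> \<Phi> h \<epsilon> Ap Bp Cp Aq Bq Cq Q x1 x2 .
    interpret so: two_lines_same_orbit \<alpha> p1 p2 Ap Bp Cp Gp q1 q2 Aq Bq Cq Gq Q x1 x2 r m1 m2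
      by unfold_locales (use r m in auto)
    assume hits: "\<And>e i0. e > 0 \<Longrightarrow> \<exists>i\<ge>i0. x2 - p2 - \<alpha> * (x1 - p1) \<in> hits \<alpha> (Q i) (e / (real (Q i) * ln (real (Q i))))"
      and far: "\<And>i0. \<exists>i\<ge>i0. sp.far (x2 - p2 - \<alpha> * (x1 - p1)) i \<and> sp.far (x2 - q2 - \<alpha> * (x1 - q1)) i"
    have "sp.\<Theta> = sdp" "sq.\<Theta> = sdq" by (simp_all add: sp.\<Theta>_def sq.\<Theta>_def dp dq sdp_def sdq_def)
    then have "sp.\<kappa> = 2 * pi / sdp" "sq.\<kappa> = 2 * pi / sdq" by (simp_all add: sp.\<kappa>_def sq.\<kappa>_def)
    then have "so.share = (2 * pi / sdp) / (2 * pi / sdp + 2 * pi / sdq)" by (simp add: so.share_def)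
    also have "\<dots> = w"
    proof -
      have "2 * pi / sdp + 2 * pi / sdq = 2 * pi * (sdp + sdq) / (sdp * sdq)" using sd by (simp add: field_simps)
      then show ?thesis using sd by (simp add: w(1))
    qed
    finally have share: "so.share = w" .
    have acc1: "accumulates 1"
    proof (rule accumulates_1I, rule share_near_one)
      show "\<exists>i\<ge>i0. sp.y \<in> hits \<alpha> (Q i) (sp.\<delta> e i)" if "e > 0" for e i0
        unfolding sp.offset_def by (rule hits[OF that])
      show "r / 4 > 0" using r by simp
      show "\<forall>\<^sub>F i in sequentially. well_separated (r / 4) i"
        using sep by (simp add: well_separated_def separated_at_def)
    qed
    have far_p: "\<exists>i\<ge>i0. sp.far sp.y i" for i0 using far[of i0] by (auto simp: sp.offset_def)
    have liminf: "\<exists>R0. \<forall>R\<ge>R0. (w - e) * T R \<le> sp.time R" if e: "e > 0" for e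
    proof -
      obtain R0 where "\<And>R. R \<ge> R0 \<Longrightarrow> (so.share - e) * T R \<le> sp.time R"
        by (rule so.share_liminf[OF e]) blast
      then show ?thesis unfolding share by blast
    qed
    have ge: "w \<le> s" if "accumulates s" for s
      by (rule accumulates_ge[OF liminf that])
    have accw: "accumulates w"
    proof (rule accumulatesI)
      fix e B :: real assume e: "e > 0" and "B \<ge> 1"
      obtain R0 where R0: "\<And>R. R \<ge> R0 \<Longrightarrow> (w - e) * T R \<le> sp.time R"
        using liminf[OF e] by blast
      obtain R where R: "R \<ge> 0" "max B (T (max R0 0) + 1) \<le> T R" "sp.time R \<le> (w + e) * T R"
        using so.share_limsup_le[OF far_p e, of "max B (T (max R0 0) + 1)"] unfolding share by blast
      \<comment> \<open>The size of \<open>T R\<close> pushes \<open>R\<close> beyond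
        \<open>R0\<close>, so the bounds from below and from above hold at the same
        \<open>R\<close>.\<close>
      have "\<not> R \<le> max R0 0"
      proof
        assume "R \<le> max R0 0"
        then have "T R \<le> T (max R0 0)" unfolding T_def by (intro add_mono sp.time_mono sq.time_mono)
        then show False using R(2) by simp
      qed
      then have "(w - e) * T R \<le> sp.time R" by (intro R0) auto
      with R show "\<exists>R\<ge>0. B \<le> T R \<and> \<bar>sp.time R - w * T R\<bar> \<le> e * T R"
        by (intro exI[of _ R]) (auto simp: abs_le_iff algebra_simps)
    qed
    have "accumulates s \<longleftrightarrow> w \<le> s" if "s \<le> 1" for s
      using ge accumulates_between[OF accw acc1 _ that] by blast
    then have "{mix s | s. 0 \<le> s \<and> s \<le> 1 \<and> accumulates s} = {mix s | s. w \<le> s \<and> s \<le> 1}"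
      using w(2) by fastforce
    then show "p_omega \<Phi> (to_torus (vector [x1, x2])) = measure_segment (mu_infinity \<phi> p q) (dirac p)"
      unfolding p_omega_eq mu measure_segment_mix[OF w(2,3)] .
  qed
qed

end

theorem theorem7p1:
  fixes \<alpha> :: real and a :: "nat \<Rightarrow> int"
    and p q :: torus and \<phi> :: "torus \<Rightarrow> real" and \<Phi> :: "real \<Rightarrow> torus \<Rightarrow> torus"
  assumes "\<alpha> \<notin> \<rat>"
    and "has_cfrac_expansion \<alpha> a"
    and "infinite {n. 2 \<le> a n}"
    and "(\<Sum>\<^sub>\<infinity>n\<in>{n. 2 \<le> n \<and> 2 \<le> a n \<and> 2 \<le> a (n + 1)}.
            ennreal (1 / ln (real_of_int (convergent_denom a n)))) = \<infinity>"
    and "reparametrized_linear_flow \<alpha> p q \<phi> \<Phi>"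
  shows "historic_behaviour \<Phi> \<and>
    ((\<exists>r>0. q = p + to_torus (r *\<^sub>R direction \<alpha>)) \<longrightarrow>
      (AE x in haar_torus. p_omega \<Phi> x = measure_segment (mu_infinity \<phi> p q) (dirac p)))"
proof -
  define S where "S = {n. 2 \<le> n \<and> 2 \<le> a n \<and> 2 \<le> a (n + 1)}"
  define f where "f n = 1 / ln (real_of_int (convergent_denom a n))" for n
  have a: "\<And>k. k \<ge> 1 \<Longrightarrow> 1 \<le> a k" using assms(2) by (auto simp: has_cfrac_expansion_def)
  have den: "1 \<le> convergent_denom a n" for n
    by (subst convergent_denom_eq) (auto intro: a cf_den_pos)
  have f0: "0 \<le> f n" for n using den[of n] by (simp add: f_def)
  have ns: "\<not> f summable_on S"
    using assms(4) f0 by (intro not_summable_on_of_infsum_ennreal) (simp_all add: f_def S_def)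
  then have inf: "infinite S" using summable_on_finite by blast
  define Q where "Q i = nat (convergent_denom a (enumerate S i))" for i
  have Q: "approx_sequence \<alpha> Q"
    using approx_sequence_of_cfrac[OF assms(2) inf] by (simp add: S_def Q_def[abs_def])
  have "\<not> summable (\<lambda>i. f (enumerate S i))" by (rule not_summable_enumerate[OF inf ns f0])
  moreover have "f (enumerate S i) = 1 / ln (real (Q i))" for i
    using den[of "enumerate S i"] by (simp add: f_def Q_def)
  ultimately have div: "\<not> summable (\<lambda>i. 1 / ln (real (Q i)))" by simp
  have "p \<noteq> q" using assms(5) by (simp add: reparametrized_linear_flow_def)
  then show ?thesis
  proof (rule exists_cutoff)
    fix h :: "torus \<Rightarrow> real" and \<epsilon>
    assume "continuous_on UNIV h" "\<And>x. 0 \<le> h x" "\<And>x. h x \<le> 1" "\<epsilon> > 0"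
      "\<And>v. (\<forall>i. dist_int (v $ i - torus_rep p $ i) < \<epsilon>) \<Longrightarrow> h (to_torus v) = 1"
      "\<And>v. (\<forall>i. dist_int (v $ i - torus_rep q $ i) < \<epsilon>) \<Longrightarrow> h (to_torus v) = 0"
    then interpret stopped_flow \<alpha> p q \<phi> \<Phi> h \<epsilon> using assms(5) by unfold_locales
    show ?thesis using historic_of_approx_sequence[OF Q div] p_omega_same_orbit[OF Q div] by blast
  qed
qed

end
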